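(* (1) There is no abelian cellular automaton with commuting endomorphisms which strongly randomizes the class of harmonically mixing measures. (2) Moreover, for any finite abelian group $G$ there exists $N\in\mathbb N$ such that, for any abelian cellular automaton $F$ over $G$ with commuting endomorphisms, the following are equivalent: (i) $F$ randomizes in density (the class of harmonically mixing measures); (ii) $\mathrm{rank}(F^N(c))\ge 2$ for any finite configuration $c$ of rank $1$; (iii) $F$ randomizes in density on cylinders of length $1$ (the class of harmonically mixing measures).
   Context: $(G,+)$ is a finite abelian group with neutral element $0$; $G^{\mathbb Z}$ has the product topology and componentwise group structure; $\sigma(x)=(x_{i+1})_i$ is the shift. An abelian cellular automaton over $G$ is a continuous group endomorphism $F$ of $G^{\mathbb Z}$ commuting with $\sigma$; equivalently $F(x)_z=\sum_{i\in\mathcal N}\phi_i(x_{z+i})$ with $\mathcal N\subset\mathbb Z$ finite and $\phi_i$ endomorphisms of $G$. $F$ has commuting endomorphisms if the $\phi_i$ commute pairwise. A finite configuration has $x_i=0$ for all but finitely many $i$; its rank is the number of $i$ with $x_i\neq0$. For $u\in G^n$ and $k\in\mathbb Z$, $[u]_k=\{x\in G^{\mathbb Z}: x_{k}\cdots x_{k+n-1}=u\}$. For a Borel probability measure $\mu$ on $G^{\mathbb Z}$, $F\mu(U)=\mu(F^{-1}U)$. $\lambda$ is the uniform Bernoulli measure on $G^{\mathbb Z}$. $F$ strongly randomizes a class of measures if $F^t\mu\to\lambda$ weak-$*$ for every $\mu$ in the class. The lower density of $X\subseteq\mathbb N$ is $\liminf_n|\{i\in X:i\le n\}|/n$. $F$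 randomizes the class in density if for every $\mu$ in the class there is an increasing sequence $(\varphi(t))_t$ of lower density $1$ with $F^{\varphi(t)}\mu\to\lambda$ weak-$*$. $F$ randomizes the class in density on cylinders of length $1$ if for every $\mu$ in the class, every $u\in G$ and every $k\in\mathbb Z$, there is an increasing sequence $(\varphi(t))_t$ of lower density $1$ with $F^{\varphi(t)}\mu([u]_k)\to\lambda([u]_k)=1/|G|$. A character of $G^{\mathbb Z}$ is a continuous homomorphism $\chi$ to the unit circle, written uniquely $\chi(x)=\prod_k\chi_k(x_k)$ with $\chi_k$ characters of $G$, all but finitely many trivial; $\mathrm{rank}(\chi)=|\{k:\chi_k\neq\mathbf 1\}|$. $\mu$ is harmonically mixing if for all $\varepsilon>0$ there is $R>0$ such that $\mathrm{rank}(\chi)>R$ implies $\left|\int\chi\,d\mu\right|<\varepsilon$.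
   Formalization: Part (1) is stated for groups G with at least two elements; for the trivial group the configuration space is a single point and the identity automaton strongly randomizes the class, so the claim as literally written fails there. *)

theory Defs
  imports "HOL-Probability.Probability" "HOL-Library.Function_Algebras"
begin

(* The finite abelian group G is a type of sort {ab_group_add, finite, discrete_topology}. On
   configurations int => G, the library instances for the function type give the product
   topology, and Function_Algebras gives the componentwise group structure. *)

type_synonym 'g config = "int \<Rightarrow> 'g"

definition shift :: "'g config \<Rightarrow> 'g config" where
  "shift x = (\<lambda>i. x (i + 1))"

definition endomorphism :: "('a::ab_group_add \<Rightarrow> 'a) \<Rightarrow> bool" where
  "endomorphism f \<longleftrightarrow> (\<forall>x y. f (x + y) = f x + f y)"

definition abelian_ca ::
  "('g::{ab_group_add, finite, discrete_topology} config \<Rightarrow> 'g config) \<Rightarrow> bool" where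
  "abelian_ca F \<longleftrightarrow> continuous_on UNIV F \<and> endomorphism F \<and> F \<circ> shift = shift \<circ> F"

(* The coefficients phi i (i in N) of such a representation are determined by F up to adding or
   removing zero coefficients, so the existential quantifier involves no choice. *)
definition commuting_endomorphisms :: "('g::ab_group_add config \<Rightarrow> 'g config) \<Rightarrow> bool" where
  "commuting_endomorphisms F \<longleftrightarrow>
     (\<exists>(N :: int set) (\<phi> :: int \<Rightarrow> 'g \<Rightarrow> 'g).
        finite N \<and> (\<forall>i\<in>N. endomorphism (\<phi> i)) \<and>
        (\<forall>x z. F x z = (\<Sum>i\<in>N. \<phi> i (x (z + i)))) \<and>
        (\<forall>i\<in>N. \<forall>j\<in>N. \<phi> i \<circ> \<phi> j = \<phi> j \<circ> \<phi> i))"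

definition finite_config :: "'g::zero config \<Rightarrow> bool" where
  "finite_config c \<longleftrightarrow> finite {i. c i \<noteq> 0}"

(* Meaningful for finite configurations only: card of an infinite set is 0. *)
definition config_rank :: "'g::zero config \<Rightarrow> nat" where
  "config_rank c = card {i. c i \<noteq> 0}"

definition cylinder :: "'g list \<Rightarrow> int \<Rightarrow> 'g config set" where
  "cylinder u k = {x. \<forall>j<length u. x (k + int j) = u ! j}"

definition borel_probability_measure :: "'a::topological_space measure \<Rightarrow> bool" where
  "borel_probability_measure \<mu> \<longleftrightarrow> prob_space \<mu> \<and> sets \<mu> = sets borel"

definition uniform_bernoulli :: "'g::finite config measure" where
  "uniform_bernoulli = PiM UNIV (\<lambda>_. uniform_count_measure UNIV)"

definition push :: "('a::topological_space \<Rightarrow> 'a) \<Rightarrow> 'a measure \<Rightarrow> 'a measure" where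
  "push F \<mu> = distr \<mu> borel F"

(* Test functions need no boundedness condition, since the space of configurations is compact. *)
definition weak_star_limit ::
  "(nat \<Rightarrow> 'g::{finite, discrete_topology} config measure) \<Rightarrow> 'g config measure \<Rightarrow> bool" where
  "weak_star_limit \<mu> \<nu> \<longleftrightarrow>
     (\<forall>f :: 'g config \<Rightarrow> real. continuous_on UNIV f \<longrightarrow>
        (\<lambda>t. integral\<^sup>L (\<mu> t) f) \<longlonglongrightarrow> integral\<^sup>L \<nu> f)"

definition lower_density :: "nat set \<Rightarrow> ereal" where
  "lower_density X = liminf (\<lambda>n. ereal (real (card {i \<in> X. i \<le> n}) / real n))"

definition strongly_randomizes ::
  "('g::{finite, discrete_topology} config \<Rightarrow> 'g config) \<Rightarrow> 'g config measure set \<Rightarrow> bool" where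
  "strongly_randomizes F C \<longleftrightarrow>
     (\<forall>\<mu>\<in>C. weak_star_limit (\<lambda>t. push (F ^^ t) \<mu>) uniform_bernoulli)"

definition randomizes_in_density ::
  "('g::{finite, discrete_topology} config \<Rightarrow> 'g config) \<Rightarrow> 'g config measure set \<Rightarrow> bool" where
  "randomizes_in_density F C \<longleftrightarrow>
     (\<forall>\<mu>\<in>C. \<exists>\<phi> :: nat \<Rightarrow> nat. strict_mono \<phi> \<and> lower_density (range \<phi>) = 1 \<and>
        weak_star_limit (\<lambda>t. push (F ^^ \<phi> t) \<mu>) uniform_bernoulli)"

definition randomizes_in_density_on_cylinders_1 ::
  "('g::{finite, discrete_topology} config \<Rightarrow> 'g config) \<Rightarrow> 'g config measure set \<Rightarrow> bool" where
  "randomizes_in_density_on_cylinders_1 F C \<longleftrightarrow>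
     (\<forall>\<mu>\<in>C. \<forall>(u :: 'g) (k :: int).
        \<exists>\<phi> :: nat \<Rightarrow> nat. strict_mono \<phi> \<and> lower_density (range \<phi>) = 1 \<and>
          (\<lambda>t. measure (push (F ^^ \<phi> t) \<mu>) (cylinder [u] k))
            \<longlonglongrightarrow> measure uniform_bernoulli (cylinder [u] k))"

(* Used both for configurations and for G itself, where continuity is automatic. *)
definition character :: "('a::{ab_group_add, topological_space} \<Rightarrow> complex) \<Rightarrow> bool" where
  "character \<xi> \<longleftrightarrow> continuous_on UNIV \<xi> \<and> (\<forall>x. norm (\<xi> x) = 1) \<and>
     (\<forall>x y. \<xi> (x + y) = \<xi> x * \<xi> y)"

definition single :: "int \<Rightarrow> 'g \<Rightarrow> 'g::zero config" where
  "single k g = (\<lambda>i. if i = k then g else 0)"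

(* The k-th factor of the product decomposition of a character; see the lemmas
   character_decomposition and character_decomposition_unique below. *)
definition char_component :: "('g::zero config \<Rightarrow> complex) \<Rightarrow> int \<Rightarrow> 'g \<Rightarrow> complex" where
  "char_component \<xi> k = (\<lambda>g. \<xi> (single k g))"

definition char_rank :: "('g::zero config \<Rightarrow> complex) \<Rightarrow> nat" where
  "char_rank \<xi> = card {k. char_component \<xi> k \<noteq> (\<lambda>_. 1)}"

definition harmonically_mixing ::
  "'g::{ab_group_add, finite, discrete_topology} config measure \<Rightarrow> bool" where
  "harmonically_mixing \<mu> \<longleftrightarrow>
     (\<forall>\<epsilon>>0. \<exists>R>0. \<forall>\<xi>. character \<xi> \<and> char_rank \<xi> > R \<longrightarrow> norm (integral\<^sup>L \<mu> \<xi>) < \<epsilon>)"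

definition harmonically_mixing_measures ::
  "'g::{ab_group_add, finite, discrete_topology} config measure set" where
  "harmonically_mixing_measures = {\<mu>. borel_probability_measure \<mu> \<and> harmonically_mixing \<mu>}"


lemma character_zero:
  assumes "character \<xi>"
  shows "\<xi> 0 = 1"
proof -
  have "\<xi> 0 = \<xi> 0 * \<xi> 0" "norm (\<xi> 0) = 1"
    using assms unfolding character_def by (metis add_0)+
  thus ?thesis by auto
qed

lemma character_sum:
  assumes "character \<xi>" "finite A"
  shows "\<xi> (\<Sum>i\<in>A. f i) = (\<Prod>i\<in>A. \<xi> (f i))"
  using assms(2) assms(1) by (induction A) (auto simp: character_zero, simp add: character_def)

lemma sum_single:
  assumes "finite K"
  shows "(\<Sum>k\<in>K. single k (x k)) i = (if i \<in> K then x i else (0::'g::ab_group_add))"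
  using assms by (induction K) (auto simp: single_def)

lemma unit_powers_near_one:
  fixes z :: complex
  assumes z: "norm z = 1" and near: "\<And>n. norm (z ^ n - 1) < 1"
  shows "z = 1"
proof -
  define t where "t = Arg z"
  have zt: "z = cis t" using rcis_cmod_Arg[of z] z by (simp add: t_def rcis_def)
  have t: "-pi < t" "t \<le> pi" using Arg_bounded[of z] by (auto simp: t_def)
  have pos: "cos (real n * t) > 0" for n
  proof -
    have "\<bar>Re (z ^ n - 1)\<bar> < 1" using near[of n] abs_Re_le_cmod[of "z ^ n - 1"] by linarith
    thus ?thesis by (simp add: zt Complex.DeMoivre)
  qed
  have pos2: "cos (2 ^ n * t) > 0" for n :: nat using pos[of "2 ^ n"] by simp
  have bound: "\<bar>2 ^ n * t\<bar> < pi / 2" for n :: nat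
  proof (induction n)
    case 0
    show ?case
    proof (rule ccontr)
      assume "\<not> ?thesis"
      hence "pi / 2 \<le> \<bar>t\<bar>" "\<bar>t\<bar> \<le> pi" using t by auto
      hence "cos \<bar>t\<bar> \<le> cos (pi / 2)" by (intro cos_monotone_0_pi_le) auto
      thus False using pos[of 1] by simp
    qed
  next
    case (Suc n)
    show ?case
    proof (rule ccontr)
      assume "\<not> ?thesis"
      moreover have "\<bar>2 ^ Suc n * t\<bar> = 2 * \<bar>2 ^ n * t\<bar>" by (simp add: abs_mult)
      ultimately have "pi / 2 \<le> \<bar>2 ^ Suc n * t\<bar>" "\<bar>2 ^ Suc n * t\<bar> \<le> pi" using Suc by auto
      hence "cos \<bar>2 ^ Suc n * t\<bar> \<le> cos (pi / 2)" by (intro cos_monotone_0_pi_le) auto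
      thus False using pos2[of "Suc n"] by simp
    qed
  qed
  have "t = 0"
  proof (rule ccontr)
    assume "t \<noteq> 0"
    then obtain n where "pi / 2 / \<bar>t\<bar> < 2 ^ n" using real_arch_pow[of 2] by auto
    with \<open>t \<noteq> 0\<close> have "pi / 2 < \<bar>2 ^ n * t\<bar>" by (simp add: field_simps abs_mult)
    with bound[of n] show False by simp
  qed
  thus ?thesis by (simp add: zt)
qed

lemma open_config_contains_finite_window:
  fixes x :: "'g::discrete_topology config"
  assumes "open U" "x \<in> U"
  obtains n :: nat where "\<And>y. (\<And>i. \<bar>i\<bar> \<le> int n \<Longrightarrow> y i = x i) \<Longrightarrow> y \<in> U"
proof -
  have "openin (product_topology (\<lambda>i::int. euclidean :: 'g topology) UNIV) U"
    unfolding euclidean_product_topology using assms(1) by simp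
  then obtain X where X: "x \<in> PiE UNIV X" "finite {i. X i \<noteq> UNIV}" "PiE UNIV X \<subseteq> U"
    using product_topology_open_contains_basis[of "\<lambda>_. euclidean" UNIV U x] assms(2) by auto
  have "finite ((\<lambda>i. nat \<bar>i\<bar>) ` {i. X i \<noteq> UNIV})" using X(2) by simp
  then obtain n where n: "\<And>i. X i \<noteq> UNIV \<Longrightarrow> nat \<bar>i\<bar> \<le> n"
    using finite_nat_set_iff_bounded_le by auto
  show ?thesis
  proof (rule that[of n])
    fix y assume y: "\<And>i. \<bar>i\<bar> \<le> int n \<Longrightarrow> y i = x i"
    have "y i \<in> X i" for i
    proof (cases "X i = UNIV")
      case False
      with n[of i] have "y i = x i" by (intro y) auto
      with X(1) show ?thesis by auto
    qed auto
    with X(3) show "y \<in> U" by auto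
  qed
qed

theorem character_decomposition:
  fixes \<xi> :: "'g::{ab_group_add, finite, discrete_topology} config \<Rightarrow> complex"
  assumes "character \<xi>"
  shows "character (char_component \<xi> k)"
    and "finite {k. char_component \<xi> k \<noteq> (\<lambda>_. 1)}"
    and "\<xi> x = (\<Prod>k | char_component \<xi> k \<noteq> (\<lambda>_. 1). char_component \<xi> k (x k))"
proof -
  have mult: "\<xi> (x + y) = \<xi> x * \<xi> y" and nrm: "norm (\<xi> x) = 1" for x y
    using assms by (auto simp: character_def)
  have single_add: "single k (g + h) = single k g + single k h" for k and g h :: 'g
    by (auto simp: single_def fun_eq_iff)
  show "character (char_component \<xi> k)"
    by (auto simp: character_def char_component_def single_add mult nrm)
  have "open (\<xi> -` ball 1 1)"
    using assms by (intro open_vimage) (auto simp: character_def)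
  moreover have "0 \<in> \<xi> -` ball 1 1" by (simp add: character_zero[OF assms])
  ultimately obtain n :: nat
    where n: "\<And>y. (\<And>i. \<bar>i\<bar> \<le> int n \<Longrightarrow> y i = 0 i) \<Longrightarrow> y \<in> \<xi> -` ball 1 1"
    by (rule open_config_contains_finite_window) auto
  have triv: "\<xi> y = 1" if y: "\<And>i. \<bar>i\<bar> \<le> int n \<Longrightarrow> y i = 0" for y
  proof (rule unit_powers_near_one[OF nrm])
    fix m
    have "\<exists>w. \<xi> w = \<xi> y ^ m \<and> (\<forall>i. \<bar>i\<bar> \<le> int n \<longrightarrow> w i = 0)"
    proof (induction m)
      case 0
      have "\<xi> 0 = \<xi> y ^ 0 \<and> (\<forall>i. \<bar>i\<bar> \<le> int n \<longrightarrow> (0 :: 'g config) i = 0)"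
        by (simp add: character_zero[OF assms])
      thus ?case by blast
    next
      case (Suc m)
      then obtain w where "\<xi> w = \<xi> y ^ m" "\<forall>i. \<bar>i\<bar> \<le> int n \<longrightarrow> w i = 0" by blast
      with y have "\<xi> (y + w) = \<xi> y ^ Suc m" "\<forall>i. \<bar>i\<bar> \<le> int n \<longrightarrow> (y + w) i = 0"
        by (simp_all add: mult)
      thus ?case by blast
    qed
    then obtain w where w: "\<xi> w = \<xi> y ^ m" "\<forall>i. \<bar>i\<bar> \<le> int n \<longrightarrow> w i = 0" by blast
    with n[of w] show "norm (\<xi> y ^ m - 1) < 1" by (auto simp: dist_norm norm_minus_commute)
  qed
  define K where "K = {- int n..int n}"
  have sub: "{k. char_component \<xi> k \<noteq> (\<lambda>_. 1)} \<subseteq> K"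
  proof
    fix k assume k: "k \<in> {k. char_component \<xi> k \<noteq> (\<lambda>_. 1)}"
    show "k \<in> K"
    proof (rule ccontr)
      assume "k \<notin> K"
      hence "\<xi> (single k g) = 1" for g by (intro triv) (auto simp: single_def K_def)
      with k show False by (auto simp: char_component_def)
    qed
  qed
  thus "finite {k. char_component \<xi> k \<noteq> (\<lambda>_. 1)}" by (rule finite_subset) (simp add: K_def)
  define s where "s = (\<Sum>k\<in>K. single k (x k))"
  have s: "s i = (if i \<in> K then x i else 0)" for i
    unfolding s_def by (rule sum_single) (simp add: K_def)
  have "\<xi> (x - s) = 1" by (rule triv) (auto simp: s K_def)
  hence "\<xi> x = \<xi> s" using mult[of "x - s" s] by simp
  also have "\<dots> = (\<Prod>k\<in>K. char_component \<xi> k (x k))"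
    unfolding s_def char_component_def by (rule character_sum[OF assms]) (simp add: K_def)
  also have "\<dots> = (\<Prod>k | char_component \<xi> k \<noteq> (\<lambda>_. 1). char_component \<xi> k (x k))"
    by (rule prod.mono_neutral_right) (use sub in \<open>auto simp: K_def\<close>)
  finally show "\<xi> x = (\<Prod>k | char_component \<xi> k \<noteq> (\<lambda>_. 1). char_component \<xi> k (x k))" .
qed

theorem character_decomposition_unique:
  fixes \<xi> :: "'g::{ab_group_add, finite, discrete_topology} config \<Rightarrow> complex"
  assumes psi: "\<And>k. character (\<psi> k)" and fin: "finite {k. \<psi> k \<noteq> (\<lambda>_. 1)}"
    and eq: "\<And>x. \<xi> x = (\<Prod>k | \<psi> k \<noteq> (\<lambda>_. 1). \<psi> k (x k))"
  shows "\<psi> = char_component \<xi>"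
proof (intro ext)
  fix k g
  have "\<xi> (single k g) = (\<Prod>j | \<psi> j \<noteq> (\<lambda>_. 1). if j = k then \<psi> k g else 1)"
    unfolding eq by (rule prod.cong) (auto simp: single_def character_zero[OF psi])
  also have "\<dots> = \<psi> k g" using fin by (auto simp: prod.delta)
  finally show "\<psi> k g = char_component \<xi> k g" by (simp add: char_component_def)
qed

lemma sets_uniform_bernoulli:
  "sets (uniform_bernoulli :: 'g::{finite, discrete_topology} config measure) = sets borel"
proof
  let ?U = "uniform_bernoulli :: 'g config measure"
  have space: "space ?U = UNIV"
    by (auto simp: uniform_bernoulli_def space_PiM space_uniform_count_measure)
  have comp: "(\<lambda>x. x i) \<in> measurable ?U (count_space UNIV)" for i
  proof -
    have "(\<lambda>x. x i) \<in> measurable ?U (uniform_count_measure (UNIV :: 'g set))"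
      unfolding uniform_bernoulli_def by (rule measurable_component_singleton) simp
    thus ?thesis
      by (subst measurable_cong_sets[OF refl, of _ "uniform_count_measure UNIV"])
         (simp_all add: sets_uniform_count_measure)
  qed
  show "sets ?U \<subseteq> sets borel"
  proof -
    have "(\<lambda>x i. x i) \<in> measurable (borel :: 'g config measure)
        (PiM UNIV (\<lambda>_. uniform_count_measure UNIV))"
    proof (rule measurable_PiM_single')
      fix i :: int
      have "(\<lambda>x :: 'g config. x i) -` A \<in> sets borel" for A
        by (intro borel_open open_vimage continuous_on_product_coordinates)
           (rule discrete_topology_class.open_discrete)
      thus "(\<lambda>x :: 'g config. x i) \<in> measurable borel (uniform_count_measure UNIV)"
        by (intro measurableI) (auto simp: space_uniform_count_measure)
    qed (auto simp: space_uniform_count_measure)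
    hence "(\<lambda>x. x) \<in> measurable (borel :: 'g config measure) ?U"
      by (simp add: uniform_bernoulli_def)
    from measurable_sets[OF this] show ?thesis
      using sets.sets_into_space[of _ ?U] by (auto simp: vimage_def)
  qed
  show "sets borel \<subseteq> sets ?U"
  proof -
    have "U \<in> sets ?U" if U: "open U" for U :: "'g config set"
    proof -
      define W where "W = (\<lambda>n::nat. {u \<in> PiE {- int n..int n} (\<lambda>_. UNIV :: 'g set).
        {x. \<forall>i\<in>{- int n..int n}. x i = u i} \<subseteq> U})"
      have U_eq: "U = (\<Union>n. \<Union>u\<in>W n. {x. \<forall>i\<in>{- int n..int n}. x i = u i})"
      proof (intro equalityI subsetI)
        fix x assume x: "x \<in> U"
        obtain n :: nat where n: "\<And>y. (\<And>i. \<bar>i\<bar> \<le> int n \<Longrightarrow> y i = x i) \<Longrightarrow> y \<in> U"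
          using open_config_contains_finite_window[OF U x] by blast
        have "restrict x {- int n..int n} \<in> W n"
          by (auto simp: W_def abs_le_iff intro!: n)
        moreover have "x \<in> {y. \<forall>i\<in>{- int n..int n}. y i = restrict x {- int n..int n} i}"
          by auto
        ultimately show "x \<in> (\<Union>n. \<Union>u\<in>W n. {x. \<forall>i\<in>{- int n..int n}. x i = u i})"
          by blast
      qed (auto simp: W_def)
      have "finite (W n)" for n
        unfolding W_def by (rule finite_subset[OF Collect_subset]) (auto intro: finite_PiE)
      moreover have "{x. \<forall>i\<in>{- int n..int n}. x i = u i} \<in> sets ?U" for n :: nat and u
      proof -
        have "{x \<in> space ?U. x i = u i} \<in> sets ?U" for i
          using measurable_sets[OF comp[of i], of "{u i}"]
          by (simp add: vimage_def Int_def conj_commute)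
        hence "{x \<in> space ?U. \<forall>i\<in>{- int n..int n}. x i = u i} \<in> sets ?U"
          by (intro sets.sets_Collect_finite_All') auto
        thus ?thesis by (simp add: space)
      qed
      ultimately have "(\<Union>n. \<Union>u\<in>W n. {x. \<forall>i\<in>{- int n..int n}. x i = u i}) \<in> sets ?U"
        by (intro sets.countable_UN image_subsetI sets.finite_UN)
      with U_eq show ?thesis by simp
    qed
    hence "sigma_sets UNIV {U :: 'g config set. open U} \<subseteq> sets ?U"
      using sets.sigma_sets_subset[of "{U. open U}" ?U] by (auto simp: space)
    thus ?thesis by (simp add: borel_def)
  qed
qed

lemma measure_uniform_bernoulli_cylinder:
  "measure uniform_bernoulli (cylinder (u :: 'g::finite list) k) = 1 / real CARD('g) ^ length u"
proof -
  interpret product_prob_space "\<lambda>_::int. uniform_count_measure (UNIV :: 'g set)" UNIV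
    by (intro product_prob_spaceI prob_space_uniform_count_measure) auto
  let ?J = "(\<lambda>j. k + int j) ` {..<length u}"
  let ?X = "\<lambda>i. {u ! nat (i - k)}"
  have "cylinder u k = prod_emb UNIV (\<lambda>_. uniform_count_measure UNIV) ?J (PiE ?J ?X)"
    by (auto simp: cylinder_def prod_emb_def space_uniform_count_measure restrict_def PiE_iff)
  hence "measure uniform_bernoulli (cylinder u k)
      = (\<Prod>i\<in>?J. measure (uniform_count_measure UNIV) (?X i))"
    unfolding uniform_bernoulli_def
    by (simp add: measure_PiM_emb sets_uniform_count_measure)
  also have "\<dots> = (\<Prod>i\<in>?J. 1 / real CARD('g))"
    by (intro prod.cong) (auto simp: measure_uniform_count_measure)
  also have "\<dots> = 1 / real CARD('g) ^ length u"
    by (simp add: card_image inj_on_def power_one_over)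
  finally show ?thesis .
qed

end

(* Duality turns the action of F on characters of the configuration space into a cellular
   automaton F' with commuting coefficients on finite configurations over the dual group, and
   harmonic mixing reduces everything to the growth of ranks under the iterates of F'.

   (1) On a configuration c killed by a prime p, Frobenius gives
   F'^(p^n) c = (sum_i phi_i^(p^n) shift^(i p^n)) c, so the rank stays bounded along t = p^n.
   The product measure of the lazy distribution (half Dirac mass at 0, half uniform), whose
   Fourier coefficient at a character of rank r is 2^(-r), is therefore not randomized.

   (2) One may take N = 1. Condition (ii) then says that every nonzero element of G is mapped to
   a nonzero element by at least two coefficients, which passes to the dual group. Restricting to
   a minimal subgroup stable under the coefficients, these generate a finite field, so that for
   arbitrarily large powers Q of p the automaton F'^Q has the coefficient of F' at i in position
   Q i. Self-similarity modulo P = Q^2 then shows that the times at which the rank is below a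
   given bound have density zero. If (ii) fails, some character of rank one keeps rank at most
   one forever, and the lazy product measure contradicts (iii). *)

theory Submission
  imports Defs "HOL-Computational_Algebra.Primes"
begin

text \<open>Three difficulties lie beyond duality and Frobenius. A character killed by the adjoints
  of several coefficients only shows that their images generate a proper subgroup. That the
  coefficients themselves have a common kernel uses commutation and finiteness: one after another
  they are made nilpotent at an element on which the character is nontrivial. Self-similarity cannot
  be followed along a single configuration, because a residue class of an iterate is the start of a
  different orbit. The estimate is therefore uniform over all nonzero configurations supported in a
  fixed window. If the radius of the window also bounds the neighbourhood, fewer than P steps
  followed by cutting into residue classes modulo P lead back into the same window. Rank growth
  gives a null set of exceptional times for each configuration separately, whereas weak-*
  convergence concerns all characters along one sequence. Over a finite group each window carries
  finitely many configurations, and a diagonal choice of times serves all windows and all rank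
  bounds together.\<close>

section \<open>Multiples and endomorphisms in abelian groups\<close>

definition nmult :: "nat \<Rightarrow> 'a::ab_group_add \<Rightarrow> 'a" where
  "nmult n x = (\<Sum>i<n. x)"

lemma nmult_0 [simp]: "nmult 0 x = 0"
  and nmult_Suc [simp]: "nmult (Suc n) x = nmult n x + x"
  and nmult_zero [simp]: "nmult n 0 = 0"
  by (auto simp: nmult_def)

lemma nmult_add_left: "nmult (m + n) x = nmult m x + nmult n x"
  by (induction n) (auto simp: add.assoc)

lemma nmult_mult: "nmult (m * n) x = nmult m (nmult n x)"
  by (induction m) (auto simp: nmult_add_left add.commute)

lemma nmult_add_right: "nmult n (x + y) = nmult n x + nmult n y"
  by (simp add: nmult_def sum.distrib)

lemma nmult_fun: "nmult n x i = nmult n (x i)"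
  by (induction n) auto

lemma endomorphism_0: "endomorphism f \<Longrightarrow> f 0 = 0"
  unfolding endomorphism_def by (metis add_cancel_right_right)

lemma endomorphism_add: "endomorphism f \<Longrightarrow> f (x + y) = f x + f y"
  by (simp add: endomorphism_def)

lemma endomorphism_diff: "endomorphism f \<Longrightarrow> f (x - y) = f x - f y"
  by (metis add_diff_cancel_right' diff_add_cancel endomorphism_add)

lemma endomorphism_sum: "endomorphism f \<Longrightarrow> f (\<Sum>i\<in>A. g i) = (\<Sum>i\<in>A. f (g i))"
  by (induction A rule: infinite_finite_induct) (auto simp: endomorphism_0 endomorphism_add)

lemma endomorphism_nmult: "endomorphism f \<Longrightarrow> f (nmult n x) = nmult n (f x)"
  by (simp add: nmult_def endomorphism_sum)

lemma endomorphism_id: "endomorphism (\<lambda>x. x)"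
  by (simp add: endomorphism_def)

lemma endomorphism_funpow: "endomorphism f \<Longrightarrow> endomorphism (f ^^ n)"
  by (induction n) (auto simp: endomorphism_def)

lemma endomorphism_minus:
  "endomorphism f \<Longrightarrow> endomorphism g \<Longrightarrow> endomorphism (\<lambda>x. f x - g x)"
  by (simp add: endomorphism_def algebra_simps)

lemma endomorphism_Sum:
  "(\<And>i. i \<in> A \<Longrightarrow> endomorphism (f i)) \<Longrightarrow> endomorphism (\<lambda>x. \<Sum>i\<in>A. f i x)"
  by (simp add: endomorphism_def sum.distrib)

lemma endomorphism_nmult_fun: "endomorphism (nmult n)"
  by (simp add: endomorphism_def nmult_add_right)

lemma comp_funpow_commute:
  assumes "f \<circ> g = g \<circ> f"
  shows "f ((g ^^ n) x) = (g ^^ n) (f x)"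
proof -
  have "f (g y) = g (f y)" for y using fun_cong[OF assms, of y] by simp
  thus ?thesis by (induction n) auto
qed

lemma funpow_commute:
  assumes "f \<circ> g = g \<circ> f"
  shows "(f ^^ m) \<circ> (g ^^ n) = (g ^^ n) \<circ> (f ^^ m)"
proof (rule ext)
  fix x
  have "f \<circ> (g ^^ n) = (g ^^ n) \<circ> f"
    using comp_funpow_commute[OF assms] by (auto simp: fun_eq_iff)
  from comp_funpow_commute[OF this[symmetric]] show "((f ^^ m) \<circ> (g ^^ n)) x = ((g ^^ n) \<circ> (f ^^ m)) x"
    by simp
qed

section \<open>Frobenius for sums of commuting endomorphisms\<close>

text \<open>Commuting endomorphisms compute like elements of a commutative ring. The identity is
  evaluated at a point so that the torsion of this point alone can be exploited.\<close>

lemma funpow_sum_binomial: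
  assumes A: "endomorphism A" and B: "endomorphism B" and comm: "A \<circ> B = B \<circ> A"
  shows "((\<lambda>x. A x + B x) ^^ n) x = (\<Sum>k\<le>n. nmult (n choose k) ((A ^^ k) ((B ^^ (n - k)) x)))"
proof (induction n)
  case (Suc n)
  let ?t = "\<lambda>k. (A ^^ k) ((B ^^ (Suc n - k)) x)"
  have BA: "B ((A ^^ k) y) = (A ^^ k) (B y)" for k y
    by (rule comp_funpow_commute[OF comm[symmetric]])
  have "((\<lambda>x. A x + B x) ^^ Suc n) x =
      (\<Sum>k\<le>n. nmult (n choose k) (?t (Suc k))) + (\<Sum>k\<le>n. nmult (n choose k) (?t k))"
    by (simp add: Suc endomorphism_sum[OF A] endomorphism_sum[OF B] endomorphism_nmult[OF A]
        endomorphism_nmult[OF B] BA Suc_diff_le)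
  also have "(\<Sum>k\<le>n. nmult (n choose k) (?t k)) = (\<Sum>k\<le>Suc n. nmult (n choose k) (?t k))"
    by (simp add: binomial_eq_0)
  also have "\<dots> = ?t 0 + (\<Sum>k\<le>n. nmult (n choose Suc k) (?t (Suc k)))"
    by (subst sum.atMost_Suc_shift) simp
  also have "(\<Sum>k\<le>n. nmult (n choose k) (?t (Suc k))) + \<dots> =
      ?t 0 + (\<Sum>k\<le>n. nmult (Suc n choose Suc k) (?t (Suc k)))"
    by (simp add: sum.distrib nmult_add_left)
  also have "\<dots> = (\<Sum>k\<le>Suc n. nmult (Suc n choose k) (?t k))"
    by (simp only: sum.atMost_Suc_shift binomial_n_0 nmult_Suc nmult_0 One_nat_def add_0)
  finally show ?case .
qed simp

text \<open>The inner binomial coefficients are multiples of \<open>p\<close>, and the factor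
  \<open>p\<close> can be moved through \<open>A\<close> and \<open>B\<close> onto
  \<open>x\<close>.\<close>

lemma funpow_prime_add:
  assumes A: "endomorphism A" and B: "endomorphism B" and comm: "A \<circ> B = B \<circ> A"
    and p: "prime p" and x: "nmult p x = 0"
  shows "((\<lambda>x. A x + B x) ^^ p) x = (A ^^ p) x + (B ^^ p) x"
proof -
  let ?t = "\<lambda>k. nmult (p choose k) ((A ^^ k) ((B ^^ (p - k)) x))"
  have p0: "p > 0" using p by (simp add: prime_gt_0_nat)
  have "?t k = 0" if "0 < k" "k < p" for k
  proof -
    have "p dvd (p choose k)" using that p p0 by (intro dvd_choose_prime) auto
    then obtain m where m: "p choose k = m * p" by (auto simp: dvd_def mult.commute)
    have "nmult p ((A ^^ k) ((B ^^ (p - k)) x)) = (A ^^ k) ((B ^^ (p - k)) (nmult p x))"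
      by (simp add: endomorphism_nmult endomorphism_funpow A B)
    also have "\<dots> = 0" by (simp add: x endomorphism_0 endomorphism_funpow A B)
    finally show ?thesis by (simp add: m nmult_mult)
  qed
  hence "(\<Sum>k\<le>p. ?t k) = (\<Sum>k\<in>{0, p}. ?t k)"
    by (intro sum.mono_neutral_right) auto
  also have "\<dots> = (A ^^ p) x + (B ^^ p) x" using p0 by (simp add: add.commute)
  finally show ?thesis by (simp add: funpow_sum_binomial[OF A B comm])
qed

lemma funpow_prime_Sum:
  assumes "finite I" and A: "\<And>i. i \<in> I \<Longrightarrow> endomorphism (A i)"
    and comm: "\<And>i j. i \<in> I \<Longrightarrow> j \<in> I \<Longrightarrow> A i \<circ> A j = A j \<circ> A i"
    and p: "prime p" and x: "nmult p x = 0"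
  shows "((\<lambda>x. \<Sum>i\<in>I. A i x) ^^ p) x = (\<Sum>i\<in>I. (A i ^^ p) x)"
  using assms(1-3)
proof (induction I)
  case empty
  \<comment> \<open>Positivity matters here: the zeroth iterate of the zero map would be the
    identity.\<close>
  have "p > 0" using p by (simp add: prime_gt_0_nat)
  then obtain m where "p = Suc m" by (cases p) auto
  thus ?case by simp
next
  case (insert i I)
  have c: "A i \<circ> (\<lambda>x. \<Sum>i\<in>I. A i x) = (\<lambda>x. \<Sum>i\<in>I. A i x) \<circ> A i"
  proof (rule ext)
    fix x
    have "A i (A j x) = A j (A i x)" if "j \<in> I" for j
      using fun_cong[OF insert.prems(2)[of i j], of x] that by simp
    thus "(A i \<circ> (\<lambda>x. \<Sum>i\<in>I. A i x)) x = ((\<lambda>x. \<Sum>i\<in>I. A i x) \<circ> A i) x"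
      using insert.prems(1)[of i] by (simp add: endomorphism_sum)
  qed
  have "((\<lambda>x. A i x + (\<Sum>i\<in>I. A i x)) ^^ p) x = (A i ^^ p) x + ((\<lambda>x. \<Sum>i\<in>I. A i x) ^^ p) x"
    using insert.prems(1) by (intro funpow_prime_add[OF _ _ c p x] endomorphism_Sum) auto
  also have "((\<lambda>x. \<Sum>i\<in>I. A i x) ^^ p) x = (\<Sum>i\<in>I. (A i ^^ p) x)"
    using insert.prems by (intro insert.IH) auto
  finally show ?case using insert.hyps by simp
qed

lemma funpow_prime_power_Sum:
  assumes I: "finite I" and A: "\<And>i. i \<in> I \<Longrightarrow> endomorphism (A i)"
    and comm: "\<And>i j. i \<in> I \<Longrightarrow> j \<in> I \<Longrightarrow> A i \<circ> A j = A j \<circ> A i"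
    and p: "prime p" and x: "nmult p x = 0"
  shows "((\<lambda>x. \<Sum>i\<in>I. A i x) ^^ (p ^ n)) x = (\<Sum>i\<in>I. (A i ^^ (p ^ n)) x)"
  using x
proof (induction n arbitrary: x)
  case (Suc n)
  let ?F = "(\<lambda>x. \<Sum>i\<in>I. A i x) ^^ (p ^ n)" and ?G = "\<lambda>x. \<Sum>i\<in>I. (A i ^^ (p ^ n)) x"
  have F: "endomorphism ?F" by (intro endomorphism_funpow endomorphism_Sum A)
  \<comment> \<open>The induction hypothesis equates \<open>?F\<close> and \<open>?G\<close> only at
    elements killed by \<open>p\<close>, so the orbit has to be kept inside the
    \<open>p\<close>-torsion at the same time.\<close>
  have "(?F ^^ k) x = (?G ^^ k) x \<and> nmult p ((?F ^^ k) x) = 0" for k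
  proof (induction k)
    case (Suc k)
    hence "?F ((?F ^^ k) x) = ?G ((?F ^^ k) x)" using \<open>\<And>x. _ \<Longrightarrow> ?F x = ?G x\<close> by blast
    moreover have "nmult p (?F ((?F ^^ k) x)) = 0"
      using endomorphism_nmult[OF F, of p "(?F ^^ k) x"] conjunct2[OF Suc]
      by (simp only: endomorphism_0[OF F])
    ultimately show ?case using Suc by simp
  qed (simp add: Suc)
  hence "(?F ^^ p) x = (?G ^^ p) x" by blast
  also have "\<dots> = (\<Sum>i\<in>I. ((A i ^^ (p ^ n)) ^^ p) x)"
    by (rule funpow_prime_Sum[OF I _ _ p Suc.prems])
      (auto intro!: endomorphism_funpow A funpow_commute comm)
  finally show ?case by (simp add: funpow_mult mult.commute)
qed simp

lemma funpow_prime_power_add: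
  assumes A: "endomorphism A" and B: "endomorphism B" and comm: "A \<circ> B = B \<circ> A"
    and p: "prime p" and x: "nmult p x = 0"
  shows "((\<lambda>x. A x + B x) ^^ (p ^ n)) x = (A ^^ (p ^ n)) x + (B ^^ (p ^ n)) x"
  using funpow_prime_power_Sum[of "{True, False}" "\<lambda>b. if b then A else B" p x n] assms by auto

section \<open>Sets of natural numbers of density zero\<close>

text \<open>These are the complements of the sets of lower density one. They form an ideal, which
  makes it easy to combine exceptional sets of times.\<close>

definition null_density :: "nat set \<Rightarrow> bool" where
  "null_density X \<longleftrightarrow> (\<lambda>n. real (card {i \<in> X. i \<le> n}) / real n) \<longlonglongrightarrow> 0"

lemma null_density_mono:
  assumes "null_density Y" "X \<subseteq> Y"
  shows "null_density X"
proof -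
  have "card {i \<in> X. i \<le> n} \<le> card {i \<in> Y. i \<le> n}" for n
    using assms(2) by (intro card_mono) auto
  hence "real (card {i \<in> X. i \<le> n}) / real n \<le> real (card {i \<in> Y. i \<le> n}) / real n" for n
    by (intro divide_right_mono of_nat_mono) auto
  thus ?thesis unfolding null_density_def
    by (intro tendsto_sandwich[OF _ _ tendsto_const assms(1)[unfolded null_density_def]])
      (simp_all add: always_eventually)
qed

lemma null_density_empty: "null_density {}"
  by (simp add: null_density_def)

lemma null_density_Un:
  assumes "null_density X" "null_density Y"
  shows "null_density (X \<union> Y)"
proof -
  have "card {i \<in> X \<union> Y. i \<le> n} \<le> card {i \<in> X. i \<le> n} + card {i \<in> Y. i \<le> n}" for n
    by (rule order_trans[OF _ card_Un_le]) (rule card_mono, auto)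
  hence "real (card {i \<in> X \<union> Y. i \<le> n}) / real n \<le>
      real (card {i \<in> X. i \<le> n}) / real n + real (card {i \<in> Y. i \<le> n}) / real n" for n
    unfolding add_divide_distrib[symmetric] of_nat_add[symmetric]
    by (intro divide_right_mono of_nat_mono) auto
  moreover have "(\<lambda>n. real (card {i \<in> X. i \<le> n}) / real n + real (card {i \<in> Y. i \<le> n}) / real n)
      \<longlonglongrightarrow> 0 + 0"
    using assms unfolding null_density_def by (rule tendsto_add)
  ultimately show ?thesis unfolding null_density_def add_0
    by (elim tendsto_sandwich[OF _ _ tendsto_const, rotated -1]) (simp_all add: always_eventually)
qed

lemma null_density_UN:
  "finite I \<Longrightarrow> (\<And>i. i \<in> I \<Longrightarrow> null_density (X i)) \<Longrightarrow> null_density (\<Union>i\<in>I. X i)"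
  by (induction I rule: finite_induct) (auto intro: null_density_Un null_density_empty)

text \<open>Clearing denominators gives inequalities between natural numbers, one for each level
  \<open>k\<close>; the diagonal construction works with these levels.\<close>

lemma null_density_iff:
  "null_density X \<longleftrightarrow> (\<forall>k. \<forall>\<^sub>F n in sequentially. card {i \<in> X. i \<le> n} * Suc k \<le> n)"
proof
  assume "null_density X"
  show "\<forall>k. \<forall>\<^sub>F n in sequentially. card {i \<in> X. i \<le> n} * Suc k \<le> n"
  proof
    fix k
    have "\<forall>\<^sub>F n in sequentially. real (card {i \<in> X. i \<le> n}) / real n < 1 / real (Suc k)"
      using \<open>null_density X\<close> unfolding null_density_def by (rule order_tendstoD) simp
    thus "\<forall>\<^sub>F n in sequentially. card {i \<in> X. i \<le> n} * Suc k \<le> n"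
      using eventually_gt_at_top[of 0]
    proof eventually_elim
      case (elim n)
      hence "real (card {i \<in> X. i \<le> n} * Suc k) < real n"
        unfolding of_nat_mult by (simp add: field_simps del: of_nat_Suc)
      thus ?case by linarith
    qed
  qed
next
  assume *: "\<forall>k. \<forall>\<^sub>F n in sequentially. card {i \<in> X. i \<le> n} * Suc k \<le> n"
  show "null_density X"
    unfolding null_density_def
  proof (rule tendstoI)
    fix e :: real assume "e > 0"
    then obtain k where k: "inverse (real (Suc k)) < e" using reals_Archimedean by blast
    show "\<forall>\<^sub>F n in sequentially. dist (real (card {i \<in> X. i \<le> n}) / real n) 0 < e"
      using *[rule_format, of k] eventually_gt_at_top[of 0]
    proof eventually_elim
      case (elim n)
      have "real (card {i \<in> X. i \<le> n}) * real (Suc k) \<le> real n"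
        using elim(1) by (simp only: of_nat_mult[symmetric] of_nat_le_iff)
      hence "real (card {i \<in> X. i \<le> n}) / real n \<le> inverse (real (Suc k))"
        using elim(2) by (simp add: field_simps del: of_nat_Suc)
      with k show ?case by simp
    qed
  qed
qed

lemma null_densityD:
  "null_density X \<Longrightarrow> \<exists>n0. \<forall>n\<ge>n0. card {i \<in> X. i \<le> n} * Suc k \<le> n"
  using null_density_iff[of X] by (simp only: eventually_sequentially)

lemma card_le_split: "card {i. i \<le> (n::nat)} = card {i \<in> X. i \<le> n} + card {i \<in> - X. i \<le> n}"
proof -
  have "card {i. i \<le> n} = card ({i \<in> X. i \<le> n} \<union> {i \<in> - X. i \<le> n})"
    by (rule arg_cong[where f = card]) auto
  also have "\<dots> = card {i \<in> X. i \<le> n} + card {i \<in> - X. i \<le> n}"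
    by (rule card_Un_disjoint) auto
  finally show ?thesis .
qed

text \<open>The upper limit of the frequencies never exceeds one, so lower density one already
  forces them to converge.\<close>

lemma lower_density_eq_1_iff: "lower_density X = 1 \<longleftrightarrow> null_density (- X)"
proof -
  define a b where "a n = real (card {i \<in> X. i \<le> n}) / real n"
    and "b n = real (card {i \<in> - X. i \<le> n}) / real n" for n
  \<comment> \<open>The term \<open>1 / real n\<close> comes from counting 0 as well: there are
    \<open>n + 1\<close> numbers up to \<open>n\<close>.\<close>
  have ab: "a n + b n = 1 + 1 / real n" if "n > 0" for n
  proof -
    have "real (card {i \<in> X. i \<le> n}) + real (card {i \<in> - X. i \<le> n}) = real n + 1"
      using card_le_split[of n X] by simp
    thus ?thesis using that
      by (simp add: a_def b_def add_divide_distrib[symmetric] del: Compl_iff) (simp add: field_simps)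
  qed
  have b0: "b n \<ge> 0" for n by (simp add: b_def)
  have one: "(\<lambda>n. 1 + 1 / real n) \<longlonglongrightarrow> 1"
    using tendsto_add[OF tendsto_const[of 1] lim_1_over_n] by simp
  have upper: "limsup (\<lambda>n. ereal (a n)) \<le> 1"
  proof -
    have "limsup (\<lambda>n. ereal (a n)) \<le> limsup (\<lambda>n. ereal (1 + 1 / real n))"
    proof (rule Limsup_mono)
      show "\<forall>\<^sub>F n in sequentially. ereal (a n) \<le> ereal (1 + 1 / real n)"
        using eventually_gt_at_top[of 0]
      proof eventually_elim
        case (elim n)
        thus ?case using ab[OF elim] b0[of n] by simp
      qed
    qed
    also have "(\<lambda>n. ereal (1 + 1 / real n)) \<longlonglongrightarrow> ereal 1" using one by simp
    hence "limsup (\<lambda>n. ereal (1 + 1 / real n)) = ereal 1"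
      by (intro lim_imp_Limsup) auto
    finally show ?thesis by (simp add: one_ereal_def)
  qed
  have "lower_density X = 1 \<longleftrightarrow> (\<lambda>n. ereal (a n)) \<longlonglongrightarrow> 1"
    unfolding lower_density_def a_def[symmetric]
    using upper Liminf_le_Limsup[of sequentially "\<lambda>n. ereal (a n)"]
    by (auto simp: tendsto_iff_Liminf_eq_Limsup)
  also have "\<dots> \<longleftrightarrow> a \<longlonglongrightarrow> 1" by (simp add: one_ereal_def)
  also have "\<dots> \<longleftrightarrow> b \<longlonglongrightarrow> 0"
  proof -
    have ev: "\<forall>\<^sub>F n in sequentially. a n + b n = 1 + 1 / real n"
      using eventually_gt_at_top[of 0] by (rule eventually_mono) (rule ab)
    have a: "\<forall>\<^sub>F n in sequentially. (1 + 1 / real n) - b n = a n"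
      using ev by (rule eventually_mono) linarith
    have b: "\<forall>\<^sub>F n in sequentially. (1 + 1 / real n) - a n = b n"
      using ev by (rule eventually_mono) linarith
    show ?thesis
    proof
      assume "a \<longlonglongrightarrow> 1"
      from Lim_transform_eventually[OF tendsto_diff[OF one this] b] show "b \<longlonglongrightarrow> 0" by simp
    next
      assume "b \<longlonglongrightarrow> 0"
      from Lim_transform_eventually[OF tendsto_diff[OF one this] a] show "a \<longlonglongrightarrow> 1" by simp
    qed
  qed
  finally show ?thesis by (simp add: null_density_def b_def[abs_def])
qed

lemma not_null_density_UNIV: "\<not> null_density UNIV"
proof
  assume "null_density UNIV"
  from null_densityD[OF this, of 0]
  obtain n where n: "\<forall>k\<ge>n. card {i \<in> UNIV. i \<le> k} * Suc 0 \<le> k"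
    by (rule exE)
  have "card {i \<in> UNIV. i \<le> n} \<le> n" using n[rule_format, OF order_refl] by (simp only: mult_Suc_right mult_0_right add_0_right)
  thus False by simp
qed

lemma null_density_atMost: "null_density {..m}"
proof -
  have "\<forall>\<^sub>F n in sequentially. card {i \<in> {..m}. i \<le> n} * Suc k \<le> n" for k
    using eventually_ge_at_top[of "Suc m * Suc k"]
  proof eventually_elim
    case (elim n)
    have "card {i \<in> {..m}. i \<le> n} \<le> card {..m}" by (intro card_mono) auto
    hence "card {i \<in> {..m}. i \<le> n} * Suc k \<le> Suc m * Suc k" by (intro mult_right_mono) auto
    with elim show ?case by linarith
  qed
  thus ?thesis unfolding null_density_iff by (rule allI)
qed

lemma null_density_frequently:
  assumes "null_density X"
  shows "\<exists>n\<ge>m. n \<notin> X"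
proof (rule ccontr)
  assume "\<not> ?thesis"
  hence "n \<in> X \<union> {..m}" for n using nat_le_linear[of n m] by blast
  hence "UNIV \<subseteq> X \<union> {..m}" by blast
  from null_density_mono[OF null_density_Un[OF assms null_density_atMost] this]
  show False using not_null_density_UNIV by (rule notE[rotated])
qed

text \<open>The diagonal set contains \<open>t \<in> Z\<^sub>m\<close> only while \<open>m\<close> is the largest level whose
  density estimate \<open>1 / (m + 1)\<close> is already valid from \<open>t\<close> on.\<close>

lemma null_density_diagonal:
  fixes Z :: "nat \<Rightarrow> nat set"
  assumes null: "\<And>m. null_density (Z m)" and mono: "\<And>m n. m \<le> n \<Longrightarrow> Z m \<subseteq> Z n"
  obtains B where "null_density B" "\<And>m. \<forall>\<^sub>F t in sequentially. t \<in> Z m \<longrightarrow> t \<in> B"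
proof -
  \<comment> \<open>The bound \<open>m \<le> t\<close> leaves finitely many levels at each time, so
    that a largest one exists.\<close>
  define ok where "ok t m \<longleftrightarrow> m \<le> (t::nat) \<and> (\<forall>n\<ge>t. card {i \<in> Z m. i \<le> n} * Suc m \<le> n)" for t m
  define g where "g t = Max (insert 0 {m. ok t m})" for t
  have fin: "finite {m. ok t m}" for t
    by (rule finite_subset[of _ "{..t}"]) (auto simp: ok_def)
  have g_ge: "m \<le> g t" if "ok t m" for t m
    unfolding g_def using that fin by (intro Max_ge) auto
  have ok_g: "g t = 0 \<or> ok t (g t)" for t
    using Max_in[of "insert 0 {m. ok t m}"] fin by (auto simp: g_def)
  have ev_ok: "\<forall>\<^sub>F t in sequentially. ok t m" for m
  proof -
    obtain n0 where "\<forall>n\<ge>n0. card {i \<in> Z m. i \<le> n} * Suc m \<le> n"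
      using null_densityD[OF null[of m], of m] by (rule exE)
    hence "ok t m" if "t \<ge> max m n0" for t using that by (auto simp: ok_def)
    thus ?thesis unfolding eventually_sequentially by blast
  qed
  have g_mono: "g s \<le> g t" if "s \<le> t" for s t
    using ok_g[of s] g_ge[of t "g s"] that by (auto simp: ok_def)
  define B where "B = {t. t \<in> Z (g t)}"
  \<comment> \<open>Levels only grow with time. Up to \<open>n\<close>, all of \<open>B\<close>
    therefore lies in the set of the level reached at \<open>n\<close>, and the density bound of
    that level is valid there.\<close>
  have sub: "{i \<in> B. i \<le> n} \<subseteq> {i \<in> Z (g n). i \<le> n}" for n
    using mono g_mono unfolding B_def by blast
  have "null_density B"
    unfolding null_density_iff
  proof
    fix k
    show "\<forall>\<^sub>F n in sequentially. card {i \<in> B. i \<le> n} * Suc k \<le> n"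
      using ev_ok[of "Suc k"]
    proof eventually_elim
      case (elim n)
      hence k: "Suc k \<le> g n" by (rule g_ge)
      have "card {i \<in> B. i \<le> n} * Suc k \<le> card {i \<in> Z (g n). i \<le> n} * Suc (g n)"
        using k by (intro mult_mono card_mono sub) auto
      also have "\<dots> \<le> n" using ok_g[of n] k by (auto simp: ok_def)
      finally show ?case .
    qed
  qed
  moreover have "\<forall>\<^sub>F t in sequentially. t \<in> Z m \<longrightarrow> t \<in> B" for m
    using ev_ok[of m] by eventually_elim (use mono g_ge in \<open>auto simp: B_def\<close>)
  ultimately show ?thesis by (rule that)
qed

lemma null_density_complement_enumerate:
  assumes "null_density B"
  obtains \<phi> :: "nat \<Rightarrow> nat" where "strict_mono \<phi>" "range \<phi> = - B"
proof -
  have "infinite (- B)"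
    unfolding infinite_nat_iff_unbounded_le Compl_iff by (intro allI null_density_frequently assms)
  thus ?thesis using that[of "enumerate (- B)"] by (simp add: strict_mono_enumerate range_enumerate)
qed

text \<open>A set which, up to a null set, repeats its own pattern in all but one of the residue
  classes modulo \<open>P\<close> has upper density \<open>\<delta> \<le> (1 - 1/P) \<delta>\<close>.\<close>

lemma null_density_self_similar:
  fixes P a0 :: nat
  assumes C: "null_density C" and P: "a0 < P"
    and self: "\<And>a b. a < P \<Longrightarrow> a + P * b \<in> B \<Longrightarrow> b \<in> B"
    and a0: "\<And>b. a0 + P * b \<in> B \<Longrightarrow> b \<in> C"
  shows "null_density B"
proof -
  \<comment> \<open>With strict bounds, \<open>i < P * n\<close> splits exactly into a residue below
    \<open>P\<close> and a quotient below \<open>n\<close>.\<close>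
  define f c where "f n = card {i \<in> B. i < n}" and "c n = card {i \<in> C. i < n}" for n
  have rec: "f (P * n) \<le> (P - 1) * f n + c n" for n
  proof -
    have "{i \<in> B. i < P * n} \<subseteq> (\<lambda>(a, b). a + P * b) ` (({..<P} - {a0}) \<times> {i \<in> B. i < n}) \<union>
        (\<lambda>b. a0 + P * b) ` {i \<in> C. i < n}"
    proof
      fix i assume i: "i \<in> {i \<in> B. i < P * n}"
      have d: "i = i mod P + P * (i div P)" by simp
      have m: "i mod P < P" using P by simp
      have n: "i div P < n" using i by (simp add: less_mult_imp_div_less mult.commute)
      show "i \<in> (\<lambda>(a, b). a + P * b) ` (({..<P} - {a0}) \<times> {i \<in> B. i < n}) \<union>
        (\<lambda>b. a0 + P * b) ` {i \<in> C. i < n}"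
      proof (cases "i mod P = a0")
        case True
        hence "i div P \<in> {i \<in> C. i < n}" using a0[of "i div P"] i d n by auto
        moreover have "i = a0 + P * (i div P)" using d True by simp
        ultimately show ?thesis by blast
      next
        case False
        have "i div P \<in> {i \<in> B. i < n}" using self[OF m, of "i div P"] i n d by auto
        hence "(i mod P, i div P) \<in> ({..<P} - {a0}) \<times> {i \<in> B. i < n}" using False m by auto
        from imageI[OF this, of "\<lambda>(a, b). a + P * b"] show ?thesis by simp
      qed
    qed
    hence "f (P * n) \<le> card ((\<lambda>(a, b). a + P * b) ` (({..<P} - {a0}) \<times> {i \<in> B. i < n}) \<union>
        (\<lambda>b. a0 + P * b) ` {i \<in> C. i < n})"
      unfolding f_def by (intro card_mono) auto
    also have "\<dots> \<le> card (({..<P} - {a0}) \<times> {i \<in> B. i < n}) + card {i \<in> C. i < n}"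
      by (intro order_trans[OF card_Un_le] add_mono card_image_le) auto
    also have "card (({..<P} - {a0}) \<times> {i \<in> B. i < n}) = (P - 1) * f n"
      using P by (simp add: card_cartesian_product f_def)
    finally show ?thesis by (simp add: c_def)
  qed
  have f_mono: "m \<le> n \<Longrightarrow> f m \<le> f n" for m n
    unfolding f_def by (intro card_mono) auto
  have c_small: "\<forall>\<^sub>F n in sequentially. real (c n) \<le> e * real n" if e: "e > 0" for e
  proof -
    have "\<forall>\<^sub>F n in sequentially. real (card {i \<in> C. i \<le> n}) / real n < e"
      using C e unfolding null_density_def by (rule order_tendstoD)
    thus ?thesis using eventually_gt_at_top[of 0]
    proof eventually_elim
      case (elim n)
      have "real (c n) \<le> real (card {i \<in> C. i \<le> n})"
        unfolding c_def by (intro of_nat_mono card_mono) auto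
      with elim show ?case by (simp add: field_simps)
    qed
  qed
  \<comment> \<open>One of \<open>P\<close> residue classes is saved. Half of this saving is spent,
    a quarter on \<open>C\<close> and a quarter on rounding \<open>N\<close> up to a multiple of
    \<open>P\<close>, which leaves the factor \<open>(P - 1/2) / P\<close>.\<close>
  define q where "q = 1 - 1 / (2 * real P)"
  have q: "0 < q" "q < 1" using P by (auto simp: q_def field_simps)
  have step: "\<forall>\<^sub>F n in sequentially. real (f n) \<le> e * q * real n"
    if e: "e > 0" and S: "\<forall>\<^sub>F n in sequentially. real (f n) \<le> e * real n" for e
  proof -
    obtain n0 where n0: "\<And>n. n \<ge> n0 \<Longrightarrow> real (f n) \<le> e * real n \<and> real (c n) \<le> e / 4 * real n"
      using eventually_conj[OF S c_small[of "e / 4"]] e unfolding eventually_sequentially by auto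
    have "real (f N) \<le> e * q * real N" if N: "N \<ge> P * (n0 + 4 * P)" for N
    proof -
      define n where "n = N div P"
      have n: "P * n \<le> N" "N < P * Suc n"
        using P dividend_less_div_times[of P N] by (auto simp: n_def mult.commute)
      have n_ge: "n \<ge> n0 + 4 * P"
        unfolding n_def using N P by (simp add: less_eq_div_iff_mult_less_eq mult.commute)
      have "real (f N) \<le> real (f (P * Suc n))" using n by (intro of_nat_mono f_mono) simp
      also have "\<dots> \<le> real ((P - 1) * f (Suc n) + c (Suc n))" using rec[of "Suc n"] by linarith
      also have "\<dots> = (real P - 1) * real (f (Suc n)) + real (c (Suc n))"
        using P by (simp add: of_nat_diff)
      also have "\<dots> \<le> (real P - 1) * (e * real (Suc n)) + e / 4 * real (Suc n)"
        using n0[of "Suc n"] n_ge P by (intro add_mono mult_left_mono) auto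
      also have "\<dots> = e * ((real P - 3 / 4) * (real n + 1))" by (simp add: field_simps)
      also have "(real P - 3 / 4) * (real n + 1) \<le> (real P - 1 / 2) * real n"
      proof -
        have "real n \<ge> 4 * real P" using n_ge by linarith
        thus ?thesis by (simp add: algebra_simps)
      qed
      also have "(real P - 1 / 2) * real n = q * (real P * real n)"
        using P by (simp add: q_def field_simps)
      also have "\<dots> \<le> q * real N"
        using n(1) q by (intro mult_left_mono) (auto simp flip: of_nat_mult)
      finally show ?thesis using e by (simp add: mult.assoc)
    qed
    thus ?thesis unfolding eventually_sequentially by blast
  qed
  have "\<forall>\<^sub>F n in sequentially. real (f n) \<le> q ^ k * real n" for k
  proof (induction k)
    case 0
    have "f n \<le> card {..<n}" for n unfolding f_def by (intro card_mono) auto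
    thus ?case by simp
  next
    case (Suc k)
    with step[of "q ^ k"] q show ?case by (simp add: mult.commute)
  qed
  note small = this
  show ?thesis
    unfolding null_density_def
  proof (rule tendstoI)
    fix e :: real assume e: "e > 0"
    obtain k where k: "q ^ k < e / 2" using real_arch_pow_inv[of "e / 2" q] q e by auto
    have "\<forall>\<^sub>F n in sequentially. real n \<ge> 2 / e"
      by (rule filterlim_real_sequentially[unfolded filterlim_at_top, rule_format])
    thus "\<forall>\<^sub>F n in sequentially. dist (real (card {i \<in> B. i \<le> n}) / real n) 0 < e"
      using small[of k] eventually_gt_at_top[of 0]
    proof eventually_elim
      case (elim n)
      have "{i \<in> B. i \<le> n} \<subseteq> insert n {i \<in> B. i < n}" by auto
      hence "card {i \<in> B. i \<le> n} \<le> card (insert n {i \<in> B. i < n})" by (intro card_mono) auto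
      also have "\<dots> \<le> Suc (f n)" unfolding f_def by (simp add: card_insert_if)
      finally have "real (card {i \<in> B. i \<le> n}) \<le> q ^ k * real n + 1" using elim by linarith
      also have "q ^ k * real n < e / 2 * real n" using k elim by (intro mult_strict_right_mono) auto
      finally have "real (card {i \<in> B. i \<le> n}) < e / 2 * real n + 1" by simp
      also have "1 \<le> e / 2 * real n" using elim e by (simp add: field_simps)
      finally show ?case using elim by (simp add: field_simps)
    qed
  qed
qed

section \<open>Local rules, torsion and common kernels\<close>

definition ca :: "int set \<Rightarrow> (int \<Rightarrow> 'a \<Rightarrow> 'a) \<Rightarrow> 'a::ab_group_add config \<Rightarrow> 'a config" where
  "ca N \<phi> x = (\<lambda>z. \<Sum>i\<in>N. \<phi> i (x (z + i)))"

lemma funpow_eventually_periodic: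
  fixes f :: "'a::finite \<Rightarrow> 'a"
  obtains a d where "d > 0" "(f ^^ (a + d)) x = (f ^^ a) x"
proof -
  have "\<not> inj (\<lambda>n. (f ^^ n) x)"
    using finite_imageD[of "\<lambda>n. (f ^^ n) x" UNIV] infinite_UNIV_nat by auto
  then obtain m n where mn: "m \<noteq> n" "(f ^^ m) x = (f ^^ n) x" unfolding inj_def by blast
  show ?thesis
  proof (cases "m < n")
    case True
    thus ?thesis using mn that[of "n - m" m] by simp
  next
    case False
    thus ?thesis using mn that[of "m - n" n] by simp
  qed
qed

lemma ex_nmult_eq_0:
  fixes x :: "'a::{ab_group_add, finite}"
  shows "\<exists>n>0. nmult n x = 0"
proof -
  obtain a d where d: "d > 0" "(((+) x) ^^ (a + d)) 0 = (((+) x) ^^ a) 0"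
    by (rule funpow_eventually_periodic)
  have "(((+) x) ^^ n) 0 = nmult n x" for n by (induction n) (auto simp: add.commute)
  hence "nmult d x = 0" using d(2) by (simp add: nmult_add_left)
  with d(1) show ?thesis by blast
qed

text \<open>Dividing the order of \<open>x\<close> by one of its prime factors leaves an element of
  prime order.\<close>

lemma ex_prime_torsion:
  fixes x :: "'a::{ab_group_add, finite}"
  assumes "x \<noteq> 0"
  shows "\<exists>p m. prime p \<and> nmult m x \<noteq> 0 \<and> nmult p (nmult m x) = 0"
proof -
  obtain n where n: "n > 0 \<and> nmult n x = 0" and least: "\<And>m. m < n \<Longrightarrow> \<not> (m > 0 \<and> nmult m x = 0)"
    using ex_nmult_eq_0[of x] exists_least_iff[of "\<lambda>n. n > 0 \<and> nmult n x = 0"] by blast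
  have "n \<noteq> 1" using n assms by auto
  then obtain p where p: "prime p" "p dvd n" using prime_factor_nat by blast
  obtain m where m: "n = p * m" using p(2) by (auto simp: dvd_def)
  have "m > 0" "m < n" using n p(1) prime_gt_1_nat[of p] by (auto simp: m)
  with least have "nmult m x \<noteq> 0" by blast
  moreover have "nmult p (nmult m x) = 0" using n by (simp add: m nmult_mult)
  ultimately show ?thesis using p(1) by blast
qed

text \<open>The last nonzero iterate of \<open>x\<close> under one coefficient lies in the kernel of
  that coefficient, and commutation keeps the others nilpotent there. The clause on maps
  \<open>g\<close> commuting with the coefficients carries kernels already obtained through the
  later stages of the induction.\<close>

lemma jointly_nilpotent_common_kernel:
  fixes \<phi> :: "'i \<Rightarrow> 'a::ab_group_add \<Rightarrow> 'a"
  assumes "finite I" and "\<And>i. i \<in> I \<Longrightarrow> endomorphism (\<phi> i)"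
    and "\<And>i j. i \<in> I \<Longrightarrow> j \<in> I \<Longrightarrow> \<phi> i \<circ> \<phi> j = \<phi> j \<circ> \<phi> i"
    and "x \<noteq> 0" and "\<And>i. i \<in> I \<Longrightarrow> \<exists>n. (\<phi> i ^^ n) x = 0"
  shows "\<exists>y. y \<noteq> 0 \<and> (\<forall>i\<in>I. \<phi> i y = 0) \<and>
    (\<forall>g. (\<forall>i\<in>I. g \<circ> \<phi> i = \<phi> i \<circ> g) \<longrightarrow> g x = 0 \<longrightarrow> g y = 0)"
  using assms
proof (induction I arbitrary: x)
  case empty
  thus ?case by (intro exI[of _ x]) simp
next
  case (insert i I)
  define n where "n = (LEAST n. (\<phi> i ^^ n) x = 0)"
  have n0: "(\<phi> i ^^ n) x = 0"
    unfolding n_def by (rule LeastI_ex) (rule insert.prems(4), simp)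
  then obtain m where m: "n = Suc m" using insert.prems(3) by (cases n) auto
  define x1 where "x1 = (\<phi> i ^^ m) x"
  have "m < n" by (simp add: m)
  hence x1: "x1 \<noteq> 0" unfolding x1_def n_def by (rule not_less_Least)
  have ix1: "\<phi> i x1 = 0" using n0 by (simp add: m x1_def)
  have g0: "g x1 = 0" if "g \<circ> \<phi> i = \<phi> i \<circ> g" "g x = 0" for g
    using comp_funpow_commute[OF that(1), of m x] that(2) insert.prems(1)[of i]
    by (simp add: x1_def endomorphism_0 endomorphism_funpow)
  have "\<exists>y. y \<noteq> 0 \<and> (\<forall>i\<in>I. \<phi> i y = 0) \<and>
      (\<forall>g. (\<forall>i\<in>I. g \<circ> \<phi> i = \<phi> i \<circ> g) \<longrightarrow> g x1 = 0 \<longrightarrow> g y = 0)"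
  proof (rule insert.IH)
    fix j assume j: "j \<in> I"
    obtain k where k: "(\<phi> j ^^ k) x = 0" using insert.prems(4)[of j] j by auto
    have "(\<phi> j ^^ k) \<circ> \<phi> i = \<phi> i \<circ> (\<phi> j ^^ k)"
      using funpow_commute[OF insert.prems(2)[of j i], of k 1] j by simp
    thus "\<exists>n. (\<phi> j ^^ n) x1 = 0" using g0 k by blast
  qed (use insert.prems x1 in auto)
  then obtain y where y: "y \<noteq> 0" "\<forall>i\<in>I. \<phi> i y = 0"
    and g: "\<And>g. (\<forall>i\<in>I. g \<circ> \<phi> i = \<phi> i \<circ> g) \<Longrightarrow> g x1 = 0 \<Longrightarrow> g y = 0" by (elim exE conjE) simp
  have "\<phi> i y = 0" by (intro g[of "\<phi> i"] ix1 ballI insert.prems(2)) simp_all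
  show ?case
  proof (intro exI[of _ y] conjI allI impI)
    show "\<forall>j\<in>insert i I. \<phi> j y = 0" using \<open>\<phi> i y = 0\<close> y(2) by simp
    show "h y = 0" if "\<forall>j\<in>insert i I. h \<circ> \<phi> j = \<phi> j \<circ> h" "h x = 0" for h
      using that g0[of h] by (intro g[of h]) simp_all
  qed (rule y(1))
qed

text \<open>If \<open>\<phi>\<^sub>i\<close> maps into the kernel of \<open>\<psi>\<close>, passing from \<open>x\<close> to \<open>x - \<phi>\<^sub>i\<^sup>d x\<close> keeps \<open>\<psi> x\<close>, and
  for a suitable period \<open>d\<close> it makes \<open>\<phi>\<^sub>i\<close> nilpotent at \<open>x\<close>.\<close>

lemma common_kernel_nonzero:
  fixes \<phi> :: "'i \<Rightarrow> 'a::{ab_group_add, finite} \<Rightarrow> 'a" and \<psi> :: "'a \<Rightarrow> complex"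
  assumes I: "finite I" and endo: "\<And>i. i \<in> I \<Longrightarrow> endomorphism (\<phi> i)"
    and comm: "\<And>i j. i \<in> I \<Longrightarrow> j \<in> I \<Longrightarrow> \<phi> i \<circ> \<phi> j = \<phi> j \<circ> \<phi> i"
    and mult: "\<And>x y. \<psi> (x + y) = \<psi> x * \<psi> y" and one: "\<psi> 0 = 1" and x0: "\<psi> x0 \<noteq> 1"
    and ker: "\<And>i x. i \<in> I \<Longrightarrow> \<psi> (\<phi> i x) = 1"
  shows "\<exists>y. y \<noteq> 0 \<and> (\<forall>i\<in>I. \<phi> i y = 0)"
proof -
  have "\<exists>x. \<psi> x \<noteq> 1 \<and> (\<forall>i\<in>I. \<exists>n. (\<phi> i ^^ n) x = 0)"
    using I endo comm ker
  proof (induction I)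
    case empty
    show ?case using x0 by blast
  next
    case (insert i I)
    obtain x where x: "\<psi> x \<noteq> 1" "\<forall>i\<in>I. \<exists>n. (\<phi> i ^^ n) x = 0"
      using insert.IH insert.prems by (metis insertCI)
    obtain a d where d: "d > 0" "(\<phi> i ^^ (a + d)) x = (\<phi> i ^^ a) x"
      by (rule funpow_eventually_periodic)
    define x' where "x' = x - (\<phi> i ^^ d) x"
    have "(\<phi> i ^^ d) x = \<phi> i ((\<phi> i ^^ (d - 1)) x)" using d(1) by (cases d) auto
    hence "\<psi> ((\<phi> i ^^ d) x) = 1" using insert.prems(3)[of i] by simp
    hence "\<psi> x' = \<psi> x" using mult[of x' "(\<phi> i ^^ d) x"] by (simp add: x'_def)
    moreover have "(\<phi> i ^^ a) x' = 0"
      using d(2) insert.prems(1)[of i]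
      by (simp add: x'_def endomorphism_diff endomorphism_funpow funpow_add)
    moreover have "\<exists>n. (\<phi> j ^^ n) x' = 0" if j: "j \<in> I" for j
    proof -
      obtain n where n: "(\<phi> j ^^ n) x = 0" using x(2) j by blast
      have "(\<phi> j ^^ n) ((\<phi> i ^^ d) x) = (\<phi> i ^^ d) ((\<phi> j ^^ n) x)"
        using fun_cong[OF funpow_commute[OF insert.prems(2)[of j i], of n d], of x] j by simp
      hence "(\<phi> j ^^ n) x' = 0"
        using j insert.prems(1)
        by (simp add: x'_def endomorphism_diff endomorphism_funpow n endomorphism_0)
      thus ?thesis ..
    qed
    ultimately show ?case using x(1) by (intro exI[of _ x']) auto
  qed
  then obtain x where x: "\<psi> x \<noteq> 1" "\<forall>i\<in>I. \<exists>n. (\<phi> i ^^ n) x = 0" by blast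
  have "x \<noteq> 0" using x(1) one by auto
  from jointly_nilpotent_common_kernel[where \<phi> = \<phi>, OF I endo comm this] x(2)
  show ?thesis by blast
qed

section \<open>Prime power iterates and residue classes\<close>

lemma sum_fun_apply: "(\<Sum>i\<in>A. f i) z = (\<Sum>i\<in>A. f i z)"
  by (induction A rule: infinite_finite_induct) auto

text \<open>Shifts commute with maps applied entrywise, so the summands \<open>A i\<close> are
  commuting endomorphisms of the group of configurations, and the prime power rule applies to
  them.\<close>

lemma ca_prime_power:
  assumes N: "finite N" and endo: "\<And>i. i \<in> N \<Longrightarrow> endomorphism (\<phi> i)"
    and comm: "\<And>i j. i \<in> N \<Longrightarrow> j \<in> N \<Longrightarrow> \<phi> i \<circ> \<phi> j = \<phi> j \<circ> \<phi> i"
    and p: "prime p" and x: "\<And>z. nmult p (x z) = 0"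
  shows "(ca N \<phi> ^^ (p ^ n)) x = (\<lambda>z. \<Sum>i\<in>N. (\<phi> i ^^ (p ^ n)) (x (z + int (p ^ n) * i)))"
proof -
  define A where "A i y = (\<lambda>z. \<phi> i (y (z + i)))" for i and y :: "'a config"
  have ca_A: "ca N \<phi> = (\<lambda>x. \<Sum>i\<in>N. A i x)"
    by (simp add: fun_eq_iff ca_def A_def sum_fun_apply)
  have A_pow: "(A i ^^ k) y = (\<lambda>z. (\<phi> i ^^ k) (y (z + int k * i)))" for i k y
    by (induction k) (auto simp: A_def algebra_simps)
  have "(ca N \<phi> ^^ (p ^ n)) x = (\<Sum>i\<in>N. (A i ^^ (p ^ n)) x)"
    unfolding ca_A
  proof (rule funpow_prime_power_Sum[OF N _ _ p])
    show "endomorphism (A i)" if "i \<in> N" for i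
      using endo[OF that] by (simp add: endomorphism_def A_def fun_eq_iff)
    show "A i \<circ> A j = A j \<circ> A i" if "i \<in> N" "j \<in> N" for i j
    proof -
      have "\<phi> i (\<phi> j v) = \<phi> j (\<phi> i v)" for v using fun_cong[OF comm[OF that], of v] by simp
      thus ?thesis by (simp add: A_def fun_eq_iff algebra_simps)
    qed
    show "nmult p x = 0" by (simp add: fun_eq_iff nmult_fun x)
  qed
  thus ?thesis by (simp add: fun_eq_iff sum_fun_apply A_pow)
qed

text \<open>When an iterate moves entries by multiples of \<open>P\<close> only, each residue class
  modulo \<open>P\<close> evolves on its own; this is the configuration carried by the class of
  \<open>e\<close>, rescaled.\<close>

definition residue_section :: "int \<Rightarrow> int \<Rightarrow> 'a config \<Rightarrow> 'a config" where
  "residue_section P e x = (\<lambda>j. x (e + P * j))"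

lemma config_rank_ge_residue_sections:
  fixes x :: "'a::zero config"
  assumes x: "finite_config x" and P: "P > 0" and E: "E \<subseteq> {0..<P}"
  shows "(\<Sum>e\<in>E. config_rank (residue_section P e x)) \<le> config_rank x"
proof -
  have "finite E" using E by (rule finite_subset) simp
  define f where "f = (\<lambda>(e, j). e + P * j)"
  have f: "fst a = f a mod P \<and> snd a = f a div P" if "fst a \<in> {0..<P}" for a
    using that P by (cases a) (simp add: f_def)
  have inj: "inj_on f (E \<times> UNIV)"
  proof (rule inj_onI)
    fix a b assume ab: "a \<in> E \<times> UNIV" "b \<in> E \<times> UNIV" "f a = f b"
    hence "fst a \<in> {0..<P}" "fst b \<in> {0..<P}" using E by auto
    thus "a = b" using f[of a] f[of b] ab(3) by (simp add: prod_eq_iff)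
  qed
  let ?S = "SIGMA e:E. {j. residue_section P e x j \<noteq> 0}"
  have img: "f ` ?S \<subseteq> {i. x i \<noteq> 0}" by (auto simp: f_def residue_section_def)
  have injS: "inj_on f ?S" by (rule inj_on_subset[OF inj]) auto
  have finS: "finite ?S"
    using finite_subset[OF img] x injS by (simp add: finite_config_def finite_image_iff)
  have fin: "finite {j. residue_section P e x j \<noteq> 0}" if "e \<in> E" for e
  proof (rule finite_subset)
    show "{j. residue_section P e x j \<noteq> 0} \<subseteq> snd ` ?S" using that by force
  qed (use finS in simp)
  have "(\<Sum>e\<in>E. config_rank (residue_section P e x)) = card ?S"
    unfolding config_rank_def using \<open>finite E\<close> fin by (simp add: card_SigmaI)
  also have "\<dots> = card (f ` ?S)" using injS by (simp add: card_image)
  also have "\<dots> \<le> config_rank x"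
    unfolding config_rank_def using img x by (intro card_mono) (auto simp: finite_config_def)
  finally show ?thesis .
qed

definition supported_within :: "int \<Rightarrow> 'a::zero config \<Rightarrow> bool" where
  "supported_within D x \<longleftrightarrow> (\<forall>z. x z \<noteq> 0 \<longrightarrow> \<bar>z\<bar> \<le> D)"

lemma supported_within_finite: "supported_within D x \<Longrightarrow> finite_config x"
  unfolding supported_within_def finite_config_def
  by (rule finite_subset[of _ "{-D..D}"]) (auto simp: abs_le_iff)

lemma finite_config_supported_within:
  assumes "finite_config x"
  obtains D where "\<And>D'. D \<le> D' \<Longrightarrow> supported_within D' x"
proof -
  have "finite (abs ` {z. x z \<noteq> 0})" using assms by (simp add: finite_config_def)
  then obtain D where "\<forall>i\<in>abs ` {z. x z \<noteq> 0}. i \<le> D"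
    using bdd_above_finite unfolding bdd_above_def by blast
  thus ?thesis by (intro that[of D]) (auto simp: supported_within_def intro: order_trans)
qed

text \<open>If raising to the power \<open>p ^ l\<close> fixes \<open>f\<close> on \<open>V\<close>,
  then so does doing it \<open>s\<close> times in succession.\<close>

lemma funpow_prime_power_fixed:
  assumes stable: "\<And>v. v \<in> V \<Longrightarrow> f v \<in> V" and fixed: "\<And>v. v \<in> V \<Longrightarrow> (f ^^ (p ^ l)) v = f v"
    and v: "v \<in> V"
  shows "(f ^^ (p ^ (l * s))) v = f v"
proof (induction s)
  case (Suc s)
  let ?f = "f ^^ (p ^ (l * s))"
  \<comment> \<open>Only \<open>?f v = f v\<close> at the single point \<open>v\<close> is known.
    Since \<open>?f\<close> commutes with the powers of \<open>f\<close>, the agreement propagates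
    to the iterates at \<open>v\<close>.\<close>
  have pp: "(?f ^^ m) v = (f ^^ m) v" for m
  proof (induction m)
    case (Suc m)
    have "(?f ^^ Suc m) v = ?f ((f ^^ m) v)" using Suc by simp
    also have "\<dots> = (f ^^ m) (?f v)"
      using fun_cong[OF funpow_commute[of f f "p ^ (l * s)" m], of v] by simp
    also have "\<dots> = (f ^^ m) (f v)" by (simp only: \<open>?f v = f v\<close>)
    also have "\<dots> = (f ^^ Suc m) v" by (simp add: funpow_swap1)
    finally show ?case .
  qed simp
  have "(f ^^ (p ^ (l * Suc s))) v = (?f ^^ (p ^ l)) v"
    by (simp add: funpow_mult power_add mult.commute)
  also have "\<dots> = f v" by (simp add: pp fixed v)
  finally show ?case .
qed simp

section \<open>Rank growth when the coefficients act through a finite field\<close>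

text \<open>On \<open>V\<close> the coefficients behave like elements of the field with
  \<open>p ^ l\<close> elements: zero or injective, and equal to their own \<open>p ^ l\<close>-th
  power. The positions \<open>i1\<close> and \<open>i2\<close> carry two nonzero field elements;
  they are the source of the rank growth.\<close>

locale frobenius_ca =
  fixes V :: "'a::ab_group_add set" and N :: "int set" and \<phi> :: "int \<Rightarrow> 'a \<Rightarrow> 'a"
    and p l :: nat and i1 i2 :: int
  assumes N: "finite N"
    and endo: "\<And>i. i \<in> N \<Longrightarrow> endomorphism (\<phi> i)"
    and comm: "\<And>i j. i \<in> N \<Longrightarrow> j \<in> N \<Longrightarrow> \<phi> i \<circ> \<phi> j = \<phi> j \<circ> \<phi> i"
    and p: "prime p" and pV: "\<And>v. v \<in> V \<Longrightarrow> nmult p v = 0"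
    and V0: "0 \<in> V" and V_diff: "\<And>v w. v \<in> V \<Longrightarrow> w \<in> V \<Longrightarrow> v - w \<in> V"
    and V_stable: "\<And>i v. i \<in> N \<Longrightarrow> v \<in> V \<Longrightarrow> \<phi> i v \<in> V"
    and zero_or_inj: "\<And>i. i \<in> N \<Longrightarrow> (\<forall>v\<in>V. \<phi> i v = 0) \<or> (\<forall>v\<in>V. \<phi> i v = 0 \<longrightarrow> v = 0)"
    and l: "l > 0" and frob: "\<And>i v. i \<in> N \<Longrightarrow> v \<in> V \<Longrightarrow> (\<phi> i ^^ (p ^ l)) v = \<phi> i v"
    and i1: "i1 \<in> N" "\<And>v. v \<in> V \<Longrightarrow> \<phi> i1 v = 0 \<Longrightarrow> v = 0"
    and i2: "i2 \<in> N" "\<And>v. v \<in> V \<Longrightarrow> \<phi> i2 v = 0 \<Longrightarrow> v = 0"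
    and i12: "i1 \<noteq> i2"
begin

abbreviation F where "F \<equiv> ca N \<phi>"

definition V_valued where "V_valued x \<longleftrightarrow> (\<forall>z. x z \<in> V)"

lemma V_add: "v \<in> V \<Longrightarrow> w \<in> V \<Longrightarrow> v + w \<in> V"
  using V_diff[of v "0 - w"] V_diff[of 0 w] V0 by simp

lemma V_sum: "(\<And>i. i \<in> A \<Longrightarrow> f i \<in> V) \<Longrightarrow> sum f A \<in> V"
  by (induction A rule: infinite_finite_induct) (auto simp: V0 V_add)

lemma V_valued_F: "V_valued x \<Longrightarrow> V_valued (F x)"
  by (auto simp: V_valued_def ca_def intro!: V_sum V_stable)

lemma V_valued_funpow: "V_valued x \<Longrightarrow> V_valued ((F ^^ n) x)"
  by (induction n) (auto simp: V_valued_F)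

text \<open>This is the identity \<open>F(X)^Q = F(X^Q)\<close> for a Laurent polynomial over a
  finite field, with \<open>Q\<close> a power of the field size, read on configurations.\<close>

definition period where
  "period Q \<longleftrightarrow> Q > 0 \<and> (\<forall>x z. V_valued x \<longrightarrow> (F ^^ Q) x z = (\<Sum>i\<in>N. \<phi> i (x (z + int Q * i))))"

lemma period_prime_power: "period (p ^ (l * s))"
proof -
  have "(F ^^ (p ^ (l * s))) x z = (\<Sum>i\<in>N. \<phi> i (x (z + int (p ^ (l * s)) * i)))"
    if "V_valued x" for x z
  proof -
    have "(F ^^ (p ^ (l * s))) x = (\<lambda>z. \<Sum>i\<in>N. (\<phi> i ^^ (p ^ (l * s))) (x (z + int (p ^ (l * s)) * i)))"
      using that by (intro ca_prime_power N endo comm p pV) (auto simp: V_valued_def)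
    thus ?thesis using that by (simp add: funpow_prime_power_fixed[OF V_stable frob] V_valued_def cong: sum.cong)
  qed
  thus ?thesis using p by (simp add: period_def prime_gt_0_nat)
qed

text \<open>Two periods are used together: \<open>Q ^ 2\<close> as the modulus, and \<open>Q\<close>
  as the time below the modulus at which two separate translates become visible.\<close>

lemma ex_period:
  obtains Q where "Q \<ge> B" "period Q" "period (Q ^ 2)"
proof -
  have "B \<le> l * B" using l by simp
  also have "l * B < 2 ^ (l * B)" by (rule less_exp)
  also have "(2::nat) ^ (l * B) \<le> p ^ (l * B)" using p by (intro power_mono prime_ge_2_nat) auto
  finally have "p ^ (l * B) \<ge> B" by simp
  moreover have "(p ^ (l * B)) ^ 2 = p ^ (l * (2 * B))"
    by (simp add: power_mult[symmetric] ac_simps)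
  ultimately show ?thesis using that period_prime_power by metis
qed

text \<open>\<open>F ^^ P\<close> has the coefficients of \<open>F\<close> at positions multiplied
  by \<open>P\<close>, so on each residue class it acts as \<open>F\<close> itself.\<close>

lemma residue_section_funpow:
  assumes P: "period P" and x: "V_valued x"
  shows "residue_section (int P) e ((F ^^ (P * b)) x) = (F ^^ b) (residue_section (int P) e x)"
proof (induction b)
  case (Suc b)
  have "(F ^^ (P * Suc b)) x = (F ^^ P) ((F ^^ (P * b)) x)" by (simp add: funpow_add)
  hence "residue_section (int P) e ((F ^^ (P * Suc b)) x) =
      F (residue_section (int P) e ((F ^^ (P * b)) x))"
    using P V_valued_funpow[OF x]
    by (simp add: residue_section_def fun_eq_iff period_def ca_def algebra_simps)
  thus ?case using Suc by simp
qed simp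

text \<open>Extreme entries cannot cancel: the leftmost nonzero entry of \<open>x\<close>, moved by
  the largest position with an injective coefficient, meets no other contribution.\<close>

lemma F_nonzero:
  assumes x: "V_valued x" "finite_config x" "x \<noteq> 0"
  shows "F x \<noteq> 0"
proof -
  define N' where "N' = {i\<in>N. \<forall>v\<in>V. \<phi> i v = 0 \<longrightarrow> v = 0}"
  have N': "finite N'" "N' \<noteq> {}" "N' \<subseteq> N" using N i1 by (auto simp: N'_def)
  have F: "F x z = (\<Sum>i\<in>N'. \<phi> i (x (z + i)))" for z
    unfolding ca_def
  proof (rule sum.mono_neutral_right[OF N N'(3)], rule ballI)
    fix i assume i: "i \<in> N - N'"
    hence "\<forall>v\<in>V. \<phi> i v = 0" using zero_or_inj[of i] unfolding N'_def by auto
    thus "\<phi> i (x (z + i)) = 0" using x(1) by (auto simp: V_valued_def)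
  qed
  define m where "m = Max N'"
  define S where "S = {z. x z \<noteq> 0}"
  have S: "finite S" "S \<noteq> {}" using x by (auto simp: S_def finite_config_def fun_eq_iff)
  define z0 where "z0 = Min S"
  have z0: "z0 \<in> S" unfolding z0_def using S by (rule Min_in)
  have m: "m \<in> N'" unfolding m_def using N' by (intro Max_in)
  have "F x (z0 - m) = (\<Sum>i\<in>{m}. \<phi> i (x (z0 - m + i)))"
    unfolding F
  proof (rule sum.mono_neutral_right[OF N'(1)], use m in simp, rule ballI)
    fix i assume i: "i \<in> N' - {m}"
    hence "i < m" using Max_ge[OF N'(1), of i] by (auto simp: m_def)
    hence "z0 - m + i \<notin> S" using Min_le[OF S(1), of "z0 - m + i"] by (auto simp: z0_def)
    thus "\<phi> i (x (z0 - m + i)) = 0"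
      using i N'(3) endo by (auto simp: S_def intro!: endomorphism_0)
  qed
  also have "\<dots> \<noteq> 0"
    using z0 m x(1) by (auto simp: S_def N'_def V_valued_def)
  finally show ?thesis by auto
qed

lemma supported_within_funpow:
  assumes ND: "\<And>i. i \<in> N \<Longrightarrow> \<bar>i\<bar> \<le> D" and x: "supported_within D x"
  shows "supported_within (D + int a * D) ((F ^^ a) x)"
proof (induction a)
  case (Suc a)
  show ?case unfolding supported_within_def
  proof (intro allI impI)
    fix z assume "(F ^^ Suc a) x z \<noteq> 0"
    hence "(\<Sum>i\<in>N. \<phi> i ((F ^^ a) x (z + i))) \<noteq> 0" by (simp add: ca_def)
    then obtain i where i: "i \<in> N" "\<phi> i ((F ^^ a) x (z + i)) \<noteq> 0" by (rule sum.not_neutral_contains_not_neutral)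
    hence "(F ^^ a) x (z + i) \<noteq> 0" using endomorphism_0[OF endo[OF i(1)]] by metis
    hence "\<bar>z + i\<bar> \<le> D + int a * D" using Suc by (auto simp: supported_within_def)
    with ND[OF i(1)] show "\<bar>z\<bar> \<le> D + int (Suc a) * D" by (simp add: algebra_simps)
  qed
qed (use x in simp)

lemma funpow_nonzero:
  assumes ND: "\<And>i. i \<in> N \<Longrightarrow> \<bar>i\<bar> \<le> D" and x: "supported_within D x" "V_valued x" "x \<noteq> 0"
  shows "(F ^^ a) x \<noteq> 0"
proof (induction a)
  case 0
  show ?case using x(3) by (simp only: funpow.simps id_apply not_False_eq_True)
next
  case (Suc a)
  have "finite_config ((F ^^ a) x)"
    by (rule supported_within_finite[OF supported_within_funpow[OF ND x(1)]])
  from F_nonzero[OF V_valued_funpow[OF x(2)] this Suc] show ?case by (simp only: funpow.simps o_apply not_False_eq_True)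
qed

text \<open>All nonzero configurations of one window are treated at once, because passing to a
  residue class changes the configuration but not the window. The thresholds are powers of two,
  since an induction step on \<open>r\<close> shares the threshold between two residue
  classes.\<close>

definition bad where
  "bad D r = {t. \<exists>x. V_valued x \<and> supported_within D x \<and> x \<noteq> 0 \<and> config_rank ((F ^^ t) x) < 2 ^ r}"

text \<open>For \<open>a < P\<close> the radius \<open>(1 + a) * D\<close> is at most
  \<open>P * D\<close>, and restricting to one class modulo \<open>P\<close> divides it by
  \<open>P\<close>. The window is thus reproduced exactly.\<close>

lemma supported_residue_section:
  assumes a: "a < P" and e: "0 \<le> e" "e < int P"
    and x: "supported_within (D + int a * D) x" and D: "D \<ge> 0"
  shows "supported_within D (residue_section (int P) e x)"
  unfolding supported_within_def
proof (intro allI impI)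
  fix j assume "residue_section (int P) e x j \<noteq> 0"
  hence "\<bar>e + int P * j\<bar> \<le> D + int a * D" using x by (simp add: residue_section_def supported_within_def)
  also have "\<dots> = (1 + int a) * D" by (simp add: algebra_simps)
  also have "\<dots> \<le> int P * D" using a D by (intro mult_right_mono) auto
  finally have b: "\<bar>e + int P * j\<bar> \<le> int P * D" .
  show "\<bar>j\<bar> \<le> D"
  proof (rule ccontr)
    assume "\<not> \<bar>j\<bar> \<le> D"
    then consider "D + 1 \<le> j" | "j \<le> - D - 1" by linarith
    thus False
    proof cases
      case 1
      hence "int P * (D + 1) \<le> int P * j" by (intro mult_left_mono) auto
      with b e show False by (simp add: algebra_simps)
    next
      case 2
      hence "int P * j \<le> int P * (- D - 1)" by (intro mult_left_mono) auto
      with b e show False by (simp add: algebra_simps)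
    qed
  qed
qed

text \<open>For \<open>Q\<close> a large enough Frobenius period, \<open>F\<^sup>Q x\<close> contains translates of \<open>\<phi>\<^sub>i\<^sub>1 x\<close> and
  \<open>\<phi>\<^sub>i\<^sub>2 x\<close> which fall into different residue classes modulo \<open>P = Q\<^sup>2\<close>, and the residue classes
  evolve independently under \<open>F\<^sup>P\<close>. So the exponents \<open>t \<equiv> Q\<close> modulo \<open>P\<close> double the rank.\<close>

lemma null_density_bad:
  assumes ND: "\<And>i. i \<in> N \<Longrightarrow> \<bar>i\<bar> \<le> D" and D: "D \<ge> 0"
  shows "null_density (bad D r)"
proof (induction r)
  case 0
  have "t \<notin> bad D 0" for t
  proof
    assume "t \<in> bad D 0"
    then obtain x where x: "V_valued x" "supported_within D x" "x \<noteq> 0" "config_rank ((F ^^ t) x) < 2 ^ 0"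
      unfolding bad_def by (elim CollectE exE conjE) simp
    have "finite_config ((F ^^ t) x)"
      by (rule supported_within_finite[OF supported_within_funpow[OF ND x(2)]])
    hence "(F ^^ t) x = 0" using x(4) by (simp add: config_rank_def finite_config_def fun_eq_iff)
    thus False using funpow_nonzero[OF ND x(2,1,3)] by simp
  qed
  hence "bad D 0 = {}" by (simp add: set_eq_iff)
  thus ?case by (simp only: null_density_empty)
next
  case (Suc r)
  \<comment> \<open>The bound serves twice: different translates of the window
    \<open>[-D, D]\<close> by multiples of \<open>Q\<close> are disjoint, and \<open>i1\<close>,
    \<open>i2\<close> differ by at most \<open>2 * D\<close>, hence by less than
    \<open>Q\<close>.\<close>
  obtain Q where Q: "Q \<ge> nat (2 * D + 2)" "period Q" "period (Q ^ 2)" by (rule ex_period)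
  define P where "P = Q ^ 2"
  have QD: "int Q \<ge> 2 * D + 2" using Q(1) D by linarith
  hence "Q \<ge> 2" using D by linarith
  hence QP: "Q < P" by (simp add: P_def power2_eq_square)
  hence P0: "P > 0" by simp
  have per: "period P" using Q(3) by (simp add: P_def)
  have split: "(F ^^ (a + P * b)) x = (F ^^ (P * b)) ((F ^^ a) x)" for a b x
    by (simp add: add.commute[of a] funpow_add)
  \<comment> \<open>Low rank at time \<open>a + P * b\<close> in one class is low rank at time
    \<open>b\<close> for the configuration of that class at time \<open>a\<close>. The entry at
    \<open>z\<close> ensures that this configuration is nonzero, and \<open>r'\<close> is free
    because the step is used with both \<open>Suc r\<close> and \<open>r\<close>.\<close>
  have sec: "b \<in> bad D r'"
    if a: "a < P" and x: "V_valued x" "supported_within D x"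
      and z: "(F ^^ a) x z \<noteq> 0"
      and rk: "config_rank (residue_section (int P) (z mod int P) ((F ^^ (a + P * b)) x)) < 2 ^ r'"
    for a b x z r'
  proof -
    let ?e = "z mod int P"
    have e: "0 \<le> ?e" "?e < int P" using P0 by auto
    let ?y = "residue_section (int P) ?e ((F ^^ a) x)"
    have "supported_within D ?y"
      by (rule supported_residue_section[OF a e supported_within_funpow[OF ND x(2)] D])
    moreover have "V_valued ?y"
      using V_valued_funpow[OF x(1), of a] by (simp add: V_valued_def residue_section_def)
    moreover have "?y (z div int P) \<noteq> 0" using z by (simp add: residue_section_def)
    hence "?y \<noteq> 0" by auto
    moreover have "config_rank ((F ^^ b) ?y) < 2 ^ r'"
      using rk by (simp only: split residue_section_funpow[OF per V_valued_funpow[OF x(1)]])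
    ultimately show ?thesis unfolding bad_def by (intro CollectI exI[of _ ?y] conjI)
  qed
  have fin: "finite_config ((F ^^ t) x)" if "supported_within D x" for x t
    by (rule supported_within_finite[OF supported_within_funpow[OF ND that]])
  show ?case
  proof (rule null_density_self_similar[OF Suc QP])
    fix a b assume a: "a < P" and "a + P * b \<in> bad D (Suc r)"
    then obtain x where x: "V_valued x" "supported_within D x" "x \<noteq> 0"
        "config_rank ((F ^^ (a + P * b)) x) < 2 ^ Suc r"
      unfolding bad_def by (elim CollectE exE conjE) simp
    have "(F ^^ a) x \<noteq> 0" by (rule funpow_nonzero[OF ND x(2,1,3)])
    then obtain z where z: "(F ^^ a) x z \<noteq> 0" by (auto simp: fun_eq_iff)
    have "(\<Sum>e\<in>{z mod int P}. config_rank (residue_section (int P) e ((F ^^ (a + P * b)) x)))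
        \<le> config_rank ((F ^^ (a + P * b)) x)"
      using P0 by (intro config_rank_ge_residue_sections fin x(2)) auto
    hence "config_rank (residue_section (int P) (z mod int P) ((F ^^ (a + P * b)) x)) < 2 ^ Suc r"
      using x(4) by simp
    from sec[OF a x(1,2) z this] show "b \<in> bad D (Suc r)" .
  next
    fix b assume "Q + P * b \<in> bad D (Suc r)"
    then obtain x where x: "V_valued x" "supported_within D x" "x \<noteq> 0"
        "config_rank ((F ^^ (Q + P * b)) x) < 2 ^ Suc r"
      unfolding bad_def by (elim CollectE exE conjE) simp
    obtain e0 where e0: "x e0 \<noteq> 0" using x(3) by (auto simp: fun_eq_iff)
    hence e0D: "\<bar>e0\<bar> \<le> D" using x(2) by (simp add: supported_within_def)
    have nz: "(F ^^ Q) x (e0 - int Q * i) \<noteq> 0"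
      if i: "i \<in> N" "\<And>v. v \<in> V \<Longrightarrow> \<phi> i v = 0 \<Longrightarrow> v = 0" for i
    proof -
      have "(F ^^ Q) x (e0 - int Q * i) = (\<Sum>j\<in>N. \<phi> j (x (e0 - int Q * i + int Q * j)))"
        using Q(2) x(1) by (simp add: period_def)
      also have "\<dots> = (\<Sum>j\<in>{i}. \<phi> j (x (e0 - int Q * i + int Q * j)))"
      proof (rule sum.mono_neutral_right[OF N], use i in simp, rule ballI)
        fix j assume j: "j \<in> N - {i}"
        have "int Q * 1 \<le> int Q * \<bar>j - i\<bar>" using j by (intro mult_left_mono) auto
        also have "\<dots> = \<bar>int Q * j - int Q * i\<bar>" by (simp add: abs_mult right_diff_distrib[symmetric])
        finally have "\<bar>e0 - int Q * i + int Q * j\<bar> > D" using QD e0D by linarith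
        hence "x (e0 - int Q * i + int Q * j) = 0" using x(2) unfolding supported_within_def by force
        thus "\<phi> j (x (e0 - int Q * i + int Q * j)) = 0"
          using j endo by (simp add: endomorphism_0)
      qed
      also have "\<dots> = \<phi> i (x e0)" by simp
      finally show ?thesis using i(2)[of "x e0"] e0 x(1) by (auto simp: V_valued_def)
    qed
    let ?z1 = "e0 - int Q * i1" and ?z2 = "e0 - int Q * i2"
    let ?y = "(F ^^ (Q + P * b)) x"
    \<comment> \<open>Here the modulus has to be \<open>Q ^ 2\<close>: modulo \<open>Q\<close> both
      positions would be congruent to \<open>e0\<close>.\<close>
    have ne: "?z1 mod int P \<noteq> ?z2 mod int P"
    proof
      assume "?z1 mod int P = ?z2 mod int P"
      hence "int P dvd int Q * (i2 - i1)"
        by (simp add: mod_eq_dvd_iff algebra_simps)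
      hence "int Q dvd i2 - i1" using \<open>Q \<ge> 2\<close> by (simp add: P_def power2_eq_square)
      moreover have "\<bar>i2 - i1\<bar> < int Q" using ND[OF i1(1)] ND[OF i2(1)] QD by linarith
      ultimately show False using i12 zdvd_not_zless[of "\<bar>i2 - i1\<bar>" "int Q"] by simp
    qed
    have "(\<Sum>e\<in>{?z1 mod int P, ?z2 mod int P}. config_rank (residue_section (int P) e ?y))
        \<le> config_rank ?y"
      using P0 by (intro config_rank_ge_residue_sections fin x(2)) auto
    hence "config_rank (residue_section (int P) (?z1 mod int P) ?y) +
        config_rank (residue_section (int P) (?z2 mod int P) ?y) < 2 ^ r + 2 ^ r"
      using x(4) ne by simp
    hence "config_rank (residue_section (int P) (?z1 mod int P) ?y) < 2 ^ r \<or>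
        config_rank (residue_section (int P) (?z2 mod int P) ?y) < 2 ^ r" by linarith
    thus "b \<in> bad D r"
      using sec[OF QP x(1,2) nz[OF i1]] sec[OF QP x(1,2) nz[OF i2]] by (elim disjE) simp_all
  qed
qed

lemma null_density_rank_less:
  assumes x: "V_valued x" "finite_config x" "x \<noteq> 0"
  shows "null_density {t. config_rank ((F ^^ t) x) < R}"
proof -
  obtain D1 where D1: "\<And>D'. D1 \<le> D' \<Longrightarrow> supported_within D' x"
    using finite_config_supported_within[OF x(2)] by metis
  obtain D2 where D2: "\<And>i. i \<in> N \<Longrightarrow> \<bar>i\<bar> \<le> D2"
    using bdd_above_finite[of "abs ` N"] N unfolding bdd_above_def by auto
  define D where "D = max 0 (max D1 D2)"
  have xD: "supported_within D x" by (rule D1) (simp add: D_def)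
  have "{t. config_rank ((F ^^ t) x) < R} \<subseteq> bad D R"
    unfolding bad_def using x(1,3) xD less_trans[OF _ less_exp[of R]] by (blast intro: exI[of _ x])
  moreover have "null_density (bad D R)"
    using D2 by (intro null_density_bad) (force simp: D_def)+
  ultimately show ?thesis by (rule null_density_mono[rotated])
qed

end

section \<open>Reduction of commuting coefficients to a minimal stable subgroup\<close>

lemma finite_config_ca:
  assumes "finite N" "\<And>i. i \<in> N \<Longrightarrow> endomorphism (\<phi> i)" "finite_config x"
  shows "finite_config (ca N \<phi> x)"
  unfolding finite_config_def
proof (rule finite_subset)
  show "{z. ca N \<phi> x z \<noteq> 0} \<subseteq> (\<Union>i\<in>N. (\<lambda>z. z - i) ` {z. x z \<noteq> 0})"
  proof
    fix z assume "z \<in> {z. ca N \<phi> x z \<noteq> 0}"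
    hence "(\<Sum>i\<in>N. \<phi> i (x (z + i))) \<noteq> 0" by (simp add: ca_def)
    then obtain i where i: "i \<in> N" "\<phi> i (x (z + i)) \<noteq> 0"
      by (rule sum.not_neutral_contains_not_neutral)
    hence "x (z + i) \<noteq> 0" using endomorphism_0[OF assms(2)[OF i(1)]] by metis
    thus "z \<in> (\<Union>i\<in>N. (\<lambda>z. z - i) ` {z. x z \<noteq> 0})" using i(1) by force
  qed
  show "finite (\<Union>i\<in>N. (\<lambda>z. z - i) ` {z. x z \<noteq> 0})"
    using assms(1,3) by (simp add: finite_config_def)
qed

text \<open>The double centralizer of the coefficients in the endomorphism ring. It contains the
  ring they generate, and its closure under the ring operations can be read off from the defining
  condition without an induction over polynomials.\<close>

definition bicommutant :: "'i set \<Rightarrow> ('i \<Rightarrow> 'a::ab_group_add \<Rightarrow> 'a) \<Rightarrow> ('a \<Rightarrow> 'a) set" where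
  "bicommutant N \<phi> = {r. endomorphism r \<and>
     (\<forall>s. endomorphism s \<longrightarrow> (\<forall>i\<in>N. s \<circ> \<phi> i = \<phi> i \<circ> s) \<longrightarrow> (\<forall>x. r (s x) = s (r x)))}"

lemma bicommutant_endomorphism: "r \<in> bicommutant N \<phi> \<Longrightarrow> endomorphism r"
  by (simp add: bicommutant_def)

lemma bicommutantD:
  "r \<in> bicommutant N \<phi> \<Longrightarrow> endomorphism s \<Longrightarrow> (\<And>i. i \<in> N \<Longrightarrow> s \<circ> \<phi> i = \<phi> i \<circ> s) \<Longrightarrow> r (s x) = s (r x)"
  by (simp add: bicommutant_def)

lemma bicommutant_generator:
  "i \<in> N \<Longrightarrow> endomorphism (\<phi> i) \<Longrightarrow> \<phi> i \<in> bicommutant N \<phi>"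
  unfolding bicommutant_def
  by (intro CollectI conjI allI impI) (assumption, metis comp_apply)

lemma bicommutant_id: "(\<lambda>x. x) \<in> bicommutant N \<phi>"
  by (simp add: bicommutant_def endomorphism_id)

lemma bicommutant_comp:
  "r \<in> bicommutant N \<phi> \<Longrightarrow> s \<in> bicommutant N \<phi> \<Longrightarrow> (\<lambda>x. r (s x)) \<in> bicommutant N \<phi>"
  by (simp add: bicommutant_def endomorphism_def)

lemma bicommutant_diff:
  "r \<in> bicommutant N \<phi> \<Longrightarrow> s \<in> bicommutant N \<phi> \<Longrightarrow> (\<lambda>x. r x - s x) \<in> bicommutant N \<phi>"
  by (simp add: bicommutant_def endomorphism_minus endomorphism_diff)

lemma bicommutant_funpow: "r \<in> bicommutant N \<phi> \<Longrightarrow> r ^^ n \<in> bicommutant N \<phi>"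
proof (induction n)
  case 0
  show ?case using bicommutant_id by (simp add: id_def)
next
  case (Suc n)
  thus ?case using bicommutant_comp[of r N \<phi> "r ^^ n"] by (simp add: comp_def)
qed

lemma bicommutant_nmult: "nmult n \<in> bicommutant N \<phi>"
  by (simp add: bicommutant_def endomorphism_nmult_fun endomorphism_nmult)

text \<open>The coefficients commute with one another and so lie in their own commutant. Hence
  \<open>s\<close> commutes with each of them, belongs to the commutant itself, and therefore
  commutes with \<open>r\<close>.\<close>

lemma bicommutant_commute:
  assumes endo: "\<And>i. i \<in> N \<Longrightarrow> endomorphism (\<phi> i)"
    and comm: "\<And>i j. i \<in> N \<Longrightarrow> j \<in> N \<Longrightarrow> \<phi> i \<circ> \<phi> j = \<phi> j \<circ> \<phi> i"
    and r: "r \<in> bicommutant N \<phi>" and s: "s \<in> bicommutant N \<phi>"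
  shows "r (s x) = s (r x)"
proof (rule bicommutantD[OF r bicommutant_endomorphism[OF s]])
  fix i assume i: "i \<in> N"
  have "s (\<phi> i x) = \<phi> i (s x)" for x
    by (rule bicommutantD[OF s endo[OF i] comm[OF i]])
  thus "s \<circ> \<phi> i = \<phi> i \<circ> s" by (simp add: fun_eq_iff)
qed

text \<open>The proof passes to a minimal subgroup \<open>V\<close>, stable under the bicommutant \<open>R\<close> of the
  coefficients, in which some nonzero image of \<open>c\<close> under \<open>R\<close> lives. By minimality every
  element of \<open>R\<close> is zero or injective on \<open>V\<close>, so that \<open>R\<close> acts on \<open>V\<close> as a finite field.\<close>

theorem ca_rank_growth:
  fixes \<phi> :: "int \<Rightarrow> 'a::{ab_group_add, finite} \<Rightarrow> 'a"
  assumes N: "finite N" and endo: "\<And>i. i \<in> N \<Longrightarrow> endomorphism (\<phi> i)"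
    and comm: "\<And>i j. i \<in> N \<Longrightarrow> j \<in> N \<Longrightarrow> \<phi> i \<circ> \<phi> j = \<phi> j \<circ> \<phi> i"
    and two: "\<And>v. v \<noteq> 0 \<Longrightarrow> \<exists>i\<in>N. \<exists>j\<in>N. i \<noteq> j \<and> \<phi> i v \<noteq> 0 \<and> \<phi> j v \<noteq> 0"
    and c: "finite_config c" "c \<noteq> 0"
  shows "null_density {t. config_rank ((ca N \<phi> ^^ t) c) < K}"
proof -
  define R where "R = bicommutant N \<phi>"
  have R_endo: "endomorphism r" if "r \<in> R" for r
    using that unfolding R_def by (rule bicommutant_endomorphism)
  have R_comm: "r (s x) = s (r x)" if "r \<in> R" "s \<in> R" for r s x
    by (rule bicommutant_commute[where \<phi> = \<phi> and N = N])
      (fact endo, fact comm, use that in \<open>simp_all add: R_def\<close>)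
  have R_phi: "\<phi> i \<in> R" if "i \<in> N" for i
    unfolding R_def using that endo[OF that] by (rule bicommutant_generator)
  have R_comp: "(\<lambda>x. r (s x)) \<in> R" if "r \<in> R" "s \<in> R" for r s
    using that unfolding R_def by (rule bicommutant_comp)
  define stable where "stable W \<longleftrightarrow> 0 \<in> W \<and> (\<forall>v\<in>W. \<forall>w\<in>W. v - w \<in> W) \<and> (\<forall>r\<in>R. \<forall>v\<in>W. r v \<in> W)"
    for W :: "'a set"
  \<comment> \<open>Applying an element of \<open>R\<close> to every entry commutes with the
    automaton and does not raise ranks, so a nonzero image of \<open>c\<close> with entries in
    \<open>W\<close> may replace \<open>c\<close>.\<close>
  define P where "P W \<longleftrightarrow> stable W \<and> (\<exists>r\<in>R. (\<exists>z. r (c z) \<noteq> 0) \<and> (\<forall>z. r (c z) \<in> W))" for W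
  have "P UNIV"
  proof -
    have "\<exists>z. c z \<noteq> 0" using c(2) by (auto simp: fun_eq_iff)
    moreover have "(\<lambda>x. x) \<in> R" unfolding R_def by (rule bicommutant_id)
    ultimately show ?thesis by (auto simp: P_def stable_def intro!: bexI[of _ "\<lambda>x. x"])
  qed
  then obtain V where V: "P V" and V_min: "\<And>W. P W \<Longrightarrow> card V \<le> card W"
    using ex_has_least_nat[of P UNIV card] by blast
  have V0: "0 \<in> V" and V_diff: "\<And>v w. v \<in> V \<Longrightarrow> w \<in> V \<Longrightarrow> v - w \<in> V"
    and V_R: "\<And>r v. r \<in> R \<Longrightarrow> v \<in> V \<Longrightarrow> r v \<in> V"
    using V by (simp_all add: P_def stable_def)
  obtain r0 z0 where r0: "r0 \<in> R" "r0 (c z0) \<noteq> 0" "\<And>z. r0 (c z) \<in> V"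
    using V unfolding P_def by (elim conjE bexE exE) simp
  define v0 where "v0 = r0 (c z0)"
  have v0: "v0 \<in> V" "v0 \<noteq> 0" using r0 by (simp_all add: v0_def)
  \<comment> \<open>A form of Schur's lemma. If \<open>r\<close> has a kernel in \<open>V\<close>,
    the image of \<open>V\<close> is smaller, so by minimality \<open>r\<close> kills every
    \<open>r0 (c z)\<close>. The kernel of \<open>r\<close> in \<open>V\<close> is stable because
    \<open>R\<close> is commutative, it contains these entries, and minimality makes it all of
    \<open>V\<close>.\<close>
  have dich: "(\<forall>v\<in>V. r v = 0) \<or> (\<forall>v\<in>V. r v = 0 \<longrightarrow> v = 0)" if r: "r \<in> R" for r
  proof (rule disjCI)
    assume "\<not> (\<forall>v\<in>V. r v = 0 \<longrightarrow> v = 0)"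
    then obtain v where v: "v \<in> V" "r v = 0" "v \<noteq> 0" by blast
    have rd: "r (x - y) = r x - r y" and rz: "r 0 = 0" for x y
      using R_endo[OF r] by (simp_all add: endomorphism_diff endomorphism_0)
    have "card (r ` V) < card V"
    proof -
      have "r ` V = r ` (V - {v})"
      proof
        show "r ` V \<subseteq> r ` (V - {v})"
        proof
          fix y assume "y \<in> r ` V"
          then obtain w where w: "w \<in> V" "y = r w" by blast
          show "y \<in> r ` (V - {v})"
          proof (cases "w = v")
            case True
            hence "y = r 0" using w v rz by simp
            moreover have "0 \<in> V - {v}" using V0 v by simp
            ultimately show ?thesis by blast
          qed (use w in blast)
        qed
      qed blast
      hence "card (r ` V) \<le> card (V - {v})" using card_image_le[of "V - {v}" r] by simp
      also have "\<dots> < card V" using v by (intro card_Diff1_less) simp_all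
      finally show ?thesis .
    qed
    hence nP: "\<not> P (r ` V)" using V_min[of "r ` V"] by (meson not_le)
    have st: "stable (r ` V)"
      unfolding stable_def
    proof (intro conjI ballI)
      show "0 \<in> r ` V" by (rule image_eqI[of _ r 0]) (simp_all add: V0 rz)
    next
      fix a b assume "a \<in> r ` V" "b \<in> r ` V"
      then obtain v w where "a = r v" "b = r w" "v \<in> V" "w \<in> V" by (elim imageE)
      thus "a - b \<in> r ` V" by (intro image_eqI[of _ r "v - w"]) (simp_all add: rd V_diff)
    next
      fix s a assume s: "s \<in> R" and "a \<in> r ` V"
      then obtain v where "a = r v" "v \<in> V" by (elim imageE)
      thus "s a \<in> r ` V"
        by (intro image_eqI[of _ r "s v"]) (simp_all add: V_R s R_comm[OF s r])
    qed
    have zero: "r (r0 (c z)) = 0" for z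
    proof (rule ccontr)
      assume "r (r0 (c z)) \<noteq> 0"
      hence "P (r ` V)" unfolding P_def using st R_comp[OF r r0(1)] r0(3)
        by (intro conjI bexI[of _ "\<lambda>x. r (r0 x)"]) auto
      with nP show False ..
    qed
    have "P {v\<in>V. r v = 0}"
      unfolding P_def
    proof (intro conjI bexI[of _ r0])
      show "stable {v\<in>V. r v = 0}"
        unfolding stable_def
      proof (intro conjI ballI)
        show "s a \<in> {v\<in>V. r v = 0}" if "s \<in> R" "a \<in> {v\<in>V. r v = 0}" for s a
          using that V_R R_comm[OF r that(1), of a] endomorphism_0[OF R_endo[OF that(1)]] by simp
      qed (use V0 V_diff rd rz in auto)
    qed (use r0 zero in auto)
    hence "card V \<le> card {v\<in>V. r v = 0}" by (rule V_min)
    hence "{v\<in>V. r v = 0} = V" by (intro card_seteq) auto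
    thus "\<forall>v\<in>V. r v = 0" by blast
  qed
  obtain p m where p: "prime p" and m: "nmult m v0 \<noteq> 0" "nmult p (nmult m v0) = 0"
    using ex_prime_torsion[OF v0(2)] by blast
  \<comment> \<open>Multiplication by \<open>p\<close> belongs to \<open>R\<close>, so the dichotomy
    spreads torsion from one nonzero element to all of \<open>V\<close>.\<close>
  have pV: "nmult p v = 0" if "v \<in> V" for v
  proof -
    have "nmult m v0 \<in> V" by (rule V_R[of "nmult m"]) (simp_all add: R_def bicommutant_nmult v0)
    with m have "\<not> (\<forall>v\<in>V. nmult p v = 0 \<longrightarrow> v = 0)" by blast
    with dich[of "nmult p"] that show ?thesis by (simp add: R_def bicommutant_nmult)
  qed
  have "\<exists>l>0. \<forall>v\<in>V. (\<phi> i ^^ (p ^ l)) v = \<phi> i v" if i: "i \<in> N" for i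
  proof -
    have "\<not> inj (\<lambda>n. \<phi> i ^^ (p ^ n))"
      using finite_imageD[of "\<lambda>n. \<phi> i ^^ (p ^ n)" UNIV] infinite_UNIV_nat by auto
    then obtain m n where "m \<noteq> n" "\<phi> i ^^ (p ^ m) = \<phi> i ^^ (p ^ n)" unfolding inj_def by blast
    then obtain m n where mn: "m < n" "\<phi> i ^^ (p ^ m) = \<phi> i ^^ (p ^ n)" by (metis nat_neq_iff)
    define \<psi> where "\<psi> = \<phi> i ^^ (p ^ (n - m))"
    \<comment> \<open>By Frobenius, the \<open>p ^ m\<close>-th power of this difference is
      \<open>\<phi> i ^^ (p ^ n) - \<psi> ^^ (p ^ m)\<close> on \<open>V\<close>, which vanishes. An
      element of \<open>R\<close> nilpotent on \<open>V\<close> is not injective there, hence it is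
      zero on \<open>V\<close>.\<close>
    define r where "r = (\<lambda>x. \<phi> i x - \<psi> x)"
    have \<psi>: "\<psi> \<in> R" unfolding \<psi>_def R_def
      by (rule bicommutant_funpow) (use R_phi[OF i] in \<open>simp add: R_def\<close>)
    have r: "r \<in> R" unfolding r_def using R_phi[OF i] \<psi> unfolding R_def by (rule bicommutant_diff)
    have "\<psi> ^^ (p ^ m) = \<phi> i ^^ (p ^ n)"
      using mn(1) by (simp add: \<psi>_def funpow_mult power_add[symmetric])
    moreover have "((\<lambda>x. r x + \<psi> x) ^^ (p ^ m)) v = (r ^^ (p ^ m)) v + (\<psi> ^^ (p ^ m)) v" if "v \<in> V" for v
      using R_comm[OF r \<psi>] by (intro funpow_prime_power_add R_endo r \<psi> p pV that) (simp add: fun_eq_iff)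
    moreover have "(\<lambda>x. r x + \<psi> x) = \<phi> i" by (simp add: r_def)
    ultimately have nil: "(r ^^ (p ^ m)) v = 0" if "v \<in> V" for v using that mn(2) by simp
    have "(r ^^ k) v0 \<in> V \<and> (r ^^ k) v0 \<noteq> 0" if "\<forall>v\<in>V. r v = 0 \<longrightarrow> v = 0" for k
      by (induction k) (use v0 V_R[OF r] that in auto)
    hence "\<not> (\<forall>v\<in>V. r v = 0 \<longrightarrow> v = 0)" using nil[OF v0(1)] by blast
    hence "\<forall>v\<in>V. r v = 0" using dich[OF r] by blast
    thus ?thesis using mn(1) by (intro exI[of _ "n - m"]) (simp add: r_def \<psi>_def)
  qed
  then obtain L where L: "\<And>i. i \<in> N \<Longrightarrow> L i > 0 \<and> (\<forall>v\<in>V. (\<phi> i ^^ (p ^ L i)) v = \<phi> i v)"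
    by metis
  define l where "l = (\<Prod>i\<in>N. L i)"
  have l: "l > 0" unfolding l_def using L by (intro prod_pos) simp
  have frob: "(\<phi> i ^^ (p ^ l)) v = \<phi> i v" if i: "i \<in> N" and v: "v \<in> V" for i v
  proof -
    have "L i dvd l" unfolding l_def using N i by (rule dvd_prodI)
    then obtain s where "l = L i * s" by (auto simp: dvd_def)
    thus ?thesis using funpow_prime_power_fixed[of V "\<phi> i" p "L i" v s] L[OF i] v V_R[OF R_phi[OF i]] by simp
  qed
  \<comment> \<open>The condition is used at \<open>v0\<close> only; by the dichotomy, a coefficient
    not killing \<open>v0\<close> is injective on \<open>V\<close>.\<close>
  obtain i1 i2 where i: "i1 \<in> N" "i2 \<in> N" "i1 \<noteq> i2" "\<phi> i1 v0 \<noteq> 0" "\<phi> i2 v0 \<noteq> 0"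
    using two[OF v0(2)] by blast
  interpret frobenius_ca V N \<phi> p l i1 i2
  proof
    show "v = 0" if "v \<in> V" "\<phi> i1 v = 0" for v using dich[OF R_phi[OF i(1)]] i(4) v0(1) that by blast
    show "v = 0" if "v \<in> V" "\<phi> i2 v = 0" for v using dich[OF R_phi[OF i(2)]] i(5) v0(1) that by blast
  qed (fact N endo comm p pV V0 V_diff V_R[OF R_phi] dich[OF R_phi] l frob i(1-3))+
  define x where "x = (\<lambda>z. r0 (c z))"
  have r00: "r0 0 = 0" by (rule endomorphism_0[OF R_endo[OF r0(1)]])
  have x: "V_valued x" "x \<noteq> 0" "finite_config x"
  proof -
    show "V_valued x" using r0(3) by (simp add: V_valued_def x_def)
    show "x \<noteq> 0" using r0(2) by (auto simp: x_def fun_eq_iff)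
    show "finite_config x" unfolding finite_config_def
      by (rule finite_subset[OF _ c(1)[unfolded finite_config_def]]) (auto simp: x_def r00)
  qed
  have Fx: "(F ^^ t) x = (\<lambda>z. r0 ((F ^^ t) c z))" for t
  proof (induction t)
    case (Suc t)
    have "\<phi> i (r0 v) = r0 (\<phi> i v)" if "i \<in> N" for i v by (rule R_comm[OF R_phi[OF that] r0(1)])
    hence "F (\<lambda>z. r0 (y z)) = (\<lambda>z. r0 (F y z))" for y
      by (simp add: ca_def fun_eq_iff endomorphism_sum[OF R_endo[OF r0(1)]])
    thus ?case by (simp add: Suc)
  qed (simp add: x_def)
  have fin: "finite_config ((F ^^ t) c)" for t
    by (induction t) (use c in \<open>simp_all add: finite_config_ca[where \<phi> = \<phi>, OF N endo]\<close>)
  have "config_rank ((F ^^ t) x) \<le> config_rank ((F ^^ t) c)" for t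
    unfolding config_rank_def
    by (intro card_mono) (use fin[of t] in \<open>auto simp: Fx r00 finite_config_def\<close>)
  hence "{t. config_rank ((F ^^ t) c) < K} \<subseteq> {t. config_rank ((F ^^ t) x) < K}"
    by (auto intro: le_less_trans)
  with null_density_rank_less[OF x(1,3,2)] show ?thesis by (rule null_density_mono)
qed

section \<open>The dual of a finite abelian group\<close>

text \<open>As a type with additive group structure, the dual can take the place of the group in the
  results on rank growth.\<close>

typedef (overloaded) ('g::ab_group_add) dual =
  "{f :: 'g \<Rightarrow> complex. (\<forall>x. norm (f x) = 1) \<and> (\<forall>x y. f (x + y) = f x * f y)}"
  morphisms dual_apply Dual
  by (rule exI[of _ "\<lambda>_. 1"]) simp

lemma norm_dual_apply [simp]: "norm (dual_apply f x) = 1"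
  and dual_apply_add: "dual_apply f (x + y) = dual_apply f x * dual_apply f y"
  using dual_apply[of f] by simp_all

lemma dual_apply_Dual:
  "(\<And>x. norm (f x) = 1) \<Longrightarrow> (\<And>x y. f (x + y) = f x * f y) \<Longrightarrow> dual_apply (Dual f) = f"
  by (intro Dual_inverse) simp

lemma dual_apply_nonzero [simp]: "dual_apply f x \<noteq> 0"
  using norm_dual_apply[of f x] by (metis norm_zero zero_neq_one)

lemma dual_apply_0 [simp]: "dual_apply f 0 = 1"
  using dual_apply_add[of f 0 0] by simp

lemma dual_apply_minus: "dual_apply f x * dual_apply f (- x) = 1"
  using dual_apply_add[of f x "- x"] by simp

lemma dual_apply_nmult: "dual_apply f (nmult n x) = dual_apply f x ^ n"
  by (induction n) (simp_all add: dual_apply_add mult.commute)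

lemma dual_eqI: "(\<And>x. dual_apply f x = dual_apply g x) \<Longrightarrow> f = g"
  using dual_apply_inject by blast

instantiation dual :: (ab_group_add) ab_group_add
begin

definition "0 = Dual (\<lambda>_. 1)"
definition "f + g = Dual (\<lambda>x. dual_apply f x * dual_apply g x)"
definition "- f = Dual (\<lambda>x. dual_apply f (- x))"
definition "f - g = f + - (g :: 'a dual)"

lemma dual_apply_zero [simp]: "dual_apply 0 x = 1"
  unfolding zero_dual_def by (subst dual_apply_Dual) simp_all

lemma dual_apply_plus [simp]: "dual_apply (f + g) x = dual_apply f x * dual_apply g x"
  unfolding plus_dual_def by (subst dual_apply_Dual) (simp_all add: norm_mult dual_apply_add)

lemma dual_apply_uminus [simp]: "dual_apply (- f) x = dual_apply f (- x)"
  unfolding uminus_dual_def by (subst dual_apply_Dual) (simp_all add: dual_apply_add[symmetric])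

instance
proof
  fix f g h :: "'a dual"
  show "f + g + h = f + (g + h)" "f + g = g + f" "0 + f = f" "- f + f = 0" "f - g = f + - g"
    by (auto intro!: dual_eqI simp: dual_apply_minus mult.commute minus_dual_def)
qed

end

text \<open>The value of a character at \<open>x\<close> is a root of unity whose order divides
  \<open>n x\<close>, which leaves finitely many choices at each point.\<close>

instance dual :: ("{ab_group_add, finite}") finite
proof
  obtain n :: "'a \<Rightarrow> nat" where n: "\<And>x. n x > 0" "\<And>x. nmult (n x) x = 0"
    using ex_nmult_eq_0 by metis
  have "range (dual_apply :: 'a dual \<Rightarrow> _) \<subseteq> PiE UNIV (\<lambda>x. {z. z ^ n x = 1})"
    using n(2) by (auto simp: dual_apply_nmult[symmetric])
  moreover have "finite (PiE UNIV (\<lambda>x. {z :: complex. z ^ n x = 1}))"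
    using n(1) by (intro finite_PiE finite_roots_unity) (simp_all add: Suc_le_eq)
  ultimately have "finite (range (dual_apply :: 'a dual \<Rightarrow> _))" by (rule finite_subset)
  thus "finite (UNIV :: 'a dual set)"
    by (rule finite_imageD) (intro inj_onI dual_eqI, simp)
qed

text \<open>Multiplication by a root \<open>u\<close> permutes the roots and multiplies the sum by
  \<open>u ^ k\<close>. Some \<open>u\<close> has \<open>u ^ k \<noteq> 1\<close>, because only
  \<open>k < n\<close> complex numbers satisfy \<open>w ^ k = 1\<close>.\<close>

lemma sum_powers_of_roots_of_unity:
  assumes "0 < k" "k < n"
  shows "(\<Sum>w | w ^ n = 1. w ^ k) = (0 :: complex)"
proof -
  have fin: "finite {w :: complex. w ^ n = 1}" using assms by (intro finite_roots_unity) simp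
  have "\<exists>u. u ^ n = 1 \<and> u ^ k \<noteq> (1 :: complex)"
  proof (rule ccontr)
    assume "\<not> ?thesis"
    hence "{w :: complex. w ^ n = 1} \<subseteq> {w. w ^ k = 1}" by blast
    hence "card {w :: complex. w ^ n = 1} \<le> card {w :: complex. w ^ k = 1}"
      using assms by (intro card_mono finite_roots_unity) simp_all
    thus False using assms by (simp add: card_roots_unity_eq)
  qed
  then obtain u :: complex where u: "u ^ n = 1" "u ^ k \<noteq> 1" by blast
  have u0: "u \<noteq> 0" using u(1) assms by (auto simp: power_0_left)
  have "(\<Sum>w | w ^ n = 1. w ^ k) = (\<Sum>w | w ^ n = 1. (u * w) ^ k)"
    by (rule sum.reindex_bij_witness[of _ "\<lambda>w. u * w" "\<lambda>w. w / u"])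
      (use u0 u(1) in \<open>auto simp: power_mult_distrib power_divide\<close>)
  also have "\<dots> = u ^ k * (\<Sum>w | w ^ n = 1. w ^ k)"
    by (simp add: power_mult_distrib sum_distrib_left)
  finally show ?thesis using u(2) by simp
qed

text \<open>The projection, up to the factor \<open>n\<close>, onto the eigenspace of translation by \<open>a\<close> with
  eigenvalue \<open>1 / w\<close>.\<close>

definition eigenprojection :: "nat \<Rightarrow> 'g::ab_group_add \<Rightarrow> complex \<Rightarrow> ('g \<Rightarrow> complex) \<Rightarrow> 'g \<Rightarrow> complex" where
  "eigenprojection n a w f x = (\<Sum>k<n. w ^ k * f (x + nmult k a))"

lemma eigenprojection_translate:
  assumes "nmult n a = 0" "w ^ n = 1"
  shows "w * eigenprojection n a w f (x + a) = eigenprojection n a w f x"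
proof -
  let ?t = "\<lambda>k. w ^ k * f (x + nmult k a)"
  have "w * eigenprojection n a w f (x + a) = (\<Sum>k<n. ?t (Suc k))"
    by (simp add: eigenprojection_def sum_distrib_left algebra_simps)
  moreover have "?t 0 + (\<Sum>k<n. ?t (Suc k)) = (\<Sum>k<n. ?t k) + ?t n"
    by (rule trans[OF sum.lessThan_Suc_shift[of ?t n, symmetric] sum.lessThan_Suc[of ?t n]])
  ultimately show ?thesis using assms by (simp add: eigenprojection_def)
qed

lemma sum_eigenprojections:
  assumes n: "n > 0"
  shows "(\<Sum>w | w ^ n = 1. eigenprojection n a w f x) = of_nat n * f x"
proof -
  have "(\<Sum>w | w ^ n = 1. eigenprojection n a w f x) =
      (\<Sum>k<n. (\<Sum>w | w ^ n = 1. w ^ k) * f (x + nmult k a))"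
    unfolding eigenprojection_def by (subst sum.swap) (simp add: sum_distrib_right)
  also have "\<dots> = (\<Sum>k\<in>{0}. (\<Sum>w | w ^ n = 1. w ^ k) * f (x + nmult k a))"
    using n by (intro sum.mono_neutral_right) (auto simp: sum_powers_of_roots_of_unity)
  also have "\<dots> = of_nat n * f x" using n by (simp add: card_roots_unity_eq)
  finally show ?thesis .
qed

text \<open>A common eigenfunction of all translations is a multiple of a character. Projections
  onto eigenspaces of the various translations commute with translations, so an eigenfunction for
  \<open>g\<close> with eigenvalue other than one can be refined to a common one. Dividing by its
  value at 0 gives the character, of modulus one by torsion.\<close>

theorem dual_separates_points:
  fixes g :: "'g::{ab_group_add, finite}"
  assumes g: "g \<noteq> 0"
  shows "\<exists>f. dual_apply f g \<noteq> 1"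
proof -
  define \<delta> :: "'g \<Rightarrow> complex" where "\<delta> x = (if x = 0 then 1 else 0)" for x
  obtain n where n: "n > 0" "nmult n g = 0" using ex_nmult_eq_0[of g] by blast
  \<comment> \<open>If only the component for \<open>w = 1\<close> survived, the point mass at 0
    would be invariant under translation by \<open>g\<close>.\<close>
  have "\<exists>w x. w \<noteq> 1 \<and> w ^ n = 1 \<and> eigenprojection n g w \<delta> x \<noteq> 0"
  proof (rule ccontr)
    assume "\<not> ?thesis"
    hence 0: "eigenprojection n g w \<delta> x = 0" if "w ^ n = 1" "w \<noteq> 1" for w x using that by blast
    have "of_nat n * \<delta> x = eigenprojection n g 1 \<delta> x" for x
    proof -
      have "(\<Sum>w | w ^ n = 1. eigenprojection n g w \<delta> x) = (\<Sum>w\<in>{1}. eigenprojection n g w \<delta> x)"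
        using n(1) by (intro sum.mono_neutral_right finite_roots_unity) (auto intro: 0)
      thus ?thesis using sum_eigenprojections[OF n(1), of g \<delta> x] by simp
    qed
    hence "of_nat n * \<delta> (0 + g) = of_nat n * \<delta> 0"
      using eigenprojection_translate[OF n(2), of 1 \<delta> 0] by simp
    thus False using n(1) g by (simp add: \<delta>_def)
  qed
  then obtain w where w: "w \<noteq> 1" "w ^ n = 1" "\<exists>x. eigenprojection n g w \<delta> x \<noteq> 0" by blast
  have "\<exists>h. (\<exists>x. h x \<noteq> 0) \<and> (\<forall>x. w * h (x + g) = h x) \<and> (\<forall>a\<in>A. \<exists>v. \<forall>x. v * h (x + a) = h x \<and> v \<noteq> 0)"
    if "finite A" for A :: "'g set"
    using that
  proof (induction A)
    case empty
    thus ?case using w(3) eigenprojection_translate[OF n(2) w(2)] by blast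
  next
    case (insert a A)
    from insert.IH obtain h where H: "(\<exists>x. h x \<noteq> 0) \<and> (\<forall>x. w * h (x + g) = h x) \<and>
          (\<forall>a\<in>A. \<exists>v. \<forall>x. v * h (x + a) = h x \<and> v \<noteq> 0)" by (rule exE)
    note h1 = conjunct1[OF H] and h2 = spec[OF conjunct1[OF conjunct2[OF H]]]
      and h3 = bspec[OF conjunct2[OF conjunct2[OF H]]]
    obtain m where m: "m > 0" "nmult m a = 0" using ex_nmult_eq_0[of a] by blast
    have "\<exists>u. u ^ m = 1 \<and> (\<exists>x. eigenprojection m a u h x \<noteq> 0)"
    proof (rule ccontr)
      assume "\<not> ?thesis"
      hence "(\<Sum>w | w ^ m = 1. eigenprojection m a w h x) = 0" for x by (intro sum.neutral) blast
      thus False using h1 m(1) sum_eigenprojections[OF m(1), of a h] by simp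
    qed
    then obtain u where u: "u ^ m = 1" "\<exists>x. eigenprojection m a u h x \<noteq> 0" by blast
    have u0: "u \<noteq> 0" using u(1) m(1) by (auto simp: power_0_left)
    have keep: "v * eigenprojection m a u h (x + b) = eigenprojection m a u h x"
      if "\<And>x. v * h (x + b) = h x" for v b x
    proof -
      have "v * h (x + b + c) = h (x + c)" for c using that[of "x + c"] by (simp add: ac_simps)
      thus ?thesis by (simp add: eigenprojection_def sum_distrib_left mult.left_commute[of v])
    qed
    have "\<exists>v. \<forall>x. v * eigenprojection m a u h (x + b) = eigenprojection m a u h x \<and> v \<noteq> 0"
      if b: "b \<in> insert a A" for b
    proof (cases "b = a")
      case True
      thus ?thesis using eigenprojection_translate[OF m(2) u(1), of h] u0 by blast
    next
      case False
      hence "b \<in> A" using b by simp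
      from h3[OF this] obtain v where v: "\<forall>x. v * h (x + b) = h x \<and> v \<noteq> 0" by (rule exE)
      show ?thesis by (rule exI[of _ v]) (use v keep[of v b] in simp)
    qed
    thus ?case using u(2) keep[of w g, OF h2] by (intro exI[of _ "eigenprojection m a u h"]) simp
  qed
  from this[OF finite_class.finite_UNIV] obtain h where H: "(\<exists>x. h x \<noteq> 0) \<and> (\<forall>x. w * h (x + g) = h x) \<and>
          (\<forall>a\<in>UNIV. \<exists>v. \<forall>x. v * h (x + a) = h x \<and> v \<noteq> 0)" by (rule exE)
  note h1 = conjunct1[OF H] and h2 = spec[OF conjunct1[OF conjunct2[OF H]]]
    and h3 = bspec[OF conjunct2[OF conjunct2[OF H]] UNIV_I]
  have h0: "h 0 \<noteq> 0"
  proof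
    assume "h 0 = 0"
    have "h x = 0" for x
    proof -
      from h3[of x] obtain v where "\<forall>y. v * h (y + x) = h y \<and> v \<noteq> 0" by (rule exE)
      from spec[OF this, of 0] have "v * h (0 + x) = h 0" "v \<noteq> 0" by simp_all
      thus ?thesis using \<open>h 0 = 0\<close> by simp
    qed
    thus False using h1 by blast
  qed
  define f where "f x = h x / h 0" for x
  have add: "f (x + y) = f x * f y" for x y
  proof -
    from h3[of y] obtain v where "\<forall>z. v * h (z + y) = h z \<and> v \<noteq> 0" by (rule exE)
    from spec[OF this, of x] spec[OF this, of 0]
    have "v * h (x + y) = h x" "v * h (0 + y) = h 0" "v \<noteq> 0" by simp_all
    hence "v * h (x + y) * h 0 = v * (h x * h y)" by (metis add_0 mult.commute mult.left_commute)
    thus ?thesis using \<open>v \<noteq> 0\<close> h0 by (simp add: f_def field_simps)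
  qed
  have "norm (f x) = 1" for x
  proof -
    have "f (nmult k x) = f x ^ k" for k
      by (induction k) (simp_all add: add mult.commute, simp add: f_def h0)
    moreover obtain m where m: "m > 0" "nmult m x = 0" using ex_nmult_eq_0[of x] by blast
    ultimately have "f x ^ m = f 0" by metis
    also have "f 0 = 1" by (simp add: f_def h0)
    finally have "norm (f x) ^ m = 1" by (simp flip: norm_power)
    thus ?thesis using m(1) power_eq_imp_eq_base[of "norm (f x)" m 1] by simp
  qed
  hence f: "dual_apply (Dual f) = f" using add by (intro dual_apply_Dual)
  have "f g \<noteq> 1" using h2[of 0] h0 w(1) by (auto simp: f_def)
  thus ?thesis using f by metis
qed

lemma sum_dual_apply:
  fixes f :: "'g::{ab_group_add, finite} dual"
  assumes "f \<noteq> 0"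
  shows "(\<Sum>x\<in>UNIV. dual_apply f x) = 0"
proof -
  obtain a where a: "dual_apply f a \<noteq> 1" using assms dual_eqI[of f 0] by auto
  have "(\<Sum>x\<in>UNIV. dual_apply f x) = (\<Sum>x\<in>UNIV. dual_apply f (a + x))"
    by (rule sum.reindex_bij_witness[of _ "\<lambda>x. a + x" "\<lambda>x. x - a"]) auto
  also have "\<dots> = dual_apply f a * (\<Sum>x\<in>UNIV. dual_apply f x)"
    by (simp add: dual_apply_add sum_distrib_left)
  finally show ?thesis using a by simp
qed

lemma sum_over_dual:
  fixes x :: "'g::{ab_group_add, finite}"
  shows "(\<Sum>f\<in>UNIV. dual_apply f x) = (if x = 0 then of_nat CARD('g dual) else 0)"
proof (cases "x = 0")
  case False
  then obtain h where h: "dual_apply h x \<noteq> 1" using dual_separates_points by blast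
  have "(\<Sum>f\<in>UNIV. dual_apply f x) = (\<Sum>f\<in>UNIV. dual_apply (h + f) x)"
    by (rule sum.reindex_bij_witness[of _ "\<lambda>f. h + f" "\<lambda>f. f - h"]) auto
  also have "\<dots> = dual_apply h x * (\<Sum>f\<in>UNIV. dual_apply f x)"
    by (simp add: sum_distrib_left)
  finally show ?thesis using h False by simp
qed simp

text \<open>The adjoint of \<open>\<phi>\<close>. It is meaningful for endomorphisms; otherwise
  \<open>Dual\<close> may be applied outside the represented set.\<close>

definition dual_map :: "('g::ab_group_add \<Rightarrow> 'g) \<Rightarrow> 'g dual \<Rightarrow> 'g dual" where
  "dual_map \<phi> f = Dual (\<lambda>x. dual_apply f (\<phi> x))"

lemma dual_apply_dual_map [simp]: "endomorphism \<phi> \<Longrightarrow> dual_apply (dual_map \<phi> f) x = dual_apply f (\<phi> x)"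
  unfolding dual_map_def by (subst dual_apply_Dual) (simp_all add: endomorphism_add dual_apply_add)

lemma endomorphism_dual_map: "endomorphism \<phi> \<Longrightarrow> endomorphism (dual_map \<phi>)"
  unfolding endomorphism_def[of "dual_map \<phi>"] by (auto intro!: dual_eqI)

lemma dual_map_commute:
  assumes "endomorphism \<phi>" "endomorphism \<psi>" "\<phi> \<circ> \<psi> = \<psi> \<circ> \<phi>"
  shows "dual_map \<phi> \<circ> dual_map \<psi> = dual_map \<psi> \<circ> dual_map \<phi>"
proof (rule ext, rule dual_eqI)
  fix f x
  show "dual_apply ((dual_map \<phi> \<circ> dual_map \<psi>) f) x = dual_apply ((dual_map \<psi> \<circ> dual_map \<phi>) f) x"
    using fun_cong[OF assms(3), of x] by (simp add: assms(1,2))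
qed

text \<open>A nonzero \<open>f\<close> killed by the adjoints is a nontrivial character that is
  trivial on all images \<open>\<phi> i y\<close>. The reverse direction is the same argument on the
  dual group, where evaluation at \<open>x\<close> serves as the character.\<close>

lemma common_kernel_dual_map_iff:
  fixes \<phi> :: "'i \<Rightarrow> 'g::{ab_group_add, finite} \<Rightarrow> 'g"
  assumes I: "finite I" and endo: "\<And>i. i \<in> I \<Longrightarrow> endomorphism (\<phi> i)"
    and comm: "\<And>i j. i \<in> I \<Longrightarrow> j \<in> I \<Longrightarrow> \<phi> i \<circ> \<phi> j = \<phi> j \<circ> \<phi> i"
  shows "(\<exists>f. f \<noteq> 0 \<and> (\<forall>i\<in>I. dual_map (\<phi> i) f = 0)) \<longleftrightarrow> (\<exists>x. x \<noteq> 0 \<and> (\<forall>i\<in>I. \<phi> i x = 0))"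
proof
  assume "\<exists>f. f \<noteq> 0 \<and> (\<forall>i\<in>I. dual_map (\<phi> i) f = 0)"
  then obtain f where f: "f \<noteq> 0" "\<And>i. i \<in> I \<Longrightarrow> dual_map (\<phi> i) f = 0" by blast
  obtain x where x: "dual_apply f x \<noteq> 1" using f(1) dual_eqI[of f 0] by auto
  have ker: "dual_apply f (\<phi> i y) = 1" if "i \<in> I" for i y
    using f(2)[OF that] dual_apply_dual_map[OF endo[OF that], of f y] by simp
  show "\<exists>x. x \<noteq> 0 \<and> (\<forall>i\<in>I. \<phi> i x = 0)"
    by (rule common_kernel_nonzero[where \<phi> = \<phi> and \<psi> = "dual_apply f", OF I endo comm dual_apply_add dual_apply_0 x ker])
next
  assume "\<exists>x. x \<noteq> 0 \<and> (\<forall>i\<in>I. \<phi> i x = 0)"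
  then obtain x where x: "x \<noteq> 0" "\<And>i. i \<in> I \<Longrightarrow> \<phi> i x = 0" by blast
  obtain f where f: "dual_apply f x \<noteq> 1" using dual_separates_points[OF x(1)] by blast
  have ker: "dual_apply (dual_map (\<phi> i) h) x = 1" if "i \<in> I" for i h
    using x(2)[OF that] endo[OF that] by simp
  show "\<exists>f. f \<noteq> 0 \<and> (\<forall>i\<in>I. dual_map (\<phi> i) f = 0)"
    by (rule common_kernel_nonzero[where \<phi> = "\<lambda>i. dual_map (\<phi> i)" and \<psi> = "\<lambda>f. dual_apply f x" and ?x0.0 = f, OF I])
      (use endo comm f ker in \<open>simp_all add: endomorphism_dual_map dual_map_commute\<close>)
qed

section \<open>One sequence of times for all configurations\<close>

lemma finite_supported_within: "finite {c :: 'a::{zero, finite} config. supported_within D c}"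
proof (rule finite_subset)
  let ?W = "PiE {-D..D} (\<lambda>_. UNIV :: 'a set)"
  show "{c. supported_within D c} \<subseteq> (\<lambda>u i. if i \<in> {-D..D} then u i else 0) ` ?W"
  proof
    fix c :: "'a config" assume "c \<in> {c. supported_within D c}"
    hence "c = (\<lambda>i. if i \<in> {-D..D} then restrict c {-D..D} i else 0)"
      by (force simp: supported_within_def fun_eq_iff abs_le_iff)
    moreover have "restrict c {-D..D} \<in> ?W" by simp
    ultimately show "c \<in> (\<lambda>u i. if i \<in> {-D..D} then u i else 0) ` ?W" by (rule image_eqI)
  qed
qed (simp add: finite_PiE)

text \<open>The index \<open>m\<close> is both window radius and rank bound. A window holds finitely
  many configurations, so \<open>Z m\<close> is a finite union of null sets, and every pair of a
  configuration and a bound is covered from some level on.\<close>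

theorem ca_common_times:
  fixes \<phi> :: "int \<Rightarrow> 'a::{ab_group_add, finite} \<Rightarrow> 'a"
  assumes N: "finite N" and endo: "\<And>i. i \<in> N \<Longrightarrow> endomorphism (\<phi> i)"
    and comm: "\<And>i j. i \<in> N \<Longrightarrow> j \<in> N \<Longrightarrow> \<phi> i \<circ> \<phi> j = \<phi> j \<circ> \<phi> i"
    and two: "\<And>v. v \<noteq> 0 \<Longrightarrow> \<exists>i\<in>N. \<exists>j\<in>N. i \<noteq> j \<and> \<phi> i v \<noteq> 0 \<and> \<phi> j v \<noteq> 0"
  obtains \<tau> :: "nat \<Rightarrow> nat" where "strict_mono \<tau>" "lower_density (range \<tau>) = 1"
    "\<And>c K. finite_config c \<Longrightarrow> c \<noteq> 0 \<Longrightarrow>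
      \<forall>\<^sub>F t in sequentially. config_rank ((ca N \<phi> ^^ \<tau> t) c) > K"
proof -
  define C where "C m = {c :: 'a config. supported_within (int m) c} - {0}" for m
  define Z where "Z m = (\<Union>c\<in>C m. {t. config_rank ((ca N \<phi> ^^ t) c) < m})" for m
  have null: "null_density (Z m)" for m
    unfolding Z_def
  proof (rule null_density_UN)
    show "finite (C m)" unfolding C_def using finite_supported_within by simp
    show "null_density {t. config_rank ((ca N \<phi> ^^ t) c) < m}" if "c \<in> C m" for c
    proof (rule ca_rank_growth[where \<phi> = \<phi>, OF N endo comm two])
      show "finite_config c" "c \<noteq> 0"
        using that supported_within_finite by (auto simp only: C_def)
    qed
  qed
  have mono: "Z m \<subseteq> Z n" if "m \<le> n" for m n
  proof -
    have "C m \<subseteq> C n" using that unfolding C_def supported_within_def by force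
    thus ?thesis using that unfolding Z_def by (fastforce intro: less_le_trans)
  qed
  obtain B where B: "null_density B" "\<And>m. \<forall>\<^sub>F t in sequentially. t \<in> Z m \<longrightarrow> t \<in> B"
    using null_density_diagonal[of Z, OF null mono] by metis
  obtain \<tau> :: "nat \<Rightarrow> nat" where \<tau>: "strict_mono \<tau>" "range \<tau> = - B"
    by (rule null_density_complement_enumerate[OF B(1)])
  show ?thesis
  proof (rule that[OF \<tau>(1)])
    show "lower_density (range \<tau>) = 1" by (simp add: lower_density_eq_1_iff \<tau>(2) B(1))
  next
    fix c :: "'a config" and K assume c: "finite_config c" "c \<noteq> 0"
    obtain D where D: "\<And>D'. D \<le> D' \<Longrightarrow> supported_within D' c"
      using finite_config_supported_within[OF c(1)] by metis
    define m where "m = max (Suc K) (nat D)"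
    have "c \<in> C m" using c(2) D[of "int m"] by (simp add: C_def m_def)
    have "\<forall>\<^sub>F t in sequentially. \<tau> t \<in> Z m \<longrightarrow> \<tau> t \<in> B"
      by (rule eventually_subseq[OF \<tau>(1) B(2)])
    thus "\<forall>\<^sub>F t in sequentially. config_rank ((ca N \<phi> ^^ \<tau> t) c) > K"
    proof (rule eventually_mono)
      fix t assume "\<tau> t \<in> Z m \<longrightarrow> \<tau> t \<in> B"
      moreover have "\<tau> t \<notin> B" using \<tau>(2) by (metis ComplD rangeI)
      ultimately have "\<not> config_rank ((ca N \<phi> ^^ \<tau> t) c) < m"
        using \<open>c \<in> C m\<close> unfolding Z_def by blast
      thus "config_rank ((ca N \<phi> ^^ \<tau> t) c) > K" by (simp add: m_def)
    qed
  qed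
qed

section \<open>The dual automaton acting on characters\<close>

text \<open>With the reflection \<open>k \<mapsto> - k\<close> the dual of a cellular automaton is the one with the adjoint
  coefficients at the same positions.\<close>

definition dual_config ::
    "('g::{ab_group_add, finite, discrete_topology} config \<Rightarrow> complex) \<Rightarrow> 'g dual config" where
  "dual_config \<xi> = (\<lambda>k. Dual (char_component \<xi> (- k)))"

lemma dual_apply_dual_config:
  assumes "character \<xi>"
  shows "dual_apply (dual_config \<xi> k) = char_component \<xi> (- k)"
  unfolding dual_config_def using character_decomposition(1)[OF assms, of "- k"]
  by (intro dual_apply_Dual) (auto simp: character_def)

lemma char_component_eq_dual_apply:
  "character \<xi> \<Longrightarrow> char_component \<xi> k = dual_apply (dual_config \<xi> (- k))"
  by (simp add: dual_apply_dual_config)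

lemma dual_config_support:
  assumes "character \<xi>"
  shows "{k. dual_config \<xi> k \<noteq> 0} = uminus ` {k. char_component \<xi> k \<noteq> (\<lambda>_. 1)}"
proof -
  have "dual_config \<xi> k = 0 \<longleftrightarrow> char_component \<xi> (- k) = (\<lambda>_. 1)" for k
    using dual_apply_inject[of "dual_config \<xi> k" 0] dual_apply_dual_config[OF assms, of k]
    by (auto simp: fun_eq_iff)
  thus ?thesis by (auto intro: image_eqI[of _ uminus "- k" for k])
qed

lemma config_rank_dual_config: "character \<xi> \<Longrightarrow> config_rank (dual_config \<xi>) = char_rank \<xi>"
  unfolding config_rank_def char_rank_def
  by (subst dual_config_support) (auto intro!: card_image inj_onI)

lemma finite_config_dual_config: "character \<xi> \<Longrightarrow> finite_config (dual_config \<xi>)"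
  unfolding finite_config_def
  by (subst dual_config_support) (auto intro!: finite_imageI character_decomposition(2))

lemma dual_config_nonzero:
  assumes "character \<xi>" "\<xi> \<noteq> (\<lambda>_. 1)"
  shows "dual_config \<xi> \<noteq> 0"
proof
  assume "dual_config \<xi> = 0"
  hence "{k. char_component \<xi> k \<noteq> (\<lambda>_. 1)} = {}" using dual_config_support[OF assms(1)] by auto
  hence "\<xi> x = 1" for x using character_decomposition(3)[OF assms(1), of x] by simp
  thus False using assms(2) by auto
qed

lemma character_comp_ca:
  assumes "character \<xi>" "abelian_ca F"
  shows "character (\<xi> \<circ> F)"
proof -
  have "continuous_on UNIV (\<lambda>x. \<xi> (F x))"
    by (rule continuous_on_compose2[of UNIV \<xi>])
      (use assms in \<open>simp_all add: character_def abelian_ca_def\<close>)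
  thus ?thesis using assms by (simp add: character_def abelian_ca_def endomorphism_def comp_def)
qed

lemma character_comp_funpow:
  assumes "character \<xi>" "abelian_ca F"
  shows "character (\<xi> \<circ> F ^^ t)"
  using assms(1)
proof (induction t arbitrary: \<xi>)
  case (Suc t)
  have "\<xi> \<circ> F ^^ Suc t = (\<xi> \<circ> F) \<circ> F ^^ t" by (simp add: comp_assoc)
  thus ?case using Suc.IH[OF character_comp_ca[OF Suc.prems assms(2)]] by simp
qed simp

lemma dual_config_comp_ca:
  assumes \<xi>: "character \<xi>" and F: "abelian_ca (ca N \<phi>)"
    and N: "finite N" and endo: "\<And>i. i \<in> N \<Longrightarrow> endomorphism (\<phi> i)"
  shows "dual_config (\<xi> \<circ> ca N \<phi>) = ca N (\<lambda>i. dual_map (\<phi> i)) (dual_config \<xi>)"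
proof (rule ext, rule dual_eqI)
  fix k g
  \<comment> \<open>An entry at \<open>- k\<close> influences the positions \<open>- k - i\<close>;
    after reflection these are the positions \<open>k + i\<close> read by the dual
    automaton.\<close>
  have "ca N \<phi> (single (- k) g) = (\<Sum>i\<in>N. single (- k - i) (\<phi> i g))"
  proof (rule ext)
    fix z
    show "ca N \<phi> (single (- k) g) z = (\<Sum>i\<in>N. single (- k - i) (\<phi> i g)) z"
      unfolding ca_def sum_fun_apply
      by (intro sum.cong refl) (auto simp: single_def endomorphism_0[OF endo])
  qed
  hence "dual_apply (dual_config (\<xi> \<circ> ca N \<phi>) k) g = (\<Prod>i\<in>N. \<xi> (single (- k - i) (\<phi> i g)))"
    using character_sum[OF \<xi> N] character_comp_ca[OF \<xi> F]
    by (simp add: dual_apply_dual_config char_component_def)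
  also have "\<dots> = (\<Prod>i\<in>N. dual_apply (dual_map (\<phi> i) (dual_config \<xi> (k + i))) g)"
    using endo by (intro prod.cong refl) (simp add: dual_apply_dual_config[OF \<xi>] char_component_def)
  also have "\<dots> = dual_apply (ca N (\<lambda>i. dual_map (\<phi> i)) (dual_config \<xi>) k) g"
  proof -
    have "dual_apply (\<Sum>i\<in>A. f i) g = (\<Prod>i\<in>A. dual_apply (f i) g)" for A :: "int set" and f
      by (induction A rule: infinite_finite_induct) simp_all
    thus ?thesis by (simp add: ca_def)
  qed
  finally show "dual_apply (dual_config (\<xi> \<circ> ca N \<phi>) k) g =
      dual_apply (ca N (\<lambda>i. dual_map (\<phi> i)) (dual_config \<xi>) k) g" .
qed

lemma dual_config_comp_funpow:
  assumes \<xi>: "character \<xi>" and F: "abelian_ca (ca N \<phi>)"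
    and N: "finite N" and endo: "\<And>i. i \<in> N \<Longrightarrow> endomorphism (\<phi> i)"
  shows "dual_config (\<xi> \<circ> ca N \<phi> ^^ t) = (ca N (\<lambda>i. dual_map (\<phi> i)) ^^ t) (dual_config \<xi>)"
proof (induction t)
  case (Suc t)
  have "dual_config (\<xi> \<circ> ca N \<phi> ^^ Suc t) = dual_config ((\<xi> \<circ> ca N \<phi> ^^ t) \<circ> ca N \<phi>)"
    by (simp only: funpow_Suc_right comp_assoc)
  also have "\<dots> = ca N (\<lambda>i. dual_map (\<phi> i)) (dual_config (\<xi> \<circ> ca N \<phi> ^^ t))"
    by (rule dual_config_comp_ca[OF character_comp_funpow[OF \<xi> F] F N endo])
  also have "\<dots> = (ca N (\<lambda>i. dual_map (\<phi> i)) ^^ Suc t) (dual_config \<xi>)"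
    by (simp only: Suc funpow.simps o_apply)
  finally show ?case .
qed simp

section \<open>Fourier coefficients of product measures\<close>

definition bernoulli_product :: "'g pmf \<Rightarrow> 'g config measure" where
  "bernoulli_product p = PiM UNIV (\<lambda>_. measure_pmf p)"

lemma uniform_bernoulli_eq:
  "(uniform_bernoulli :: 'g::finite config measure) = bernoulli_product (pmf_of_set UNIV)"
proof -
  have "uniform_count_measure UNIV = measure_pmf (pmf_of_set (UNIV :: 'g set))"
    by (rule measure_eqI_finite[of _ UNIV])
      (auto simp: sets_uniform_count_measure emeasure_uniform_count_measure emeasure_pmf_single)
  thus ?thesis by (simp add: uniform_bernoulli_def bernoulli_product_def)
qed

lemma sets_bernoulli_product:
  "sets (bernoulli_product p :: 'g::{finite, discrete_topology} config measure) = sets borel"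
proof -
  have "sets (bernoulli_product p) = sets (uniform_bernoulli :: 'g config measure)"
    unfolding bernoulli_product_def uniform_bernoulli_def
    by (rule sets_PiM_cong) (simp_all add: sets_uniform_count_measure)
  thus ?thesis by (simp only: sets_uniform_bernoulli)
qed

lemma borel_probability_bernoulli_product:
  "borel_probability_measure (bernoulli_product p :: 'g::{finite, discrete_topology} config measure)"
  unfolding borel_probability_measure_def
  by (intro conjI sets_bernoulli_product)
    (simp add: bernoulli_product_def prob_space_PiM prob_space_measure_pmf)

text \<open>A character depends on finitely many coordinates, so the integral reduces to a finite
  product space, where it factorizes.\<close>

lemma integral_bernoulli_product_character:
  fixes \<xi> :: "'g::{ab_group_add, finite, discrete_topology} config \<Rightarrow> complex"
  assumes "character \<xi>"
  shows "integral\<^sup>L (bernoulli_product p) \<xi> =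
    (\<Prod>k | char_component \<xi> k \<noteq> (\<lambda>_. 1). \<integral>g. char_component \<xi> k g \<partial>measure_pmf p)"
proof -
  interpret product_prob_space "\<lambda>_::int. measure_pmf p" UNIV
    by (intro product_prob_spaceI prob_space_measure_pmf)
  let ?J = "{k. char_component \<xi> k \<noteq> (\<lambda>_. 1)}" and ?f = "char_component \<xi>"
  let ?M = "\<lambda>_::int. measure_pmf p"
  have J: "finite ?J" by (rule character_decomposition(2)[OF assms])
  have "integral\<^sup>L (bernoulli_product p) \<xi> = (\<integral>x. (\<Prod>k\<in>?J. ?f k (restrict x ?J k)) \<partial>PiM UNIV ?M)"
    unfolding bernoulli_product_def
    by (rule Bochner_Integration.integral_cong[OF refl], subst character_decomposition(3)[OF assms])
      (rule prod.cong, auto)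
  also have "\<dots> = (\<integral>y. (\<Prod>k\<in>?J. ?f k (y k)) \<partial>distr (PiM UNIV ?M) (PiM ?J ?M) (\<lambda>x. restrict x ?J))"
  proof (rule integral_distr[symmetric])
    show "(\<lambda>x. restrict x ?J) \<in> PiM UNIV ?M \<rightarrow>\<^sub>M PiM ?J ?M" by (rule measurable_restrict_subset) simp
    have "(\<lambda>y. ?f k (y k)) \<in> borel_measurable (PiM ?J ?M)" if "k \<in> ?J" for k
      by (rule measurable_compose[OF measurable_component_singleton[OF that]]) simp
    thus "(\<lambda>y. \<Prod>k\<in>?J. ?f k (y k)) \<in> borel_measurable (PiM ?J ?M)" by (rule borel_measurable_prod)
  qed
  also have "\<dots> = (\<integral>y. (\<Prod>k\<in>?J. ?f k (y k)) \<partial>PiM ?J ?M)"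
    by (simp only: distr_PiM_restrict_finite[OF J subset_UNIV])
  also have "\<dots> = (\<Prod>k\<in>?J. \<integral>g. ?f k g \<partial>measure_pmf p)"
    by (intro product_integral_prod J integrable_measure_pmf_finite) simp
  finally show ?thesis .
qed

lemma integral_uniform_bernoulli_character:
  fixes \<xi> :: "'g::{ab_group_add, finite, discrete_topology} config \<Rightarrow> complex"
  assumes \<xi>: "character \<xi>" "\<xi> \<noteq> (\<lambda>_. 1)"
  shows "integral\<^sup>L uniform_bernoulli \<xi> = 0"
proof -
  have "\<exists>k. char_component \<xi> k \<noteq> (\<lambda>_. 1)"
  proof (rule ccontr)
    assume "\<not> ?thesis"
    hence "\<xi> x = 1" for x using character_decomposition(3)[OF \<xi>(1), of x] by simp
    thus False using \<xi>(2) by auto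
  qed
  then obtain k where k: "char_component \<xi> k \<noteq> (\<lambda>_. 1)" by blast
  hence "dual_config \<xi> (- k) \<noteq> 0"
    using char_component_eq_dual_apply[OF \<xi>(1), of k] by (auto simp: fun_eq_iff)
  hence "(\<integral>g. char_component \<xi> k g \<partial>measure_pmf (pmf_of_set UNIV)) = 0"
    by (subst integral_measure_pmf[of UNIV])
      (simp_all add: scaleR_sum_right[symmetric] char_component_eq_dual_apply[OF \<xi>(1)] sum_dual_apply)
  thus ?thesis
    unfolding uniform_bernoulli_eq integral_bernoulli_product_character[OF \<xi>(1)]
    using k character_decomposition(2)[OF \<xi>(1)] by (intro prod_zero) auto
qed

text \<open>As the image of the uniform distribution on pairs of a coin and a group element, it
  turns integrals into finite averages.\<close>

definition lazy_pmf :: "'g::{zero, finite} pmf" where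
  "lazy_pmf = map_pmf (\<lambda>(b, g). if b then 0 else g) (pmf_of_set UNIV)"

lemma integral_lazy_pmf:
  fixes f :: "'g::{ab_group_add, finite} dual"
  assumes "f \<noteq> 0"
  shows "(\<integral>g. dual_apply f g \<partial>measure_pmf lazy_pmf) = 1 / 2"
proof -
  let ?h = "\<lambda>x. dual_apply f (if fst x then 0 else snd x)"
  have "(\<integral>g. dual_apply f g \<partial>measure_pmf lazy_pmf) =
      (\<integral>x. ?h x \<partial>measure_pmf (pmf_of_set (UNIV :: (bool \<times> 'g) set)))"
    by (simp add: lazy_pmf_def integral_map_pmf case_prod_beta)
  also have "\<dots> = (\<Sum>x\<in>UNIV. ?h x) / (2 * of_nat CARD('g))"
    by (subst integral_measure_pmf[of UNIV]) (simp_all add: sum_divide_distrib scaleR_conv_of_real)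
  also have "(\<Sum>x\<in>UNIV. ?h x) = (\<Sum>b\<in>UNIV. \<Sum>g\<in>UNIV. ?h (b, g))"
    unfolding sum.cartesian_product UNIV_Times_UNIV by (intro sum.cong refl) auto
  also have "\<dots> = of_nat CARD('g)" using assms by (simp add: UNIV_bool sum_dual_apply)
  finally show ?thesis by simp
qed

lemma integral_lazy_bernoulli_character:
  fixes \<xi> :: "'g::{ab_group_add, finite, discrete_topology} config \<Rightarrow> complex"
  assumes \<xi>: "character \<xi>"
  shows "integral\<^sup>L (bernoulli_product lazy_pmf) \<xi> = (1 / 2) ^ char_rank \<xi>"
proof -
  have "(\<integral>g. char_component \<xi> k g \<partial>measure_pmf lazy_pmf) = 1 / 2" if "char_component \<xi> k \<noteq> (\<lambda>_. 1)" for k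
  proof -
    have "dual_config \<xi> (- k) \<noteq> 0"
      using char_component_eq_dual_apply[OF \<xi>, of k] that by (auto simp: fun_eq_iff)
    thus ?thesis by (simp add: char_component_eq_dual_apply[OF \<xi>] integral_lazy_pmf)
  qed
  hence "integral\<^sup>L (bernoulli_product lazy_pmf) \<xi> = (\<Prod>k | char_component \<xi> k \<noteq> (\<lambda>_. 1). 1 / 2)"
    unfolding integral_bernoulli_product_character[OF \<xi>] by (intro prod.cong refl) simp_all
  thus ?thesis by (simp add: char_rank_def)
qed

lemma harmonically_mixing_lazy_bernoulli:
  "bernoulli_product lazy_pmf \<in>
    (harmonically_mixing_measures :: 'g::{ab_group_add, finite, discrete_topology} config measure set)"
proof -
  have "harmonically_mixing (bernoulli_product lazy_pmf :: 'g config measure)"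
    unfolding harmonically_mixing_def
  proof (intro allI impI)
    fix \<epsilon> :: real assume "\<epsilon> > 0"
    then obtain R where R: "(1 / 2) ^ R < \<epsilon>" using real_arch_pow_inv[of \<epsilon> "1 / 2"] by auto
    \<comment> \<open>The bound is \<open>Suc R\<close> because harmonic mixing asks for a positive
      threshold.\<close>
    have "norm (integral\<^sup>L (bernoulli_product lazy_pmf) \<xi>) < \<epsilon>"
      if "character \<xi>" "char_rank \<xi> > Suc R" for \<xi> :: "'g config \<Rightarrow> complex"
    proof -
      have "norm (integral\<^sup>L (bernoulli_product lazy_pmf) \<xi>) = (1 / 2) ^ char_rank \<xi>"
        by (simp add: integral_lazy_bernoulli_character[OF that(1)] norm_power norm_divide)
      also have "\<dots> \<le> (1 / 2) ^ R" using that(2) by (intro power_decreasing) auto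
      finally show ?thesis using R by simp
    qed
    thus "\<exists>R>0. \<forall>\<xi>. character \<xi> \<and> char_rank \<xi> > R \<longrightarrow>
        norm (integral\<^sup>L (bernoulli_product lazy_pmf :: 'g config measure) \<xi>) < \<epsilon>"
      by (intro exI[of _ "Suc R"]) simp
  qed
  thus ?thesis by (simp add: harmonically_mixing_measures_def borel_probability_bernoulli_product)
qed

section \<open>Weak-* convergence tested on characters\<close>

definition window_cylinder :: "int set \<Rightarrow> 'g config \<Rightarrow> 'g config set" where
  "window_cylinder W u = {x. \<forall>i\<in>W. x i = u i}"

lemma open_window_cylinder:
  assumes "finite W"
  shows "open (window_cylinder W (u :: 'g::discrete_topology config))"
proof -
  have "open ((\<lambda>x :: 'g config. x i) -` {u i})" for i
    by (intro open_vimage continuous_on_product_coordinates discrete_topology_class.open_discrete)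
  hence "open (\<Inter>i\<in>W. (\<lambda>x :: 'g config. x i) -` {u i})" using assms by (intro open_INT) auto
  moreover have "(\<Inter>i\<in>W. (\<lambda>x. x i) -` {u i}) = window_cylinder W u"
    by (auto simp: window_cylinder_def)
  ultimately show ?thesis by simp
qed

lemma compact_UNIV_config: "compact (UNIV :: 'g::{finite, discrete_topology} config set)"
proof -
  have "compact_space (product_topology (\<lambda>_::int. euclidean :: 'g topology) UNIV)"
    unfolding compact_space_product_topology
    by (intro disjI2 ballI) (simp add: compact_space_def finite_imp_compact)
  thus ?thesis unfolding euclidean_product_topology by (simp add: compact_space_def)
qed

text \<open>Uniform continuity in terms of windows instead of a metric: cylinders on which
  \<open>f\<close> varies little cover the compact space, and the widest window of a finite subcover
  works everywhere.\<close>

lemma window_uniformly_continuous: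
  fixes f :: "'g::{finite, discrete_topology} config \<Rightarrow> real"
  assumes f: "continuous_on UNIV f" and e: "e > 0"
  obtains n :: nat where "\<And>x y. (\<And>i. \<bar>i\<bar> \<le> int n \<Longrightarrow> x i = y i) \<Longrightarrow> \<bar>f x - f y\<bar> < e"
proof -
  have "\<exists>n::nat. \<forall>y. (\<forall>i. \<bar>i\<bar> \<le> int n \<longrightarrow> y i = x i) \<longrightarrow> y \<in> f -` ball (f x) (e / 2)" for x
  proof -
    have "open (f -` ball (f x) (e / 2))" using f by (intro open_vimage) auto
    from open_config_contains_finite_window[OF this, of x] e show ?thesis by (metis centre_in_ball half_gt_zero vimageI2)
  qed
  then obtain m :: "'g config \<Rightarrow> nat"
    where m: "\<And>x y. (\<forall>i. \<bar>i\<bar> \<le> int (m x) \<longrightarrow> y i = x i) \<Longrightarrow> y \<in> f -` ball (f x) (e / 2)"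
    by metis
  let ?W = "\<lambda>x. window_cylinder {- int (m x)..int (m x)} x"
  have "UNIV \<subseteq> (\<Union>x\<in>UNIV. ?W x)" by (auto simp: window_cylinder_def)
  then obtain C where C: "finite C" "UNIV \<subseteq> (\<Union>x\<in>C. ?W x)"
    using compactE_image[OF compact_UNIV_config, of UNIV ?W] by (auto simp: open_window_cylinder)
  define n where "n = Max (insert 0 (m ` C))"
  have n: "m c \<le> n" if "c \<in> C" for c unfolding n_def using C(1) that by (intro Max_ge) auto
  show ?thesis
  proof (rule that[of n])
    fix x y :: "'g config" assume xy: "\<And>i. \<bar>i\<bar> \<le> int n \<Longrightarrow> x i = y i"
    obtain c where c: "c \<in> C" "x \<in> ?W c" using C(2) by blast
    have x: "x i = c i" if "\<bar>i\<bar> \<le> int (m c)" for i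
      using c(2) that by (simp add: window_cylinder_def abs_le_iff)
    have "y i = c i" if "\<bar>i\<bar> \<le> int (m c)" for i
      using x[OF that] xy[of i] n[OF c(1)] that by simp
    hence "y \<in> f -` ball (f c) (e / 2)" by (intro m) blast
    moreover have "x \<in> f -` ball (f c) (e / 2)" using x by (intro m) blast
    ultimately show "\<bar>f x - f y\<bar> < e" unfolding vimage_def mem_Collect_eq mem_ball dist_real_def by linarith
  qed
qed

lemma borel_measurable_of_continuous:
  fixes f :: "'a::topological_space \<Rightarrow> 'b::topological_space"
  assumes "borel_probability_measure \<mu>" "continuous_on UNIV f"
  shows "f \<in> borel_measurable \<mu>"
proof -
  have "borel_measurable \<mu> = (borel_measurable borel :: ('a \<Rightarrow> 'b) set)"
    using assms(1) by (intro measurable_cong_sets refl) (simp add: borel_probability_measure_def)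
  thus ?thesis using assms(2) by (simp add: borel_measurable_continuous_onI)
qed

lemma integrable_continuous:
  fixes f :: "'g::{finite, discrete_topology} config \<Rightarrow> 'b::{banach, second_countable_topology}"
  assumes \<mu>: "borel_probability_measure \<mu>" and f: "continuous_on UNIV f"
  shows "integrable \<mu> f"
proof -
  interpret prob_space \<mu> using \<mu> by (simp add: borel_probability_measure_def)
  have "bounded (range f)"
    using compact_continuous_image[OF f compact_UNIV_config] by (rule compact_imp_bounded)
  then obtain B where "\<And>x. norm (f x) \<le> B" by (auto simp: bounded_iff)
  thus ?thesis
    by (intro integrable_const_bound[of _ B] borel_measurable_of_continuous[OF \<mu> f]) simp
qed

lemma borel_probability_push:
  assumes "borel_probability_measure \<mu>" "continuous_on UNIV F"
  shows "borel_probability_measure (push F \<mu>)"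
proof -
  interpret prob_space \<mu> using assms(1) by (simp add: borel_probability_measure_def)
  show ?thesis unfolding borel_probability_measure_def push_def
    using borel_measurable_of_continuous[OF assms] by (simp add: prob_space_distr)
qed

lemma integral_push:
  fixes f :: "'a::topological_space \<Rightarrow> 'b::{banach, second_countable_topology}"
  assumes "borel_probability_measure \<mu>" "continuous_on UNIV F" "continuous_on UNIV f"
  shows "integral\<^sup>L (push F \<mu>) f = integral\<^sup>L \<mu> (f \<circ> F)"
  unfolding push_def comp_def
  using borel_measurable_of_continuous[OF assms(1,2)] borel_measurable_continuous_onI[OF assms(3)]
  by (rule integral_distr)

definition window_character ::
    "int set \<Rightarrow> (int \<Rightarrow> 'g::ab_group_add dual) \<Rightarrow> 'g config \<Rightarrow> complex" where
  "window_character W f x = (\<Prod>k\<in>W. dual_apply (f k) (x k))"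

lemma character_window_character:
  fixes f :: "int \<Rightarrow> 'g::{ab_group_add, finite, discrete_topology} dual"
  shows "character (window_character W f)"
proof -
  have "continuous_on UNIV (\<lambda>x :: 'g config. dual_apply (f k) (x k))" for k
    by (rule continuous_on_compose2[of UNIV "dual_apply (f k)"])
      (simp_all add: continuous_on_product_coordinates)
  hence "continuous_on UNIV (window_character W f)"
    unfolding window_character_def[abs_def] by (intro continuous_on_prod) simp
  thus ?thesis
    by (simp add: character_def window_character_def prod_norm[symmetric] dual_apply_add prod.distrib)
qed

text \<open>Fourier inversion on a finite window: the orthogonality relation is written at each
  position and the product is multiplied out.\<close>

lemma indicator_window_cylinder:
  fixes u :: "'g::{ab_group_add, finite, discrete_topology} config"
  assumes W: "finite W"
  shows "complex_of_real (indicator (window_cylinder W u) x) =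
    (\<Sum>f\<in>PiE W (\<lambda>_. UNIV). window_character W f (- u) / of_nat CARD('g dual) ^ card W * window_character W f x)"
proof -
  let ?M = "of_nat CARD('g dual) :: complex"
  have "(\<Prod>k\<in>W. \<Sum>f\<in>UNIV. dual_apply f (x k - u k)) =
      (\<Sum>f\<in>PiE W (\<lambda>_. UNIV). \<Prod>k\<in>W. dual_apply (f k) (x k - u k))"
    by (rule prod_sum_PiE[OF W]) simp
  also have "\<dots> = (\<Sum>f\<in>PiE W (\<lambda>_. UNIV). window_character W f (- u) * window_character W f x)"
    by (intro sum.cong refl)
      (simp add: window_character_def prod.distrib[symmetric] dual_apply_add[symmetric])
  finally have eq: "(\<Sum>f\<in>PiE W (\<lambda>_. UNIV). window_character W f (- u) * window_character W f x) =
      (\<Prod>k\<in>W. if x k - u k = 0 then ?M else 0)" by (simp only: sum_over_dual)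
  also have "\<dots> = ?M ^ card W * of_real (indicator (window_cylinder W u) x)"
  proof (cases "x \<in> window_cylinder W u")
    case True
    hence "(\<Prod>k\<in>W. if x k - u k = 0 then ?M else 0) = (\<Prod>k\<in>W. ?M)"
      by (intro prod.cong) (auto simp: window_cylinder_def)
    thus ?thesis using True by simp
  next
    case False
    then obtain k where "k \<in> W" "x k \<noteq> u k" by (auto simp: window_cylinder_def)
    hence "(\<Prod>k\<in>W. if x k - u k = 0 then ?M else 0) = 0" using W by (intro prod_zero) auto
    thus ?thesis using False by simp
  qed
  finally show ?thesis by (simp add: sum_divide_distrib[symmetric] field_simps)
qed

lemma tendsto_measure_window_cylinder:
  fixes u :: "'g::{ab_group_add, finite, discrete_topology} config"
  assumes \<mu>: "\<And>t. borel_probability_measure (\<mu> t)" and \<nu>: "borel_probability_measure \<nu>"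
    and lim: "\<And>\<xi>. character \<xi> \<Longrightarrow> (\<lambda>t. integral\<^sup>L (\<mu> t) \<xi>) \<longlonglongrightarrow> integral\<^sup>L \<nu> \<xi>"
    and W: "finite W"
  shows "(\<lambda>t. measure (\<mu> t) (window_cylinder W u)) \<longlonglongrightarrow> measure \<nu> (window_cylinder W u)"
proof -
  define a where "a f = window_character W f (- u) / of_nat CARD('g dual) ^ card W" for f
  have ch: "character (window_character W f)" for f :: "int \<Rightarrow> 'g dual" by (rule character_window_character)
  have cont: "continuous_on UNIV (window_character W f)" for f :: "int \<Rightarrow> 'g dual"
    using ch by (simp add: character_def)
  have eq: "complex_of_real (measure \<rho> (window_cylinder W u)) =
      (\<Sum>f\<in>PiE W (\<lambda>_. UNIV). a f * integral\<^sup>L \<rho> (window_character W f))"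
    if \<rho>: "borel_probability_measure \<rho>" for \<rho>
  proof -
    interpret prob_space \<rho> using \<rho> by (simp add: borel_probability_measure_def)
    have "window_cylinder W u \<in> sets \<rho>"
      using \<rho> open_window_cylinder[OF W, of u] by (simp add: borel_probability_measure_def)
    hence "complex_of_real (measure \<rho> (window_cylinder W u)) =
        of_real (\<integral>x. indicator (window_cylinder W u) x \<partial>\<rho>)"
      using sets.sets_into_space by (simp add: Int_absorb2)
    also have "\<dots> = (\<integral>x. complex_of_real (indicator (window_cylinder W u) x) \<partial>\<rho>)"
      by (rule integral_complex_of_real[symmetric])
    also have "\<dots> = (\<integral>x. (\<Sum>f\<in>PiE W (\<lambda>_. UNIV). a f * window_character W f x) \<partial>\<rho>)"
      by (simp only: indicator_window_cylinder[OF W] a_def)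
    also have "\<dots> = (\<Sum>f\<in>PiE W (\<lambda>_. UNIV). \<integral>x. a f * window_character W f x \<partial>\<rho>)"
      by (intro Bochner_Integration.integral_sum integrable_mult_right integrable_continuous \<rho> cont)
    also have "\<dots> = (\<Sum>f\<in>PiE W (\<lambda>_. UNIV). a f * integral\<^sup>L \<rho> (window_character W f))"
      by simp
    finally show ?thesis .
  qed
  have "(\<lambda>t. complex_of_real (measure (\<mu> t) (window_cylinder W u)))
      \<longlonglongrightarrow> complex_of_real (measure \<nu> (window_cylinder W u))"
    unfolding eq[OF \<mu>] eq[OF \<nu>] by (intro tendsto_sum tendsto_mult tendsto_const lim ch)
  thus ?thesis by (simp only: tendsto_of_real_iff)
qed

text \<open>Characters span the functions of finitely many coordinates, and these approximate every
  continuous function uniformly.\<close>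

theorem weak_star_limitI_character:
  fixes \<nu> :: "'g::{ab_group_add, finite, discrete_topology} config measure"
  assumes \<mu>: "\<And>t. borel_probability_measure (\<mu> t)" and \<nu>: "borel_probability_measure \<nu>"
    and lim: "\<And>\<xi>. character \<xi> \<Longrightarrow> (\<lambda>t. integral\<^sup>L (\<mu> t) \<xi>) \<longlonglongrightarrow> integral\<^sup>L \<nu> \<xi>"
  shows "weak_star_limit \<mu> \<nu>"
  unfolding weak_star_limit_def
proof (intro allI impI)
  fix f :: "'g config \<Rightarrow> real" assume f: "continuous_on UNIV f"
  show "(\<lambda>t. integral\<^sup>L (\<mu> t) f) \<longlonglongrightarrow> integral\<^sup>L \<nu> f"
  proof (rule tendstoI)
    fix e :: real assume "e > 0"
    hence e: "e / 3 > 0" by simp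
    obtain n where n: "\<And>x y. (\<And>i. \<bar>i\<bar> \<le> int n \<Longrightarrow> x i = y i) \<Longrightarrow> \<bar>f x - f y\<bar> < e / 3"
      using window_uniformly_continuous[OF f e] by metis
    define W where "W = {- int n..int n}"
    have W: "finite W" by (simp add: W_def)
    let ?P = "PiE W (\<lambda>_. UNIV :: 'g set)"
    \<comment> \<open>Outside \<open>W\<close>, \<open>restrict x W\<close> takes the value
      \<open>undefined\<close>. Any fixed filling would do, since \<open>f\<close> varies by less
      than \<open>e / 3\<close> when entries outside the window change.\<close>
    define h where "h x = (\<Sum>u\<in>?P. f u * indicator (window_cylinder W u) x)" for x
    have h: "h x = f (restrict x W)" for x
    proof -
      have "h x = (\<Sum>u\<in>{restrict x W}. f u * indicator (window_cylinder W u) x)"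
        unfolding h_def
      proof (rule sum.mono_neutral_right)
        show "\<forall>u\<in>?P - {restrict x W}. f u * indicator (window_cylinder W u) x = 0"
        proof
          fix u assume u: "u \<in> ?P - {restrict x W}"
          have "\<exists>i\<in>W. x i \<noteq> u i"
          proof (rule ccontr)
            assume "\<not> ?thesis"
            hence "u = restrict x W" using u by (intro extensionalityI[of u W]) (auto simp: PiE_iff)
            with u show False by simp
          qed
          thus "f u * indicator (window_cylinder W u) x = 0" by (auto simp: window_cylinder_def)
        qed
      qed (use W in \<open>auto intro: finite_PiE\<close>)
      also have "\<dots> = f (restrict x W)" by (simp add: window_cylinder_def)
      finally show ?thesis .
    qed
    have close: "\<bar>f x - h x\<bar> \<le> e / 3" for x
      unfolding h by (intro less_imp_le n) (simp add: W_def abs_le_iff)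
    have approx: "\<bar>integral\<^sup>L \<rho> f - integral\<^sup>L \<rho> h\<bar> \<le> e / 3"
      and int_h: "integral\<^sup>L \<rho> h = (\<Sum>u\<in>?P. f u * measure \<rho> (window_cylinder W u))"
      if \<rho>: "borel_probability_measure \<rho>" for \<rho>
    proof -
      interpret prob_space \<rho> using \<rho> by (simp add: borel_probability_measure_def)
      have A: "window_cylinder W u \<in> sets \<rho>" for u
        using \<rho> open_window_cylinder[OF W, of u] by (simp add: borel_probability_measure_def)
      have i: "integrable \<rho> (\<lambda>x. f u * indicator (window_cylinder W u) x)" for u
        by (intro integrable_mult_right integrable_real_indicator A) (simp add: emeasure_eq_measure)
      have ih: "integrable \<rho> h" unfolding h_def[abs_def] by (intro Bochner_Integration.integrable_sum i)
      have "integral\<^sup>L \<rho> h = (\<Sum>u\<in>?P. \<integral>x. f u * indicator (window_cylinder W u) x \<partial>\<rho>)"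
        unfolding h_def[abs_def] by (intro Bochner_Integration.integral_sum i)
      also have "\<dots> = (\<Sum>u\<in>?P. f u * measure \<rho> (window_cylinder W u))"
        using A sets.sets_into_space by (intro sum.cong refl) (simp add: Int_absorb2)
      finally show "integral\<^sup>L \<rho> h = (\<Sum>u\<in>?P. f u * measure \<rho> (window_cylinder W u))" .
      have id: "integrable \<rho> (\<lambda>x. f x - h x)"
        by (intro Bochner_Integration.integrable_diff integrable_continuous[OF \<rho> f] ih)
      have "(\<integral>x. f x - h x \<partial>\<rho>) \<le> e / 3"
        using close by (intro integral_le_const id AE_I2) (simp only: abs_le_iff)
      moreover have "(\<integral>x. f x - h x \<partial>\<rho>) \<ge> - (e / 3)"
        using close by (intro integral_ge_const id AE_I2) (simp only: abs_le_iff minus_le_iff)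
      ultimately show "\<bar>integral\<^sup>L \<rho> f - integral\<^sup>L \<rho> h\<bar> \<le> e / 3"
        by (simp only: abs_le_iff minus_le_iff Bochner_Integration.integral_diff[OF integrable_continuous[OF \<rho> f] ih] simp_thms)
    qed
    have "(\<lambda>t. integral\<^sup>L (\<mu> t) h) \<longlonglongrightarrow> integral\<^sup>L \<nu> h"
      unfolding int_h[OF \<mu>] int_h[OF \<nu>]
      by (intro tendsto_sum tendsto_mult tendsto_const tendsto_measure_window_cylinder \<mu> \<nu> lim W)
    hence "\<forall>\<^sub>F t in sequentially. dist (integral\<^sup>L (\<mu> t) h) (integral\<^sup>L \<nu> h) < e / 3"
      using e by (rule tendstoD)
    thus "\<forall>\<^sub>F t in sequentially. dist (integral\<^sup>L (\<mu> t) f) (integral\<^sup>L \<nu> f) < e"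
    proof (rule eventually_mono)
      fix t assume "dist (integral\<^sup>L (\<mu> t) h) (integral\<^sup>L \<nu> h) < e / 3"
      with approx[OF \<mu>[of t]] approx[OF \<nu>] show "dist (integral\<^sup>L (\<mu> t) f) (integral\<^sup>L \<nu> f) < e"
        unfolding dist_real_def by linarith
    qed
  qed
qed

section \<open>The rank condition in terms of coefficients and its dual form\<close>

lemma config_rank_ca_single:
  assumes endo: "\<And>i. i \<in> N \<Longrightarrow> endomorphism (\<phi> i)" and N: "finite N"
  shows "config_rank (ca N \<phi> (single k g)) = card {i\<in>N. \<phi> i g \<noteq> 0}"
proof -
  have "ca N \<phi> (single k g) z = (if k - z \<in> N then \<phi> (k - z) g else 0)" for z
  proof -
    have "ca N \<phi> (single k g) z = (\<Sum>i\<in>N. if i = k - z then \<phi> i g else 0)"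
      unfolding ca_def by (intro sum.cong refl) (auto simp: single_def endomorphism_0[OF endo])
    thus ?thesis using N by simp
  qed
  hence "{z. ca N \<phi> (single k g) z \<noteq> 0} = (\<lambda>i. k - i) ` {i\<in>N. \<phi> i g \<noteq> 0}"
    by (auto intro: image_eqI[of _ _ "k - z" for z])
  thus ?thesis unfolding config_rank_def by (simp add: card_image inj_on_def)
qed

text \<open>Naming the one position \<open>k\<close> that may survive turns the failure of the
  condition into a common kernel of the remaining coefficients, which is the form that
  dualizes.\<close>

lemma not_two_nonzero_iff:
  "\<not> (\<exists>i\<in>N. \<exists>j\<in>N. i \<noteq> j \<and> f i \<noteq> 0 \<and> f j \<noteq> 0) \<longleftrightarrow> (\<exists>k. \<forall>i\<in>N - {k}. f i = 0)"
  by blast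

lemma two_nonzero_iff_card:
  assumes "finite N"
  shows "(\<exists>i\<in>N. \<exists>j\<in>N. i \<noteq> j \<and> f i \<noteq> 0 \<and> f j \<noteq> 0) \<longleftrightarrow> 2 \<le> card {i\<in>N. f i \<noteq> 0}"
proof -
  have "Suc (Suc 0) \<le> card {i\<in>N. f i \<noteq> 0} \<longleftrightarrow>
      \<not> (\<forall>i\<in>{i\<in>N. f i \<noteq> 0}. \<forall>j\<in>{i\<in>N. f i \<noteq> 0}. i = j)"
    using card_le_Suc0_iff_eq[of "{i\<in>N. f i \<noteq> 0}"] assms by auto
  thus ?thesis unfolding numeral_2_eq_2 by blast
qed

lemma rank_ge_2_iff:
  fixes \<phi> :: "int \<Rightarrow> 'a::ab_group_add \<Rightarrow> 'a"
  assumes endo: "\<And>i. i \<in> N \<Longrightarrow> endomorphism (\<phi> i)" and N: "finite N"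
  shows "(\<forall>c. finite_config c \<and> config_rank c = 1 \<longrightarrow> config_rank (ca N \<phi> c) \<ge> 2) \<longleftrightarrow>
    (\<forall>v. v \<noteq> 0 \<longrightarrow> (\<exists>i\<in>N. \<exists>j\<in>N. i \<noteq> j \<and> \<phi> i v \<noteq> 0 \<and> \<phi> j v \<noteq> 0))"
    (is "?L \<longleftrightarrow> ?R")
proof
  assume L: ?L
  show ?R
  proof (intro allI impI)
    fix v :: 'a assume v: "v \<noteq> 0"
    hence "{i. single 0 v i \<noteq> 0} = {0}" by (auto simp: single_def)
    hence "config_rank (ca N \<phi> (single 0 v)) \<ge> 2"
      using L[rule_format, of "single 0 v"] by (simp add: finite_config_def config_rank_def)
    thus "\<exists>i\<in>N. \<exists>j\<in>N. i \<noteq> j \<and> \<phi> i v \<noteq> 0 \<and> \<phi> j v \<noteq> 0"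
      by (simp only: two_nonzero_iff_card[OF N] config_rank_ca_single[where \<phi> = \<phi>, OF endo N])
  qed
next
  assume R: ?R
  show ?L
  proof (intro allI impI, elim conjE)
    fix c :: "'a config" assume "finite_config c" "config_rank c = 1"
    then obtain k where k: "{i. c i \<noteq> 0} = {k}" unfolding config_rank_def by (auto simp: card_1_singleton_iff)
    hence "c = single k (c k)" by (auto simp: single_def fun_eq_iff)
    hence "config_rank (ca N \<phi> c) = config_rank (ca N \<phi> (single k (c k)))" by (rule arg_cong)
    also have "\<dots> = card {i\<in>N. \<phi> i (c k) \<noteq> 0}" by (rule config_rank_ca_single[OF endo N])
    also have "\<dots> \<ge> 2"
    proof -
      have "c k \<noteq> 0" using k by blast
      from R[rule_format, OF this] show ?thesis by (rule two_nonzero_iff_card[OF N, THEN iffD1])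
    qed
    finally show "config_rank (ca N \<phi> c) \<ge> 2" .
  qed
qed

lemma two_nonzero_dual_iff:
  fixes \<phi> :: "int \<Rightarrow> 'g::{ab_group_add, finite} \<Rightarrow> 'g"
  assumes N: "finite N" and endo: "\<And>i. i \<in> N \<Longrightarrow> endomorphism (\<phi> i)"
    and comm: "\<And>i j. i \<in> N \<Longrightarrow> j \<in> N \<Longrightarrow> \<phi> i \<circ> \<phi> j = \<phi> j \<circ> \<phi> i"
  shows "(\<forall>v. v \<noteq> 0 \<longrightarrow> (\<exists>i\<in>N. \<exists>j\<in>N. i \<noteq> j \<and> \<phi> i v \<noteq> 0 \<and> \<phi> j v \<noteq> 0)) \<longleftrightarrow>
    (\<forall>f. f \<noteq> 0 \<longrightarrow> (\<exists>i\<in>N. \<exists>j\<in>N. i \<noteq> j \<and> dual_map (\<phi> i) f \<noteq> 0 \<and> dual_map (\<phi> j) f \<noteq> 0))"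
    (is "?L \<longleftrightarrow> ?R")
proof -
  have "\<not> ?L \<longleftrightarrow> (\<exists>k. \<exists>v. v \<noteq> 0 \<and> (\<forall>i\<in>N - {k}. \<phi> i v = 0))"
    by (simp only: not_all not_imp not_two_nonzero_iff) blast
  also have "\<dots> \<longleftrightarrow> (\<exists>k. \<exists>f. f \<noteq> 0 \<and> (\<forall>i\<in>N - {k}. dual_map (\<phi> i) f = 0))"
  proof (rule arg_cong[where f = Ex], rule ext)
    fix k
    show "(\<exists>v. v \<noteq> 0 \<and> (\<forall>i\<in>N - {k}. \<phi> i v = 0)) \<longleftrightarrow>
        (\<exists>f. f \<noteq> 0 \<and> (\<forall>i\<in>N - {k}. dual_map (\<phi> i) f = 0))"
      by (rule common_kernel_dual_map_iff[symmetric]) (simp_all add: N endo comm)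
  qed
  also have "\<dots> \<longleftrightarrow> \<not> ?R"
    by (simp only: not_all not_imp not_two_nonzero_iff) blast
  finally show ?thesis by (simp only: simp_thms not_not)
qed

lemma commuting_ca_cases:
  assumes "commuting_endomorphisms F"
  obtains N \<phi> where "finite N" "\<And>i. i \<in> N \<Longrightarrow> endomorphism (\<phi> i)"
    "\<And>i j. i \<in> N \<Longrightarrow> j \<in> N \<Longrightarrow> \<phi> i \<circ> \<phi> j = \<phi> j \<circ> \<phi> i" "F = ca N \<phi>"
proof -
  obtain N \<phi> where *: "finite N" "\<forall>i\<in>N. endomorphism (\<phi> i)"
      "\<forall>x z. F x z = (\<Sum>i\<in>N. \<phi> i (x (z + i)))" "\<forall>i\<in>N. \<forall>j\<in>N. \<phi> i \<circ> \<phi> j = \<phi> j \<circ> \<phi> i"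
    using assms unfolding commuting_endomorphisms_def by (elim exE conjE) simp
  from *(3) have "F = ca N \<phi>" by (simp add: ca_def fun_eq_iff)
  show ?thesis
    by (rule that[OF *(1) bspec[OF *(2)] bspec[OF bspec[OF *(4)]] \<open>F = ca N \<phi>\<close>])
qed

section \<open>Randomization in density\<close>

lemma continuous_funpow_ca:
  assumes "abelian_ca F"
  shows "continuous_on UNIV (F ^^ t)"
proof (induction t)
  case (Suc t)
  have "continuous_on UNIV (\<lambda>x. F ((F ^^ t) x))"
    by (rule continuous_on_compose2[of UNIV F, OF _ Suc]) (use assms in \<open>simp_all add: abelian_ca_def\<close>)
  thus ?case by (simp add: comp_def)
qed (simp add: id_def)

lemma character_continuous: "character \<xi> \<Longrightarrow> continuous_on UNIV \<xi>"
  by (simp add: character_def)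

lemma integral_push_funpow_character:
  assumes "borel_probability_measure \<mu>" "abelian_ca F" "character \<xi>"
  shows "integral\<^sup>L (push (F ^^ t) \<mu>) \<xi> = integral\<^sup>L \<mu> (\<xi> \<circ> F ^^ t)"
  by (rule integral_push[OF assms(1) continuous_funpow_ca[OF assms(2)] character_continuous[OF assms(3)]])

text \<open>The times are chosen from the dual automaton before any measure is considered, so one
  sequence serves all harmonically mixing measures.\<close>

theorem two_nonzero_imp_randomizes_in_density:
  fixes \<phi> :: "int \<Rightarrow> 'g::{ab_group_add, finite, discrete_topology} \<Rightarrow> 'g"
  assumes N: "finite N" and endo: "\<And>i. i \<in> N \<Longrightarrow> endomorphism (\<phi> i)"
    and comm: "\<And>i j. i \<in> N \<Longrightarrow> j \<in> N \<Longrightarrow> \<phi> i \<circ> \<phi> j = \<phi> j \<circ> \<phi> i"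
    and F: "abelian_ca (ca N \<phi>)"
    and two: "\<And>v. v \<noteq> 0 \<Longrightarrow> \<exists>i\<in>N. \<exists>j\<in>N. i \<noteq> j \<and> \<phi> i v \<noteq> 0 \<and> \<phi> j v \<noteq> 0"
  shows "randomizes_in_density (ca N \<phi>) harmonically_mixing_measures"
proof -
  let ?F = "ca N \<phi>"
  have two': "\<exists>i\<in>N. \<exists>j\<in>N. i \<noteq> j \<and> dual_map (\<phi> i) f \<noteq> 0 \<and> dual_map (\<phi> j) f \<noteq> 0" if "f \<noteq> 0" for f
    using iffD1[OF two_nonzero_dual_iff[where \<phi> = \<phi>, OF N endo comm]] two that by simp
  obtain \<tau> :: "nat \<Rightarrow> nat" where \<tau>: "strict_mono \<tau>" "lower_density (range \<tau>) = 1"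
    and rank: "\<And>c K. finite_config c \<Longrightarrow> c \<noteq> 0 \<Longrightarrow>
      \<forall>\<^sub>F t in sequentially. config_rank ((ca N (\<lambda>i. dual_map (\<phi> i)) ^^ \<tau> t) c) > K"
    by (rule ca_common_times[where \<phi> = "\<lambda>i. dual_map (\<phi> i)", OF N endomorphism_dual_map[OF endo]
          dual_map_commute[OF endo endo comm] two']) blast+
  have lim: "weak_star_limit (\<lambda>t. push (?F ^^ \<tau> t) \<mu>) uniform_bernoulli"
    if "\<mu> \<in> harmonically_mixing_measures" for \<mu>
  proof (rule weak_star_limitI_character)
    have \<mu>: "borel_probability_measure \<mu>" and hm: "harmonically_mixing \<mu>"
      using that by (simp_all add: harmonically_mixing_measures_def)
    show push: "borel_probability_measure (push (?F ^^ \<tau> t) \<mu>)" for t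
      by (rule borel_probability_push[OF \<mu> continuous_funpow_ca[OF F]])
    show \<lambda>: "borel_probability_measure (uniform_bernoulli :: 'g config measure)"
      unfolding uniform_bernoulli_eq by (rule borel_probability_bernoulli_product)
    fix \<xi> :: "'g config \<Rightarrow> complex" assume \<xi>: "character \<xi>"
    show "(\<lambda>t. integral\<^sup>L (push (?F ^^ \<tau> t) \<mu>) \<xi>) \<longlonglongrightarrow> integral\<^sup>L uniform_bernoulli \<xi>"
    proof (cases "\<xi> = (\<lambda>_. 1)")
      case True
      have "integral\<^sup>L \<rho> \<xi> = 1" if "borel_probability_measure \<rho>" for \<rho>
        using that by (simp add: True borel_probability_measure_def prob_space.prob_space)
      thus ?thesis by (simp add: push \<lambda>)
    next
      case False
      have "(\<lambda>t. integral\<^sup>L (push (?F ^^ \<tau> t) \<mu>) \<xi>) \<longlonglongrightarrow> 0"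
      proof (rule tendstoI)
        fix e :: real assume "e > 0"
        then obtain R where R: "\<And>\<xi>. character \<xi> \<Longrightarrow> char_rank \<xi> > R \<Longrightarrow> norm (integral\<^sup>L \<mu> \<xi>) < e"
          using hm unfolding harmonically_mixing_def by blast
        have "\<forall>\<^sub>F t in sequentially.
            config_rank ((ca N (\<lambda>i. dual_map (\<phi> i)) ^^ \<tau> t) (dual_config \<xi>)) > R"
          by (rule rank[OF finite_config_dual_config[OF \<xi>] dual_config_nonzero[OF \<xi> False]])
        thus "\<forall>\<^sub>F t in sequentially. dist (integral\<^sup>L (push (?F ^^ \<tau> t) \<mu>) \<xi>) 0 < e"
        proof (rule eventually_mono)
          fix t assume "config_rank ((ca N (\<lambda>i. dual_map (\<phi> i)) ^^ \<tau> t) (dual_config \<xi>)) > R"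
          hence "char_rank (\<xi> \<circ> ?F ^^ \<tau> t) > R"
            using config_rank_dual_config[OF character_comp_funpow[OF \<xi> F, of "\<tau> t"]]
              dual_config_comp_funpow[where \<phi> = \<phi>, OF \<xi> F N endo, of "\<tau> t"] by (simp only:)
          from R[OF character_comp_funpow[OF \<xi> F] this]
          show "dist (integral\<^sup>L (push (?F ^^ \<tau> t) \<mu>) \<xi>) 0 < e"
            by (simp only: integral_push_funpow_character[OF \<mu> F \<xi>] dist_norm diff_zero)
        qed
      qed
      thus ?thesis using integral_uniform_bernoulli_character[OF \<xi> False] by simp
    qed
  qed
  show ?thesis unfolding randomizes_in_density_def using \<tau> lim by blast
qed

text \<open>Cylinders are open and closed, so their indicators are admissible test
  functions.\<close>

lemma randomizes_in_density_imp_on_cylinders_1: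
  fixes F :: "'g::{ab_group_add, finite, discrete_topology} config \<Rightarrow> 'g config"
  assumes F: "abelian_ca F" and rand: "randomizes_in_density F harmonically_mixing_measures"
  shows "randomizes_in_density_on_cylinders_1 F harmonically_mixing_measures"
  unfolding randomizes_in_density_on_cylinders_1_def
proof (intro ballI allI)
  fix \<mu> :: "'g config measure" and u k assume \<mu>: "\<mu> \<in> harmonically_mixing_measures"
  have "\<exists>\<tau>. strict_mono \<tau> \<and> lower_density (range \<tau>) = 1 \<and>
      weak_star_limit (\<lambda>t. push (F ^^ \<tau> t) \<mu>) uniform_bernoulli"
    using rand[unfolded randomizes_in_density_def] \<mu> by (rule bspec)
  then obtain \<tau> where \<tau>: "strict_mono \<tau>" "lower_density (range \<tau>) = 1"
      "weak_star_limit (\<lambda>t. push (F ^^ \<tau> t) \<mu>) uniform_bernoulli" by (elim exE conjE)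
  define f where "f x = (if x k = u then 1 else 0 :: real)" for x :: "'g config"
  have f: "continuous_on UNIV f"
    unfolding f_def
    by (rule continuous_on_compose2[of UNIV "\<lambda>g. if g = u then 1 else 0"])
      (simp_all add: continuous_on_product_coordinates)
  have meas: "measure \<rho> (cylinder [u] k) = integral\<^sup>L \<rho> f" if \<rho>: "borel_probability_measure \<rho>" for \<rho>
  proof -
    have eq: "window_cylinder {k} (\<lambda>_. u) = cylinder [u] k"
      by (auto simp: cylinder_def window_cylinder_def)
    have "cylinder [u] k \<in> sets \<rho>"
      using \<rho> open_window_cylinder[of "{k}" "\<lambda>_. u"] by (simp add: borel_probability_measure_def eq)
    moreover have "f = indicator (cylinder [u] k)"
      by (auto simp: f_def cylinder_def fun_eq_iff indicator_def)
    ultimately show ?thesis using sets.sets_into_space by (simp add: Int_absorb2)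
  qed
  have bp: "borel_probability_measure \<mu>" using \<mu> by (simp add: harmonically_mixing_measures_def)
  have "(\<lambda>t. integral\<^sup>L (push (F ^^ \<tau> t) \<mu>) f) \<longlonglongrightarrow> integral\<^sup>L uniform_bernoulli f"
    using \<tau>(3) f by (simp add: weak_star_limit_def)
  hence "(\<lambda>t. measure (push (F ^^ \<tau> t) \<mu>) (cylinder [u] k))
      \<longlonglongrightarrow> measure uniform_bernoulli (cylinder [u] k)"
    using meas[OF borel_probability_push[OF bp continuous_funpow_ca[OF F]]]
      meas[OF borel_probability_bernoulli_product[of "pmf_of_set UNIV"]]
    by (simp add: uniform_bernoulli_eq)
  with \<tau> show "\<exists>\<tau>. strict_mono \<tau> \<and> lower_density (range \<tau>) = 1 \<and>
      (\<lambda>t. measure (push (F ^^ \<tau> t) \<mu>) (cylinder [u] k)) \<longlonglongrightarrow> measure uniform_bernoulli (cylinder [u] k)"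
    by blast
qed

section \<open>Persistence of rank one and the converse implication\<close>

text \<open>Each step only translates the configuration and applies \<open>\<phi>\<^sub>k\<close> to its one entry.\<close>

lemma config_rank_funpow_le_1:
  fixes \<phi> :: "int \<Rightarrow> 'a::ab_group_add \<Rightarrow> 'a"
  assumes endo: "\<And>i. i \<in> N \<Longrightarrow> endomorphism (\<phi> i)" and N: "finite N"
    and comm: "\<And>i j. i \<in> N \<Longrightarrow> j \<in> N \<Longrightarrow> \<phi> i \<circ> \<phi> j = \<phi> j \<circ> \<phi> i"
    and v: "\<And>i. i \<in> N - {k} \<Longrightarrow> \<phi> i v = 0"
  shows "config_rank ((ca N \<phi> ^^ t) (single z v)) \<le> 1"
proof -
  have step: "ca N \<phi> (single z w) = single (z - k) (if k \<in> N then \<phi> k w else 0)"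
    if w: "\<And>i. i \<in> N - {k} \<Longrightarrow> \<phi> i w = 0" for z w
  proof (rule ext)
    fix y
    have "ca N \<phi> (single z w) y = (\<Sum>i\<in>N. if i = k then (if y = z - k then \<phi> k w else 0) else 0)"
      unfolding ca_def by (intro sum.cong refl) (auto simp: single_def endomorphism_0[OF endo] w)
    thus "ca N \<phi> (single z w) y = single (z - k) (if k \<in> N then \<phi> k w else 0) y"
      using N by (simp add: single_def)
  qed
  have "\<exists>z' w. (ca N \<phi> ^^ t) (single z v) = single z' w \<and> (\<forall>i\<in>N - {k}. \<phi> i w = 0)"
  proof (induction t)
    case 0
    show ?case using v by (intro exI[of _ z] exI[of _ v]) simp
  next
    case (Suc t)
    then obtain z' w where w: "(ca N \<phi> ^^ t) (single z v) = single z' w" "\<And>i. i \<in> N - {k} \<Longrightarrow> \<phi> i w = 0"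
      by blast
    let ?w = "if k \<in> N then \<phi> k w else 0"
    have "\<phi> i ?w = 0" if i: "i \<in> N - {k}" for i
    proof (cases "k \<in> N")
      case True
      have "\<phi> i (\<phi> k w) = \<phi> k (\<phi> i w)" using fun_cong[OF comm[of i k], of w] i True by simp
      thus ?thesis using True w(2)[OF i] by (simp add: endomorphism_0[OF endo[OF True]])
    next
      case False
      thus ?thesis using i endo by (simp add: endomorphism_0)
    qed
    moreover have "(ca N \<phi> ^^ Suc t) (single z v) = single (z' - k) ?w"
      using step[OF w(2)] w(1) by simp
    ultimately show ?case by blast
  qed
  then obtain z' w where "(ca N \<phi> ^^ t) (single z v) = single z' w" by blast
  hence "config_rank ((ca N \<phi> ^^ t) (single z v)) \<le> card {z'}"
    unfolding config_rank_def by (intro card_mono) (auto simp: single_def)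
  thus ?thesis by simp
qed

definition coordinate_character :: "'g::ab_group_add dual \<Rightarrow> 'g config \<Rightarrow> complex" where
  "coordinate_character f x = dual_apply f (x 0)"

lemma character_coordinate_character:
  fixes f :: "'g::{ab_group_add, finite, discrete_topology} dual"
  shows "character (coordinate_character f)"
proof -
  have "coordinate_character f = window_character {0} (\<lambda>_. f)"
    by (simp add: fun_eq_iff coordinate_character_def window_character_def)
  thus ?thesis by (simp only: character_window_character)
qed

lemma dual_config_coordinate_character:
  fixes f :: "'g::{ab_group_add, finite, discrete_topology} dual"
  shows "dual_config (coordinate_character f) = single 0 f"
  by (rule ext, rule dual_eqI)
    (simp add: dual_apply_dual_config[OF character_coordinate_character] char_component_def
      coordinate_character_def single_def)

lemma integral_push_lazy_coordinate_character:
  fixes \<phi> :: "int \<Rightarrow> 'g::{ab_group_add, finite, discrete_topology} \<Rightarrow> 'g"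
  assumes N: "finite N" and endo: "\<And>i. i \<in> N \<Longrightarrow> endomorphism (\<phi> i)" and F: "abelian_ca (ca N \<phi>)"
  shows "integral\<^sup>L (push (ca N \<phi> ^^ t) (bernoulli_product lazy_pmf)) (coordinate_character f) =
    (1 / 2) ^ config_rank ((ca N (\<lambda>i. dual_map (\<phi> i)) ^^ t) (single 0 f))"
proof -
  note ch = character_coordinate_character[of f]
  have "char_rank (coordinate_character f \<circ> ca N \<phi> ^^ t) =
      config_rank ((ca N (\<lambda>i. dual_map (\<phi> i)) ^^ t) (single 0 f))"
    using config_rank_dual_config[OF character_comp_funpow[OF ch F, of t]]
      dual_config_comp_funpow[where \<phi> = \<phi>, OF ch F N endo, of t]
    by (simp only: dual_config_coordinate_character)
  thus ?thesis
    by (simp only: integral_push_funpow_character[OF borel_probability_bernoulli_product F ch]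
        integral_lazy_bernoulli_character[OF character_comp_funpow[OF ch F]])
qed

text \<open>Different cylinders may come with different sequences of times. Translated into null
  sets of exceptions, they can be combined to find one time that is good for all of them.\<close>

lemma null_density_not_eventually_along:
  assumes \<tau>: "strict_mono \<tau>" "lower_density (range \<tau>) = 1"
    and ev: "\<forall>\<^sub>F t in sequentially. P (\<tau> t)"
  shows "null_density {t. \<not> P t}"
proof -
  obtain T where T: "\<And>t. t \<ge> T \<Longrightarrow> P (\<tau> t)" using ev unfolding eventually_sequentially by blast
  have "{t. \<not> P t} \<subseteq> - range \<tau> \<union> {..\<tau> T}"
  proof
    fix s assume s: "s \<in> {t. \<not> P t}"
    show "s \<in> - range \<tau> \<union> {..\<tau> T}"
    proof (cases "s \<in> range \<tau>")
      case True
      then obtain t where t: "s = \<tau> t" by blast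
      hence "t < T" using s T[of t] by (simp add: not_le[symmetric], blast)
      hence "s \<le> \<tau> T" using t strict_mono_less[OF \<tau>(1)] by (simp add: less_imp_le)
      thus ?thesis by simp
    qed simp
  qed
  moreover have "null_density (- range \<tau> \<union> {..\<tau> T})"
    using \<tau>(2) by (intro null_density_Un null_density_atMost) (simp add: lower_density_eq_1_iff)
  ultimately show ?thesis by (rule null_density_mono[rotated])
qed

theorem randomizes_on_cylinders_1_imp_two_nonzero:
  fixes \<phi> :: "int \<Rightarrow> 'g::{ab_group_add, finite, discrete_topology} \<Rightarrow> 'g"
  assumes N: "finite N" and endo: "\<And>i. i \<in> N \<Longrightarrow> endomorphism (\<phi> i)"
    and comm: "\<And>i j. i \<in> N \<Longrightarrow> j \<in> N \<Longrightarrow> \<phi> i \<circ> \<phi> j = \<phi> j \<circ> \<phi> i"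
    and F: "abelian_ca (ca N \<phi>)"
    and rand: "randomizes_in_density_on_cylinders_1 (ca N \<phi>) harmonically_mixing_measures"
    and v: "v \<noteq> 0"
  shows "\<exists>i\<in>N. \<exists>j\<in>N. i \<noteq> j \<and> \<phi> i v \<noteq> 0 \<and> \<phi> j v \<noteq> 0"
proof -
  have "(\<forall>v. v \<noteq> 0 \<longrightarrow> (\<exists>i\<in>N. \<exists>j\<in>N. i \<noteq> j \<and> \<phi> i v \<noteq> 0 \<and> \<phi> j v \<noteq> 0)) \<longleftrightarrow>
      (\<forall>f. f \<noteq> 0 \<longrightarrow> (\<exists>i\<in>N. \<exists>j\<in>N. i \<noteq> j \<and> dual_map (\<phi> i) f \<noteq> 0 \<and> dual_map (\<phi> j) f \<noteq> 0))"
    by (rule two_nonzero_dual_iff[OF N endo comm])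
  moreover have "\<forall>f. f \<noteq> 0 \<longrightarrow> (\<exists>i\<in>N. \<exists>j\<in>N. i \<noteq> j \<and> dual_map (\<phi> i) f \<noteq> 0 \<and> dual_map (\<phi> j) f \<noteq> 0)"
  proof (intro allI impI, rule ccontr)
    fix f :: "'g dual" assume f: "f \<noteq> 0"
    assume "\<not> (\<exists>i\<in>N. \<exists>j\<in>N. i \<noteq> j \<and> dual_map (\<phi> i) f \<noteq> 0 \<and> dual_map (\<phi> j) f \<noteq> 0)"
    hence "\<exists>k. \<forall>i\<in>N - {k}. dual_map (\<phi> i) f = 0" by (simp only: not_two_nonzero_iff)
    then obtain k where "\<forall>i\<in>N - {k}. dual_map (\<phi> i) f = 0" by (rule exE)
    note k = bspec[OF this]
    let ?c = "real CARD('g)"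
    define \<rho> where "\<rho> t = push (ca N \<phi> ^^ t) (bernoulli_product lazy_pmf :: 'g config measure)" for t
    define m where "m t u = measure (\<rho> t) (cylinder [u] 0)" for t u
    have \<rho>: "borel_probability_measure (\<rho> t)" for t
      unfolding \<rho>_def by (intro borel_probability_push borel_probability_bernoulli_product continuous_funpow_ca F)
    have int_m: "integral\<^sup>L (\<rho> t) (coordinate_character f) = (\<Sum>u\<in>UNIV. dual_apply f u * of_real (m t u))" for t
    proof -
      interpret prob_space "\<rho> t" using \<rho> by (simp add: borel_probability_measure_def)
      have eq: "window_cylinder {0} (\<lambda>_. u) = cylinder [u] 0" for u :: 'g
        by (auto simp: cylinder_def window_cylinder_def)
      have A: "cylinder [u] 0 \<in> sets (\<rho> t)" for u
        using \<rho>[of t] open_window_cylinder[of "{0}" "\<lambda>_. u"] by (simp add: borel_probability_measure_def eq)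
      have "coordinate_character f x = (\<Sum>u\<in>UNIV. indicator (cylinder [u] 0) x *\<^sub>R dual_apply f u)" for x
      proof -
        have "(\<Sum>u\<in>UNIV. indicator (cylinder [u] 0) x *\<^sub>R dual_apply f u) =
            (\<Sum>u\<in>UNIV. if u = x 0 then dual_apply f u else 0)"
          by (intro sum.cong refl) (auto simp: cylinder_def)
        thus ?thesis by (simp add: coordinate_character_def)
      qed
      hence "integral\<^sup>L (\<rho> t) (coordinate_character f) =
          (\<integral>x. (\<Sum>u\<in>UNIV. indicator (cylinder [u] 0) x *\<^sub>R dual_apply f u) \<partial>\<rho> t)" by presburger
      also have "\<dots> = (\<Sum>u\<in>UNIV. \<integral>x. indicator (cylinder [u] 0) x *\<^sub>R dual_apply f u \<partial>\<rho> t)"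
        using A by (intro Bochner_Integration.integral_sum integrable_scaleR_left) (simp add: emeasure_eq_measure)
      also have "\<dots> = (\<Sum>u\<in>UNIV. dual_apply f u * of_real (m t u))"
        using A sets.sets_into_space
        by (intro sum.cong refl) (simp add: m_def Int_absorb2 scaleR_conv_of_real mult.commute)
      finally show ?thesis .
    qed
    \<comment> \<open>The tolerance is chosen so that the deviations over all elements of the group
      add up to less than 1/2, the smallest Fourier coefficient of the lazy measure at rank at most
      one.\<close>
    have "null_density {t. \<not> \<bar>m t u - 1 / ?c\<bar> < 1 / (2 * ?c)}" for u
    proof -
      have "\<exists>\<tau>. strict_mono \<tau> \<and> lower_density (range \<tau>) = 1 \<and>
          (\<lambda>t. m (\<tau> t) u) \<longlonglongrightarrow> measure uniform_bernoulli (cylinder [u] 0)"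
        using rand harmonically_mixing_lazy_bernoulli
        unfolding randomizes_in_density_on_cylinders_1_def m_def \<rho>_def by blast
      then obtain \<tau> where \<tau>: "strict_mono \<tau>" "lower_density (range \<tau>) = 1"
        and "(\<lambda>t. m (\<tau> t) u) \<longlonglongrightarrow> measure uniform_bernoulli (cylinder [u] 0)" by blast
      hence "(\<lambda>t. m (\<tau> t) u) \<longlonglongrightarrow> 1 / ?c" by (simp add: measure_uniform_bernoulli_cylinder)
      hence "\<forall>\<^sub>F t in sequentially. dist (m (\<tau> t) u) (1 / ?c) < 1 / (2 * ?c)"
        by (rule tendstoD) simp
      thus ?thesis unfolding dist_real_def
        by (rule null_density_not_eventually_along[OF \<tau>, of "\<lambda>t. \<bar>m t u - 1 / ?c\<bar> < 1 / (2 * ?c)"])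
    qed
    hence "null_density (\<Union>u\<in>UNIV. {t. \<not> \<bar>m t u - 1 / ?c\<bar> < 1 / (2 * ?c)})"
      by (intro null_density_UN) simp_all
    from null_density_frequently[OF this, of 0]
    obtain t where t: "\<And>u. \<bar>m t u - 1 / ?c\<bar> < 1 / (2 * ?c)" by auto
    have "(1 / 2 :: real) \<le> (1 / 2) ^ config_rank ((ca N (\<lambda>i. dual_map (\<phi> i)) ^^ t) (single 0 f))"
      using config_rank_funpow_le_1[where \<phi> = "\<lambda>i. dual_map (\<phi> i)" and k = k and v = f and N = N, of t 0,
          OF endomorphism_dual_map[OF endo] N dual_map_commute[OF endo endo comm] k]
        power_decreasing[of "config_rank ((ca N (\<lambda>i. dual_map (\<phi> i)) ^^ t) (single 0 f))" 1 "1 / 2 :: real"]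
      by simp
    also have "\<dots> = norm (integral\<^sup>L (\<rho> t) (coordinate_character f))"
    proof -
      have "integral\<^sup>L (\<rho> t) (coordinate_character f) =
          (1 / 2) ^ config_rank ((ca N (\<lambda>i. dual_map (\<phi> i)) ^^ t) (single 0 f))"
        unfolding \<rho>_def by (rule integral_push_lazy_coordinate_character[OF N endo F])
      thus ?thesis by (simp add: norm_power norm_divide)
    qed
    \<comment> \<open>The values of a nontrivial character sum to zero, so the uniform mass can be
      subtracted from every cylinder.\<close>
    also have "integral\<^sup>L (\<rho> t) (coordinate_character f) =
        (\<Sum>u\<in>UNIV. dual_apply f u * of_real (m t u - 1 / ?c))"
    proof -
      have "(\<Sum>u\<in>UNIV. dual_apply f u * of_real (1 / ?c)) = 0"
        using sum_dual_apply[OF f] by (simp add: sum_distrib_right[symmetric] sum_divide_distrib[symmetric])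
      thus ?thesis by (simp add: int_m right_diff_distrib sum_subtractf)
    qed
    also have "norm \<dots> \<le> (\<Sum>u\<in>UNIV. norm (dual_apply f u * of_real (m t u - 1 / ?c)))"
      by (rule norm_sum)
    also have "\<dots> = (\<Sum>u\<in>UNIV. \<bar>m t u - 1 / ?c\<bar>)"
      by (intro sum.cong refl) (simp only: norm_mult norm_dual_apply norm_of_real mult_1)
    also have "\<dots> < (\<Sum>u\<in>(UNIV :: 'g set). 1 / (2 * ?c))"
      by (intro sum_strict_mono t) simp_all
    also have "\<dots> = 1 / 2" by simp
    finally show False by simp
  qed
  ultimately show ?thesis using v by simp
qed

section \<open>Failure of strong randomization\<close>

theorem not_strongly_randomizes:
  fixes \<phi> :: "int \<Rightarrow> 'g::{ab_group_add, finite, discrete_topology} \<Rightarrow> 'g"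
  assumes card: "CARD('g) \<ge> 2"
    and N: "finite N" and endo: "\<And>i. i \<in> N \<Longrightarrow> endomorphism (\<phi> i)"
    and comm: "\<And>i j. i \<in> N \<Longrightarrow> j \<in> N \<Longrightarrow> \<phi> i \<circ> \<phi> j = \<phi> j \<circ> \<phi> i"
    and F: "abelian_ca (ca N \<phi>)"
  shows "\<not> strongly_randomizes (ca N \<phi>) harmonically_mixing_measures"
proof
  assume rand: "strongly_randomizes (ca N \<phi>) harmonically_mixing_measures"
  have "\<exists>g :: 'g. g \<noteq> 0"
  proof (rule ccontr)
    assume "\<not> ?thesis"
    hence "(UNIV :: 'g set) = {0}" by auto
    hence "CARD('g) = card {0 :: 'g}" by (rule arg_cong)
    thus False using card by simp
  qed
  then obtain g :: 'g and f0 where "dual_apply f0 g \<noteq> 1" using dual_separates_points by blast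
  hence "f0 \<noteq> 0" by auto
  \<comment> \<open>A character of prime order is chosen so that Frobenius applies to its dual
    configuration.\<close>
  from ex_prime_torsion[OF this] obtain p and f :: "'g dual" where
    p: "prime p" and f: "f \<noteq> 0" "nmult p f = 0" by blast
  let ?\<xi> = "coordinate_character f"
  define \<rho> where "\<rho> t = push (ca N \<phi> ^^ t) (bernoulli_product lazy_pmf :: 'g config measure)" for t
  define r where "r t = config_rank ((ca N (\<lambda>i. dual_map (\<phi> i)) ^^ t) (single 0 f))" for t
  have \<rho>: "borel_probability_measure (\<rho> t)" for t
    unfolding \<rho>_def by (intro borel_probability_push borel_probability_bernoulli_product continuous_funpow_ca F)
  have ch: "character ?\<xi>" by (rule character_coordinate_character)
  have nontriv: "?\<xi> \<noteq> (\<lambda>_. 1)"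
  proof
    assume triv: "?\<xi> = (\<lambda>_. 1)"
    have "dual_apply f g = 1" for g using fun_cong[OF triv, of "single 0 g"]
      by (simp add: coordinate_character_def single_def)
    thus False using f(1) dual_eqI[of f 0] by simp
  qed
  \<comment> \<open>Weak-* convergence is tested on real functions, so the complex character enters
    through its real part.\<close>
  have Re: "continuous_on UNIV (\<lambda>x. Re (?\<xi> x))"
    by (intro continuous_on_Re character_continuous ch)
  have wl: "borel_probability_measure (uniform_bernoulli :: 'g config measure)"
    unfolding uniform_bernoulli_eq by (rule borel_probability_bernoulli_product)
  have int: "(\<integral>x. Re (?\<xi> x) \<partial>M) = Re (integral\<^sup>L M ?\<xi>)" if "borel_probability_measure M" for M
    by (rule integral_Re) (rule integrable_continuous[OF that character_continuous[OF ch]])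
  have "weak_star_limit \<rho> uniform_bernoulli"
    unfolding \<rho>_def[abs_def] using rand harmonically_mixing_lazy_bernoulli
    unfolding strongly_randomizes_def by (rule bspec)
  hence "(\<lambda>t. \<integral>x. Re (?\<xi> x) \<partial>\<rho> t) \<longlonglongrightarrow> (\<integral>x. Re (?\<xi> x) \<partial>uniform_bernoulli)"
    using Re unfolding weak_star_limit_def by blast
  hence "(\<lambda>t. Re (integral\<^sup>L (\<rho> t) ?\<xi>)) \<longlonglongrightarrow> 0"
    by (simp add: int[OF \<rho>] int[OF wl] integral_uniform_bernoulli_character[OF ch nontriv])
  moreover have "integral\<^sup>L (\<rho> t) ?\<xi> = of_real ((1 / 2) ^ r t)" for t
  proof -
    have "integral\<^sup>L (\<rho> t) ?\<xi> = (1 / 2) ^ r t"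
      unfolding \<rho>_def r_def by (rule integral_push_lazy_coordinate_character[OF N endo F])
    thus ?thesis by simp
  qed
  ultimately have lim: "(\<lambda>t. (1 / 2 :: real) ^ r t) \<longlonglongrightarrow> 0" by (simp only: Re_complex_of_real)
  \<comment> \<open>At these times a single entry is merely copied, once per coefficient.\<close>
  have "r (p ^ n) \<le> card N" for n
  proof -
    have "(ca N (\<lambda>i. dual_map (\<phi> i)) ^^ (p ^ n)) (single 0 f) =
        (\<lambda>z. \<Sum>i\<in>N. (dual_map (\<phi> i) ^^ (p ^ n)) (single 0 f (z + int (p ^ n) * i)))"
      by (rule ca_prime_power[OF N endomorphism_dual_map[OF endo] dual_map_commute[OF endo endo comm] p])
        (simp_all add: single_def f)
    moreover have "(\<Sum>i\<in>N. (dual_map (\<phi> i) ^^ (p ^ n)) (single 0 f (z + int (p ^ n) * i))) = 0"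
      if "z \<notin> (\<lambda>i. - (int (p ^ n) * i)) ` N" for z
    proof (rule sum.neutral, rule ballI)
      fix i assume i: "i \<in> N"
      have "z + int (p ^ n) * i \<noteq> 0"
      proof
        assume "z + int (p ^ n) * i = 0"
        hence "z = - (int (p ^ n) * i)" by linarith
        with i that show False by blast
      qed
      thus "(dual_map (\<phi> i) ^^ (p ^ n)) (single 0 f (z + int (p ^ n) * i)) = 0"
        using endomorphism_0[OF endomorphism_funpow[OF endomorphism_dual_map[OF endo[OF i]]]]
        by (simp add: single_def)
    qed
    ultimately have "{z. (ca N (\<lambda>i. dual_map (\<phi> i)) ^^ (p ^ n)) (single 0 f) z \<noteq> 0}
        \<subseteq> (\<lambda>i. - (int (p ^ n) * i)) ` N" by auto
    hence "r (p ^ n) \<le> card ((\<lambda>i. - (int (p ^ n) * i)) ` N)"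
      unfolding r_def config_rank_def using N by (intro card_mono) simp_all
    also have "\<dots> \<le> card N" by (rule card_image_le[OF N])
    finally show ?thesis .
  qed
  hence low: "(1 / 2 :: real) ^ card N \<le> (1 / 2) ^ r (p ^ n)" for n by (intro power_decreasing) auto
  have "strict_mono (\<lambda>n. p ^ n)" using prime_gt_1_nat[OF p] by (intro strict_monoI power_strict_increasing) auto
  from LIMSEQ_subseq_LIMSEQ[OF lim this] have "(\<lambda>n. (1 / 2 :: real) ^ r (p ^ n)) \<longlonglongrightarrow> 0"
    by (simp add: comp_def)
  hence "(1 / 2 :: real) ^ card N \<le> 0" using low by (intro LIMSEQ_le_const) auto
  thus False by (simp add: power_le_zero_eq)
qed

text \<open>Over the trivial group the configuration space is a point and every automaton strongly
  randomizes; hence the first conjunct asks for at least two group elements.\<close>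

theorem theorem3:
  shows "(CARD('g::{ab_group_add, finite, discrete_topology}) \<ge> 2 \<longrightarrow>
            \<not> (\<exists>F :: 'g config \<Rightarrow> 'g config.
                 abelian_ca F \<and> commuting_endomorphisms F \<and>
                 strongly_randomizes F harmonically_mixing_measures))
       \<and> (\<exists>N :: nat. \<forall>F :: 'g config \<Rightarrow> 'g config.
            abelian_ca F \<and> commuting_endomorphisms F \<longrightarrow>
              (randomizes_in_density F harmonically_mixing_measures \<longleftrightarrow>
                 (\<forall>c. finite_config c \<and> config_rank c = 1 \<longrightarrow> config_rank ((F ^^ N) c) \<ge> 2)) \<and>
              ((\<forall>c. finite_config c \<and> config_rank c = 1 \<longrightarrow> config_rank ((F ^^ N) c) \<ge> 2) \<longleftrightarrow>
                 randomizes_in_density_on_cylinders_1 F harmonically_mixing_measures))"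
proof (intro conjI impI exI[of _ 1] allI)
  assume card: "CARD('g) \<ge> 2"
  show "\<not> (\<exists>F :: 'g config \<Rightarrow> 'g config. abelian_ca F \<and> commuting_endomorphisms F \<and>
      strongly_randomizes F harmonically_mixing_measures)"
  proof (intro notI, elim exE conjE)
    fix F :: "'g config \<Rightarrow> 'g config"
    assume F: "abelian_ca F" "commuting_endomorphisms F"
      and rand: "strongly_randomizes F harmonically_mixing_measures"
    from F(2) show False
    proof (rule commuting_ca_cases)
      fix N \<phi>
      assume *: "finite N" "\<And>i. i \<in> N \<Longrightarrow> endomorphism (\<phi> i)"
        "\<And>i j. i \<in> N \<Longrightarrow> j \<in> N \<Longrightarrow> \<phi> i \<circ> \<phi> j = \<phi> j \<circ> \<phi> i" "F = ca N \<phi>"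
      have "\<not> strongly_randomizes (ca N \<phi>) harmonically_mixing_measures"
        by (rule not_strongly_randomizes[OF card *(1-3) F(1)[unfolded *(4)]])
      with rand show False by (simp only: *(4))
    qed
  qed
next
  fix F :: "'g config \<Rightarrow> 'g config"
  assume "abelian_ca F \<and> commuting_endomorphisms F"
  hence F: "abelian_ca F" "commuting_endomorphisms F" by simp_all
  let ?i = "randomizes_in_density F harmonically_mixing_measures"
    and ?ii = "\<forall>c. finite_config c \<and> config_rank c = 1 \<longrightarrow> config_rank ((F ^^ 1) c) \<ge> 2"
    and ?iii = "randomizes_in_density_on_cylinders_1 F harmonically_mixing_measures"
  have "(?ii \<longrightarrow> ?i) \<and> (?iii \<longrightarrow> ?ii)"
    using F(2)
  proof (rule commuting_ca_cases)
    fix N \<phi>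
    assume *: "finite N" "\<And>i. i \<in> N \<Longrightarrow> endomorphism (\<phi> i)"
      "\<And>i j. i \<in> N \<Longrightarrow> j \<in> N \<Longrightarrow> \<phi> i \<circ> \<phi> j = \<phi> j \<circ> \<phi> i" "F = ca N \<phi>"
    note F' = F(1)[unfolded *(4)]
    have ii: "?ii \<longleftrightarrow> (\<forall>v. v \<noteq> 0 \<longrightarrow> (\<exists>i\<in>N. \<exists>j\<in>N. i \<noteq> j \<and> \<phi> i v \<noteq> 0 \<and> \<phi> j v \<noteq> 0))"
    proof -
      have "F ^^ 1 = ca N \<phi>" by (simp add: *(4))
      thus ?thesis by (simp only:) (rule rank_ge_2_iff[OF *(2,1)])
    qed
    show ?thesis
    proof (intro conjI impI)
      assume ?ii
      hence two: "\<exists>i\<in>N. \<exists>j\<in>N. i \<noteq> j \<and> \<phi> i v \<noteq> 0 \<and> \<phi> j v \<noteq> 0" if "v \<noteq> 0" for v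
        using that by (simp only: ii simp_thms)
      show ?i unfolding *(4) by (rule two_nonzero_imp_randomizes_in_density[OF *(1-3) F' two])
    next
      assume ?iii
      hence iii: "randomizes_in_density_on_cylinders_1 (ca N \<phi>) harmonically_mixing_measures"
        by (simp only: *(4))
      show ?ii
        unfolding ii by (intro allI impI randomizes_on_cylinders_1_imp_two_nonzero[OF *(1-3) F' iii])
    qed
  qed
  moreover have "?i \<Longrightarrow> ?iii" by (rule randomizes_in_density_imp_on_cylinders_1[OF F(1)])
  ultimately show "?i \<longleftrightarrow> ?ii" and "?ii \<longleftrightarrow> ?iii" by blast+
qed

end
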